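(* Let $\{k_\theta:\theta\in\Theta\}$, the taper $t_{\beta_0}$, the taper approximations $(\tilde t_{m,\beta_0})_{m\in\mathbb{N}_+}$, the scaled conditional Kullback–Leibler divergences $d_{n,\theta}$, $\tilde d_{n,\theta}$ and the truncated-tapered ML estimators $(\hat\theta_n(k\tilde t))_{n\in\mathbb{N}_+}$ be as in the context. Then, $\mathbb{P}$-almost surely, $$\sup_{\theta\in\Theta}\big|d_{n,\theta}-\tilde d_{n,\theta}\big|\to0\quad\text{as } n\to\infty,$$ and, as $n\to\infty$, $$d_{n,\hat\theta_n(k\tilde t)}=\inf_{\theta\in\Theta}d_{n,\theta}+\delta_n,\qquad\text{where }\delta_n\to0\text{ in }\mathbb{P}\text{-probability}.$$
   Context: Notation. $\mathbb{N}_+=\{1,2,\dots\}$; $\|\cdot\|$ is the Euclidean norm, $\mathrm{B}[0;r]$ the closed ball of radius $r$ in $\mathbb{R}^d$, $\|\cdot\|_\infty$ the supremum norm of a function. Setting. $\Theta\subset\mathbb{R}^p$ is compact and convex, $\theta_0\in\Theta$, and $\{k_\theta:\theta\in\Theta\}$ is a family of (stationary) covariance functions on $\mathbb{R}^d$ (not necessarily compactly supported) such that: for every $s\in\mathbb{R}^d$, $\theta\mapsto k_\theta(s)$ is continuously differentiable; there are constants $A<\infty$, $\alpha>0$ with $|k_\theta(s)|\le A/(1+\|s\|^{d+\alpha})$ and $|\frac{\partial k_\theta}{\partial\theta_i}(s)|\le A/(1+\|s\|^{d+\alpha})$ for all $i=1,\dots,p$, $s\in\mathbb{R}^d$, $\theta\in\Theta$;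 and Fourier inversion holds: $k_\theta(s)=\int_{\mathbb{R}^d}\hat k_\theta(f)e^{\mathrm i\langle f,s\rangle}df$ with $(\theta,f)\mapsto\hat k_\theta(f)$ continuous and strictly positive on $\Theta\times\mathbb{R}^d$. On a probability space $(\Omega,\mathcal F,\mathbb{P})$, $Z=\{Z_s:s\in\mathbb{R}^d\}$ is a real valued, jointly measurable, stationary Gaussian random field with zero mean and covariance function $k_{\theta_0}$. Let $\mathcal Q=[-1,1]^d$ and let $(X_i)_{i\in\mathbb{N}_+}$ be i.i.d. $\mathcal Q$-valued random vectors, independent of $Z$, whose common law has a strictly positive probability density on $\mathcal Q$. Fix $\tau\in[0,1/2)$ and deterministic $v_i\in\mathbb{N}_+^d$ with $\{v_i:1\le i\le I^d\}=\{1,\dots,I\}^d$ for all $I\in\mathbb{N}_+$. Put $S_i=v_i+\tau X_i$, $S_{(n)}=(S_1,\dots,S_n)$, $Z_{(n)}=(Z_{S_1},\dots,Z_{S_n})$, $K_{n,\theta}=[k_\theta(S_i-S_j)]_{1\le i,j\le n}$. Taper. $\Theta'\subset\mathbb{R}^l$ is compact and convex, $\theta_0'\in\Theta'$ is fixed, and $t_{\beta_0}:=t_{\theta'_0}$ belongs to a family of covariance functions (tapers) $\{t_{\theta'}:\theta'\in\Theta'\}$ on $\mathbb{R}^d$ such that: (1) the $t_{\theta'}$ are uniformly bounded, by a constant independent of $\theta'$, with compact supports contained in a common ball $\mathrm B[0;C]$, $C$ independent of $\theta'$; (2) for every $s$ the first order partial derivatives of $\theta'\mapsto t_{\theta'}(s)$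 exist and are continuous in $\theta'$, and as functions of $s$ they are bounded with compact support in a common ball, with bound and ball independent of $\theta'$; (3) $t_{\theta'}(s)=\int_{\mathbb{R}^d}\hat t_{\theta'}(f)e^{\mathrm i\langle f,s\rangle}df$ with $(\theta',f)\mapsto\hat t_{\theta'}(f)$ continuous and strictly positive on $\Theta'\times\mathbb{R}^d$. Here $\beta_0$ is the fixed taper range: $t_{\beta_0}(s)=0$ for $\|s\|\ge\beta_0$. Taper approximation. $(\tilde t_{m,\beta_0})_m:=(\tilde t_{m,\theta_0'})_m$ belongs to a family $\{(\tilde t_{m,\theta'})_{m\in\mathbb{N}_+}:\theta'\in\Theta'\}$ of sequences of real functions on $\mathbb{R}^d$ such that: (1) each $\tilde t_{m,\theta'}$ is Borel measurable and satisfies $\tilde t_{m,\theta'}(s)=\tilde t_{m,\theta'}(-s)$ for all $s$; (2) the $\tilde t_{m,\theta'}$ are bounded with compact supports in a common ball centred at $0$, with bound and ball independent of $m,\theta'$; (3) $\sup_{\theta'\in\Theta'}\|\tilde t_{m,\theta'}-t_{\theta'}\|_\infty\to0$ as $m\to\infty$; (4) for every $s\in\mathbb{R}^d$ and $m$, the first, second and third order partial derivatives of $\theta'\mapsto\tilde t_{m,\theta'}(s)$ exist, and for all $q=1,2,3$ and $i_1,\dots,i_q\in\{1,\dots,l\}$ the functions $\frac{\partial^q\tilde t_{m,\theta'}}{\partial\theta'_{i_1}\cdots\partial\theta'_{i_q}}$ of $s$ are bounded with compact supports in a common ball centred at $0$, with bound and ball independent of $m,\theta'$; (5) for all $q=1,2,3$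 and $i_1,\dots,i_q\in\{1,\dots,l\}$, $\sup_{\theta'\in\Theta'}\big\|\frac{\partial^q\tilde t_{m,\theta'}}{\partial\theta'_{i_1}\cdots\partial\theta'_{i_q}}-\frac{\partial^q t_{\theta'}}{\partial\theta'_{i_1}\cdots\partial\theta'_{i_q}}\big\|_\infty\to0$ as $m\to\infty$ (the partial derivatives of $t_{\theta'}$ occurring here being understood to exist). Fix $r:\mathbb{N}_+\to\mathbb{N}_+$ with $r(n)\to\infty$ as $n\to\infty$. Matrices and divergences. $R_{n,\theta}=[k_\theta(S_i-S_j)\,t_{\beta_0}(S_i-S_j)]_{1\le i,j\le n}$ and $\widetilde R_{n,\theta}=[k_\theta(S_i-S_j)\,\tilde t_{r(n),\beta_0}(S_i-S_j)]_{1\le i,j\le n}$. There is $N\in\mathbb{N}_+$ such that almost surely $\widetilde R_{n,\theta}$ is positive-definite for all $n\ge N$, $\theta\in\Theta$. Define $d_{n,\theta}=\frac1n\log\det(R_{n,\theta}K_{n,\theta_0}^{-1})+\frac1n\mathrm{tr}(K_{n,\theta_0}R_{n,\theta}^{-1})-1$ and, for $n\ge N$, $\tilde d_{n,\theta}=\frac1n\log\det(\widetilde R_{n,\theta}K_{n,\theta_0}^{-1})+\frac1n\mathrm{tr}(K_{n,\theta_0}\widetilde R_{n,\theta}^{-1})-1$. Truncated-tapered ML estimators. For a square symmetric matrix $A$, $\det_+(A)$ is the product of its strictly positive eigenvalues ($=1$ if there are none) and $A^+$ the Moore–Penrose inverse. $(\hat\theta_n(k\tilde t))_n$ is any sequence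 of estimators with $\hat\theta_n(k\tilde t)\in\arg\min_{\theta\in\Theta}\big\{\frac1n\log\det_+(\widetilde R_{n,\theta})+\frac1n\langle Z_{(n)},\widetilde R_{n,\theta}^{+}Z_{(n)}\rangle\big\}$ for every $n$.
   Formalization: Independence of the X_i from Z is taken to mean that Z is jointly measurable with respect to a sub-sigma-algebra independent of the X_i; with independence of the variables Z_s alone, Z could be altered at the random sites S_i without changing its law and the second claim would fail. *)

theory Defs
  imports "HOL-Probability.Probability" "Jordan_Normal_Form.Char_Poly"
begin

text \<open>
  \<open>\<real>\<^sup>d\<close>, \<open>\<real>\<^sup>p\<close>, \<open>\<real>\<^sup>l\<close> are the types \<open>real ^ 'd\<close>, \<open>real ^ 'p\<close>, \<open>real ^ 'l\<close>. Matrices, whose size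
  grows with the sample size, are those of \<open>Jordan_Normal_Form\<close> and are indexed from \<open>0\<close>; sequences
  over the positive integers are functions on \<open>nat\<close> whose value at \<open>0\<close> is never used. Suprema are
  taken in \<open>ereal\<close>, so that they are meaningful without a boundedness proviso.
\<close>

no_notation Matrix.vec_index (infixl "$" 100)
no_notation Matrix.scalar_prod (infix "\<bullet>" 70)

definition covariance_function :: "(real ^ 'd \<Rightarrow> real) \<Rightarrow> bool" where
  "covariance_function c \<longleftrightarrow>
     (\<forall>s. c (- s) = c s) \<and>
     (\<forall>F a. finite F \<longrightarrow> 0 \<le> (\<Sum>s\<in>F. \<Sum>u\<in>F. a s * a u * c (s - u)))"

definition fourier_inversion :: "(real ^ 'd \<Rightarrow> real) \<Rightarrow> (real ^ 'd \<Rightarrow> real) \<Rightarrow> bool" where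
  "fourier_inversion c chat \<longleftrightarrow>
     integrable lborel chat \<and>
     (\<forall>s. complex_of_real (c s) =
       (LINT f|lborel. complex_of_real (chat f) * exp (\<i> * complex_of_real (inner f s))))"

definition positive_spectral_family ::
  "(real ^ 'q) set \<Rightarrow> (real ^ 'q \<Rightarrow> real ^ 'd \<Rightarrow> real) \<Rightarrow> (real ^ 'q \<Rightarrow> real ^ 'd \<Rightarrow> real) \<Rightarrow> bool" where
  "positive_spectral_family T c chat \<longleftrightarrow>
     (\<forall>\<eta>\<in>T. fourier_inversion (c \<eta>) (chat \<eta>)) \<and>
     continuous_on (T \<times> UNIV) (\<lambda>(\<eta>, f). chat \<eta> f) \<and>
     (\<forall>\<eta>\<in>T. \<forall>f. 0 < chat \<eta> f)"

text \<open>
  Parameter sets are compact and convex, and families are given on the parameter set only, so all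
  derivatives with respect to parameters are relative to that set. In its interior they are the
  ordinary ones; where a coordinate line meets the set only in \<open>\<eta>\<close>, \<open>has_partial_derivative\<close>
  holds vacuously, so that continuous differentiability is expressed through \<open>has_gradient_on\<close>.
\<close>

definition has_gradient_on ::
  "(real ^ 'q) set \<Rightarrow> (real ^ 'q \<Rightarrow> real) \<Rightarrow> ('q \<Rightarrow> real ^ 'q \<Rightarrow> real) \<Rightarrow> bool" where
  "has_gradient_on T f D \<longleftrightarrow>
     (\<forall>\<eta>\<in>T. (f has_derivative (\<lambda>h. \<Sum>i\<in>UNIV. D i \<eta> * h $ i)) (at \<eta> within T))"

definition has_partial_derivative ::
  "(real ^ 'q \<Rightarrow> real) \<Rightarrow> 'q \<Rightarrow> real \<Rightarrow> real ^ 'q \<Rightarrow> (real ^ 'q) set \<Rightarrow> bool" where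
  "has_partial_derivative f i D \<eta> T \<longleftrightarrow>
     ((\<lambda>h. f (\<eta> + h *\<^sub>R axis i 1)) has_real_derivative D)
       (at 0 within {h. \<eta> + h *\<^sub>R axis i 1 \<in> T})"

text \<open>\<open>D [i1, \<dots>, iq]\<close> is the iterated partial derivative of \<open>f\<close> in which \<open>i1\<close> is taken last.\<close>

definition iterated_partials ::
  "(real ^ 'q) set \<Rightarrow> nat \<Rightarrow> (real ^ 'q \<Rightarrow> real) \<Rightarrow> ('q list \<Rightarrow> real ^ 'q \<Rightarrow> real) \<Rightarrow> bool" where
  "iterated_partials T q f D \<longleftrightarrow>
     (\<forall>\<eta>\<in>T. D [] \<eta> = f \<eta>) \<and>
     (\<forall>\<eta>\<in>T. \<forall>i is. length is < q \<longrightarrow> has_partial_derivative (D is) i (D (i # is) \<eta>) \<eta> T)"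

definition covariance_model ::
  "(real ^ 'p) set \<Rightarrow> (real ^ 'p \<Rightarrow> real ^ 'd \<Rightarrow> real) \<Rightarrow> ('p \<Rightarrow> real ^ 'p \<Rightarrow> real ^ 'd \<Rightarrow> real) \<Rightarrow>
   (real ^ 'p \<Rightarrow> real ^ 'd \<Rightarrow> real) \<Rightarrow> bool" where
  "covariance_model \<Theta> k dk khat \<longleftrightarrow>
     (\<forall>\<theta>\<in>\<Theta>. covariance_function (k \<theta>)) \<and>
     (\<forall>s. has_gradient_on \<Theta> (\<lambda>\<theta>. k \<theta> s) (\<lambda>i \<theta>. dk i \<theta> s)) \<and>
     (\<forall>s i. continuous_on \<Theta> (\<lambda>\<theta>. dk i \<theta> s)) \<and>
     (\<exists>A \<alpha>. 0 < \<alpha> \<and> (\<forall>\<theta>\<in>\<Theta>. \<forall>s.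
        \<bar>k \<theta> s\<bar> \<le> A / (1 + norm s powr (real CARD('d) + \<alpha>)) \<and>
        (\<forall>i. \<bar>dk i \<theta> s\<bar> \<le> A / (1 + norm s powr (real CARD('d) + \<alpha>))))) \<and>
     positive_spectral_family \<Theta> k khat"

definition bounded_with_support_in :: "real \<Rightarrow> real \<Rightarrow> (real ^ 'd \<Rightarrow> real) \<Rightarrow> bool" where
  "bounded_with_support_in B C f \<longleftrightarrow> (\<forall>s. \<bar>f s\<bar> \<le> B) \<and> closure {s. f s \<noteq> 0} \<subseteq> cball 0 C"

definition taper_family ::
  "(real ^ 'l) set \<Rightarrow> (real ^ 'l \<Rightarrow> real ^ 'd \<Rightarrow> real) \<Rightarrow> ('l list \<Rightarrow> real ^ 'l \<Rightarrow> real ^ 'd \<Rightarrow> real) \<Rightarrow>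
   (real ^ 'l \<Rightarrow> real ^ 'd \<Rightarrow> real) \<Rightarrow> bool" where
  "taper_family \<Theta>' t Dt that \<longleftrightarrow>
     (\<forall>\<eta>\<in>\<Theta>'. covariance_function (t \<eta>)) \<and>
     (\<exists>B C. \<forall>\<eta>\<in>\<Theta>'. bounded_with_support_in B C (t \<eta>)) \<and>
     (\<forall>s. iterated_partials \<Theta>' 1 (\<lambda>\<eta>. t \<eta> s) (\<lambda>is \<eta>. Dt is \<eta> s)) \<and>
     (\<forall>s i. continuous_on \<Theta>' (\<lambda>\<eta>. Dt [i] \<eta> s)) \<and>
     (\<exists>B C. \<forall>\<eta>\<in>\<Theta>'. \<forall>i. bounded_with_support_in B C (Dt [i] \<eta>)) \<and>
     positive_spectral_family \<Theta>' t that"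

definition sup_norm :: "(real ^ 'd \<Rightarrow> real) \<Rightarrow> ereal" where
  "sup_norm f = (SUP s. ereal \<bar>f s\<bar>)"

definition taper_approximation ::
  "(real ^ 'l) set \<Rightarrow> (real ^ 'l \<Rightarrow> real ^ 'd \<Rightarrow> real) \<Rightarrow> ('l list \<Rightarrow> real ^ 'l \<Rightarrow> real ^ 'd \<Rightarrow> real) \<Rightarrow>
   (nat \<Rightarrow> real ^ 'l \<Rightarrow> real ^ 'd \<Rightarrow> real) \<Rightarrow>
   (nat \<Rightarrow> 'l list \<Rightarrow> real ^ 'l \<Rightarrow> real ^ 'd \<Rightarrow> real) \<Rightarrow> bool" where
  "taper_approximation \<Theta>' t Dt ta Dta \<longleftrightarrow>
     (\<forall>m\<ge>1. \<forall>\<eta>\<in>\<Theta>'. ta m \<eta> \<in> borel_measurable borel \<and> (\<forall>s. ta m \<eta> s = ta m \<eta> (- s))) \<and>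
     (\<exists>B C. \<forall>m\<ge>1. \<forall>\<eta>\<in>\<Theta>'. bounded_with_support_in B C (ta m \<eta>)) \<and>
     (\<lambda>m. SUP \<eta>\<in>\<Theta>'. sup_norm (\<lambda>s. ta m \<eta> s - t \<eta> s)) \<longlonglongrightarrow> 0 \<and>
     (\<forall>m\<ge>1. \<forall>s. iterated_partials \<Theta>' 3 (\<lambda>\<eta>. ta m \<eta> s) (\<lambda>is \<eta>. Dta m is \<eta> s)) \<and>
     (\<exists>B C. \<forall>m\<ge>1. \<forall>\<eta>\<in>\<Theta>'. \<forall>is. length is \<in> {1, 2, 3} \<longrightarrow>
        bounded_with_support_in B C (Dta m is \<eta>)) \<and>
     (\<forall>s. iterated_partials \<Theta>' 3 (\<lambda>\<eta>. t \<eta> s) (\<lambda>is \<eta>. Dt is \<eta> s)) \<and>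
     (\<forall>is. length is \<in> {1, 2, 3} \<longrightarrow>
        (\<lambda>m. SUP \<eta>\<in>\<Theta>'. sup_norm (\<lambda>s. Dta m is \<eta> s - Dt is \<eta> s)) \<longlonglongrightarrow> 0)"

text \<open>Point masses count as (degenerate) Gaussian laws.\<close>

definition gaussian_rv :: "'w measure \<Rightarrow> ('w \<Rightarrow> real) \<Rightarrow> bool" where
  "gaussian_rv M Y \<longleftrightarrow>
     Y \<in> borel_measurable M \<and>
     ((\<exists>\<mu> \<sigma>. 0 < \<sigma> \<and> distributed M lborel Y (\<lambda>x. ennreal (normal_density \<mu> \<sigma> x))) \<or>
      (\<exists>\<mu>. AE \<omega> in M. Y \<omega> = \<mu>))"

definition centred_gaussian_field ::
  "'w measure \<Rightarrow> (real ^ 'd \<Rightarrow> 'w \<Rightarrow> real) \<Rightarrow> (real ^ 'd \<Rightarrow> real) \<Rightarrow> bool" where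
  "centred_gaussian_field M Z c \<longleftrightarrow>
     (\<forall>F a. finite F \<longrightarrow> gaussian_rv M (\<lambda>\<omega>. \<Sum>s\<in>F. a s * Z s \<omega>)) \<and>
     (\<forall>s. (LINT \<omega>|M. Z s \<omega>) = 0) \<and>
     (\<forall>s u. (LINT \<omega>|M. Z s \<omega> * Z u \<omega>) = c (s - u))"

text \<open>
  The field is evaluated at random sites, so independence has to refer to a sub-\<open>\<sigma>\<close>-algebra \<open>G\<close> that
  makes it jointly measurable. The \<open>\<sigma>\<close>-algebra generated by the single variables \<open>Z s\<close> would be too
  small: changing \<open>Z s \<omega>\<close> at the sites \<open>s\<close> that are sampled in \<open>\<omega>\<close> can leave every \<open>Z s\<close> unchanged
  almost surely and still change the observations.
\<close>

definition jointly_measurable_indep_field ::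
  "'w measure \<Rightarrow> (real ^ 'd \<Rightarrow> 'w \<Rightarrow> real) \<Rightarrow> (nat \<Rightarrow> 'w \<Rightarrow> real ^ 'd) \<Rightarrow> bool" where
  "jointly_measurable_indep_field M Z X \<longleftrightarrow>
     (\<exists>G. subalgebra M G \<and>
        (\<lambda>(s, \<omega>). Z s \<omega>) \<in> borel_measurable (borel \<Otimes>\<^sub>M G) \<and>
        prob_space.indep_set M (sets G)
          (sets (vimage_algebra (space M) (\<lambda>\<omega>. \<lambda>i\<in>{1..}. X i \<omega>) (\<Pi>\<^sub>M i\<in>{1..}. borel))))"

definition unit_cube :: "(real ^ 'd) set" where
  "unit_cube = {x. \<forall>j. x $ j \<in> {-1..1}}"

definition iid_in_unit_cube :: "'w measure \<Rightarrow> (nat \<Rightarrow> 'w \<Rightarrow> real ^ 'd) \<Rightarrow> bool" where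
  "iid_in_unit_cube M X \<longleftrightarrow>
     prob_space.indep_vars M (\<lambda>_. borel) X {1..} \<and>
     (\<forall>i\<ge>1. \<forall>\<omega>\<in>space M. X i \<omega> \<in> unit_cube) \<and>
     (\<exists>g. (\<forall>x\<in>unit_cube. 0 < g x) \<and>
          (\<forall>i\<ge>1. distributed M lborel (X i) (\<lambda>x. ennreal (g x))))"

definition enumerates_grid :: "(nat \<Rightarrow> real ^ 'd) \<Rightarrow> bool" where
  "enumerates_grid v \<longleftrightarrow>
     (\<forall>I\<ge>1. v ` {1..I ^ CARD('d)} = {x. \<forall>j. x $ j \<in> real ` {1..I}})"

definition tendsto_in_prob :: "'w measure \<Rightarrow> (nat \<Rightarrow> 'w \<Rightarrow> real) \<Rightarrow> real \<Rightarrow> bool" where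
  "tendsto_in_prob M Y c \<longleftrightarrow>
     (\<forall>n. Y n \<in> borel_measurable M) \<and>
     (\<forall>\<epsilon>>0. (\<lambda>n. measure M {\<omega> \<in> space M. \<epsilon> < \<bar>Y n \<omega> - c\<bar>}) \<longlonglongrightarrow> 0)"

definition cov_mat :: "nat \<Rightarrow> (real ^ 'd \<Rightarrow> real) \<Rightarrow> (nat \<Rightarrow> real ^ 'd) \<Rightarrow> real mat" where
  "cov_mat n c S = Matrix.mat n n (\<lambda>(i, j). c (S (Suc i) - S (Suc j)))"

definition positive_definite :: "real mat \<Rightarrow> bool" where
  "positive_definite A \<longleftrightarrow>
     square_mat A \<and> transpose_mat A = A \<and>
     (\<forall>x\<in>carrier_vec (dim_row A). x \<noteq> 0\<^sub>v (dim_row A) \<longrightarrow> 0 < scalar_prod x (A *\<^sub>v x))"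

definition mat_trace :: "real mat \<Rightarrow> real" where
  "mat_trace A = (\<Sum>i<dim_row A. A $$ (i, i))"

text \<open>Unspecified for singular matrices.\<close>

definition inv_mat :: "real mat \<Rightarrow> real mat" where
  "inv_mat A = the (mat_inverse A)"

text \<open>Eigenvalues are counted with multiplicity; the empty product is \<open>1\<close>.\<close>

definition det_plus :: "real mat \<Rightarrow> real" where
  "det_plus A = (\<Prod>x | eigenvalue A x \<and> 0 < x. x ^ Polynomial.order x (char_poly A))"

definition is_moore_penrose :: "real mat \<Rightarrow> real mat \<Rightarrow> bool" where
  "is_moore_penrose A B \<longleftrightarrow>
     B \<in> carrier_mat (dim_col A) (dim_row A) \<and>
     A * B * A = A \<and> B * A * B = B \<and>
     transpose_mat (A * B) = A * B \<and> transpose_mat (B * A) = B * A"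

definition moore_penrose :: "real mat \<Rightarrow> real mat" where
  "moore_penrose A = (THE B. is_moore_penrose A B)"

definition scaled_kl :: "nat \<Rightarrow> real mat \<Rightarrow> real mat \<Rightarrow> real" where
  "scaled_kl n K R =
     1 / real n * ln (Determinant.det (R * inv_mat K)) +
     1 / real n * mat_trace (K * inv_mat R) - 1"

definition truncated_likelihood :: "nat \<Rightarrow> real mat \<Rightarrow> real Matrix.vec \<Rightarrow> real" where
  "truncated_likelihood n R z =
     1 / real n * ln (det_plus R) + 1 / real n * scalar_prod z (moore_penrose R *\<^sub>v z)"

end

theory Submission
  imports Defs
begin

text \<open>
  For every outcome the sites stay within distance \<open>\<tau> < 1/2\<close>, in each coordinate, of distinct
  integer points. The matrix estimates below hold for all such configurations, uniformly in the
  sample size and in \<open>\<theta>\<close>; chance enters only through one law of large numbers.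

  The basic estimate is a positive lower bound for the eigenvalues. A continuous positive spectral
  density dominates a multiple of a product of tent functions on a cube. The transform of that
  product is a Fejer kernel, which decays quadratically in every coordinate, so if the cube is large
  then its matrix at the sites is diagonally dominant (\<open>spectral_lower_bound\<close>). This is applied to
  the taper and to \<open>k \<theta>0\<close>. From the taper the bound passes to the tapered covariances by a Schur
  product argument: averaging over the spectral density of \<open>k \<theta>\<close>, one sees that multiplying the
  entries by \<open>k \<theta>\<close> costs no more than the factor \<open>k \<theta> 0\<close> (\<open>schur_product_lower_bound\<close>), which is
  bounded away from \<open>0\<close> on the compact set \<open>\<Theta>\<close>.

  Compactly supported functions have boundedly many nonzero entries in each row, so replacing the
  taper by its approximation changes the matrices by some \<open>\<epsilon>\<close> tending to \<open>0\<close> in operator norm.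
  Their inverses then move by \<open>O(\<epsilon>)\<close> (\<open>inverse_perturbation\<close>). The logarithm of the determinant
  moves by \<open>O(n \<epsilon>)\<close>, since the eigenvalues of one matrix relative to the other lie within \<open>O(\<epsilon>)\<close>
  of \<open>1\<close> (\<open>log_det_perturbation\<close>), and the trace term by \<open>O(n \<epsilon>)\<close>, by the spectral representation
  once more (\<open>trace_bound\<close>). This is the first limit. The same estimates show that the tapered
  divergence depends continuously on \<open>\<theta>\<close>.

  For the second limit, fix the sites. Up to a term that does not depend on \<open>\<theta>\<close>, the divergence is
  the mean of the likelihood, and the deviation from the mean is
  \<open>(\<langle>z, B z\<rangle> - tr (B K)) / n\<close> with \<open>B\<close> the inverse of the tapered matrix. By Isserlis' formula its
  variance is \<open>2 tr (B K B K) / n\<^sup>2\<close>, which is at most a constant times the sum of the squared entries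
  of \<open>K\<close> divided by \<open>n\<^sup>2\<close> (\<open>quadratic_form_variance\<close>), and this tends to \<open>0\<close> because the covariance
  vanishes at infinity (\<open>sum_squares_decay\<close>). Averaging over the sites is Fubini's theorem
  (\<open>nn_integral_independent_bound\<close>). A finite net of \<open>\<Theta>\<close> together with a Lipschitz bound makes the
  convergence uniform in \<open>\<theta>\<close>, and a minimizer of the likelihood nearly minimizes every function that
  is uniformly close to it up to a constant (\<open>near_minimizer_deterministic\<close>).
\<close>

section \<open>Quadratic forms and spectral densities\<close>

definition quadratic_form :: "nat \<Rightarrow> (nat \<Rightarrow> nat \<Rightarrow> real) \<Rightarrow> (nat \<Rightarrow> real) \<Rightarrow> real" where
  "quadratic_form n E y = (\<Sum>i<n. \<Sum>j<n. E i j * y i * y j)"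

definition sq_norm :: "nat \<Rightarrow> (nat \<Rightarrow> real) \<Rightarrow> real" where
  "sq_norm n y = (\<Sum>i<n. (y i)\<^sup>2)"

lemma sq_norm_nonneg: "0 \<le> sq_norm n y"
  unfolding sq_norm_def by (intro sum_nonneg) auto

text \<open>
  The real part of Fourier inversion, all that real quadratic forms can see. It is stated for every
  Euclidean space because it is also applied to kernels that are not covariance functions.
\<close>

definition cosine_transform :: "('a::euclidean_space \<Rightarrow> real) \<Rightarrow> ('a \<Rightarrow> real) \<Rightarrow> bool" where
  "cosine_transform c chat \<longleftrightarrow>
     integrable lborel chat \<and> (\<forall>s. c s = (LINT f|lborel. chat f * cos (inner f s)))"

lemma cosine_transform_integrable:
  assumes "cosine_transform c chat"
  shows "integrable lborel (\<lambda>f. chat f * cos (inner f s))"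
proof -
  have ic: "integrable lborel chat"
    using assms by (simp add: cosine_transform_def)
  show ?thesis
    by (rule Bochner_Integration.integrable_bound[OF ic])
       (use ic in \<open>auto simp: abs_mult mult_left_le\<close>)
qed

lemma fourier_inversion_cosine_transform:
  assumes "fourier_inversion c chat"
  shows "cosine_transform c chat"
  unfolding cosine_transform_def
proof (intro conjI allI)
  show ic: "integrable lborel chat"
    using assms by (simp add: fourier_inversion_def)
  fix s
  have int: "integrable lborel (\<lambda>f. complex_of_real (chat f) * exp (\<i> * complex_of_real (inner f s)))"
    by (rule Bochner_Integration.integrable_bound[OF ic]) (use ic in \<open>auto simp: norm_mult\<close>)
  have re: "Re (complex_of_real (chat f) * exp (\<i> * complex_of_real (inner f s))) = chat f * cos (inner f s)" for f
    by (simp add: Re_exp)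
  have "complex_of_real (c s) = (LINT f|lborel. complex_of_real (chat f) * exp (\<i> * complex_of_real (inner f s)))"
    using assms by (simp add: fourier_inversion_def)
  then have "c s = Re (LINT f|lborel. complex_of_real (chat f) * exp (\<i> * complex_of_real (inner f s)))"
    by (metis Re_complex_of_real)
  also have "\<dots> = (LINT f|lborel. chat f * cos (inner f s))"
    using integral_Re[OF int, symmetric] unfolding re .
  finally show "c s = (LINT f|lborel. chat f * cos (inner f s))" .
qed

text \<open>
  The addition theorem for the cosine: multiplying the entries of a matrix by
  \<open>cos \<langle>f, s i - s j\<rangle>\<close> amounts to evaluating the form at two modulated vectors, whose squared norms
  add up to that of the original vector.
\<close>

lemma quadratic_form_modulate:
  "quadratic_form n (\<lambda>i j. E i j * cos (inner f (s i - s j))) y =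
     quadratic_form n E (\<lambda>i. cos (inner f (s i)) * y i) + quadratic_form n E (\<lambda>i. sin (inner f (s i)) * y i)"
  unfolding quadratic_form_def sum.distrib[symmetric] inner_diff_right cos_diff
  by (simp only: distrib_left distrib_right mult_ac)

lemma sq_norm_modulate:
  "sq_norm n (\<lambda>i. cos (a i) * y i) + sq_norm n (\<lambda>i. sin (a i) * y i) = sq_norm n y"
  by (simp add: sq_norm_def sum.distrib[symmetric] power_mult_distrib distrib_right[symmetric])

lemma quadratic_form_fourier:
  assumes "cosine_transform c chat"
  shows "quadratic_form n (\<lambda>i j. E i j * c (s i - s j)) y =
      (LINT f|lborel. chat f * quadratic_form n (\<lambda>i j. E i j * cos (inner f (s i - s j))) y)"
    and "integrable lborel (\<lambda>f. chat f * quadratic_form n (\<lambda>i j. E i j * cos (inner f (s i - s j))) y)"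
proof -
  have eq: "chat f * quadratic_form n (\<lambda>i j. E i j * cos (inner f (s i - s j))) y =
     (\<Sum>i<n. \<Sum>j<n. E i j * y i * y j * (chat f * cos (inner f (s i - s j))))" for f
    unfolding quadratic_form_def by (simp add: sum_distrib_left algebra_simps)
  have F: "integrable lborel (\<lambda>f. chat f * cos (inner f u))" "c u = (LINT f|lborel. chat f * cos (inner f u))" for u
    using cosine_transform_integrable[OF assms] assms by (auto simp: cosine_transform_def)
  show "integrable lborel (\<lambda>f. chat f * quadratic_form n (\<lambda>i j. E i j * cos (inner f (s i - s j))) y)"
    unfolding eq by (intro Bochner_Integration.integrable_sum integrable_mult_right F)
  have coeff: "(LINT f|lborel. a * (chat f * cos (inner f u))) = a * c u" for a u
    by (simp only: integral_mult_right_zero F(2)[of u])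
  show "quadratic_form n (\<lambda>i j. E i j * c (s i - s j)) y =
      (LINT f|lborel. chat f * quadratic_form n (\<lambda>i j. E i j * cos (inner f (s i - s j))) y)"
    unfolding eq
    by (subst Bochner_Integration.integral_sum, intro Bochner_Integration.integrable_sum integrable_mult_right F,
        subst Bochner_Integration.integral_sum, intro integrable_mult_right F)
       (simp only: coeff quadratic_form_def, simp only: mult_ac)
qed

text \<open>
  At every frequency the form of the modulated matrix is bounded below by the same multiple of
  \<open>sq_norm n y\<close> as that of \<open>E\<close>; integration against \<open>chat\<close> replaces the modulation by \<open>c\<close> and yields
  the total mass \<open>c 0\<close> of \<open>chat\<close>. The constant may be negative, which is how two-sided bounds are
  obtained.
\<close>

lemma schur_product_lower_bound:
  assumes F: "cosine_transform c chat" and pos: "\<And>f. 0 \<le> chat f"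
    and low: "\<And>y. \<mu> * sq_norm n y \<le> quadratic_form n E y"
  shows "\<mu> * c 0 * sq_norm n y \<le> quadratic_form n (\<lambda>i j. E i j * c (s i - s j)) y"
proof -
  have ic: "integrable lborel chat"
    using F by (simp add: cosine_transform_def)
  have c0: "c 0 = (LINT f|lborel. chat f)"
    using F by (simp add: cosine_transform_def)
  have "\<mu> * sq_norm n y * c 0 = (LINT f|lborel. chat f * (\<mu> * sq_norm n y))"
    unfolding c0 by (simp add: mult.commute)
  also have "\<dots> \<le> (LINT f|lborel. chat f * quadratic_form n (\<lambda>i j. E i j * cos (inner f (s i - s j))) y)"
  proof (rule integral_mono[OF _ quadratic_form_fourier(2)[OF F]])
    show "integrable lborel (\<lambda>f. chat f * (\<mu> * sq_norm n y))"
      by (rule integrable_mult_left[OF ic])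
    fix f
    have "\<mu> * sq_norm n y = \<mu> * sq_norm n (\<lambda>i. cos (inner f (s i)) * y i) + \<mu> * sq_norm n (\<lambda>i. sin (inner f (s i)) * y i)"
      by (simp add: sq_norm_modulate[symmetric, of n y "\<lambda>i. inner f (s i)"] distrib_left)
    also have "\<dots> \<le> quadratic_form n (\<lambda>i j. E i j * cos (inner f (s i - s j))) y"
      unfolding quadratic_form_modulate by (intro add_mono low)
    finally show "chat f * (\<mu> * sq_norm n y) \<le> chat f * quadratic_form n (\<lambda>i j. E i j * cos (inner f (s i - s j))) y"
      by (intro mult_left_mono pos)
  qed
  also have "\<dots> = quadratic_form n (\<lambda>i j. E i j * c (s i - s j)) y"
    by (rule quadratic_form_fourier(1)[OF F, symmetric])
  finally show ?thesis by (simp add: algebra_simps)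
qed

lemma quadratic_form_uminus: "quadratic_form n (\<lambda>i j. - E i j) y = - quadratic_form n E y"
  by (simp add: quadratic_form_def sum_negf)

text \<open>
  The trace of the product with a covariance matrix is the form of the entrywise product at the
  vector of ones, so the Schur product bound controls it by \<open>n\<close> and \<open>c 0\<close> alone, without a bound on
  the norm of the covariance matrix.
\<close>

lemma trace_bound:
  assumes F: "cosine_transform c chat" and pos: "\<And>f. 0 \<le> chat f"
    and bd: "\<And>y. \<bar>quadratic_form n E y\<bar> \<le> \<epsilon> * sq_norm n y"
  shows "\<bar>\<Sum>i<n. \<Sum>j<n. E i j * c (s i - s j)\<bar> \<le> \<epsilon> * c 0 * real n"
proof -
  have 1: "- \<epsilon> * sq_norm n y \<le> quadratic_form n E y" for y
    using bd[of y] by linarith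
  have 2: "- \<epsilon> * sq_norm n y \<le> quadratic_form n (\<lambda>i j. - E i j) y" for y
    using bd[of y] by (simp add: quadratic_form_uminus)
  have "- \<epsilon> * c 0 * real n \<le> (\<Sum>i<n. \<Sum>j<n. E i j * c (s i - s j))"
    using schur_product_lower_bound[OF F pos 1, of "\<lambda>_. 1" s]
    by (simp add: quadratic_form_def sq_norm_def)
  moreover have "- \<epsilon> * c 0 * real n \<le> - (\<Sum>i<n. \<Sum>j<n. E i j * c (s i - s j))"
    using schur_product_lower_bound[OF F pos 2, of "\<lambda>_. 1" s]
    by (simp add: quadratic_form_def sq_norm_def sum_negf)
  ultimately show ?thesis by linarith
qed

text \<open>
  The Schur test, through \<open>2 \<bar>x y\<bar> \<le> x\<^sup>2 + y\<^sup>2\<close>. The mean of the squared norms stands in for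
  the product of the norms, which avoids square roots.
\<close>

lemma bilinear_row_sum_bound:
  assumes "\<And>i. i < n \<Longrightarrow> (\<Sum>j<n. \<bar>E i j\<bar>) \<le> \<epsilon>" and "\<And>j. j < n \<Longrightarrow> (\<Sum>i<n. \<bar>E i j\<bar>) \<le> \<epsilon>"
  shows "\<bar>\<Sum>i<n. \<Sum>j<n. E i j * x i * y j\<bar> \<le> \<epsilon> * (sq_norm n x + sq_norm n y) / 2"
proof -
  have "\<bar>E i j * x i * y j\<bar> \<le> \<bar>E i j\<bar> * (x i)\<^sup>2 / 2 + \<bar>E i j\<bar> * (y j)\<^sup>2 / 2" for i j
  proof -
    have "0 \<le> (\<bar>x i\<bar> - \<bar>y j\<bar>)\<^sup>2" by simp
    then have "\<bar>x i\<bar> * \<bar>y j\<bar> \<le> ((x i)\<^sup>2 + (y j)\<^sup>2) / 2"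
      by (simp add: power2_diff)
    from mult_left_mono[OF this, of "\<bar>E i j\<bar>"] show ?thesis
      by (simp add: abs_mult algebra_simps add_divide_distrib)
  qed
  then have "\<bar>\<Sum>i<n. \<Sum>j<n. E i j * x i * y j\<bar> \<le> (\<Sum>i<n. \<Sum>j<n. \<bar>E i j\<bar> * (x i)\<^sup>2 / 2 + \<bar>E i j\<bar> * (y j)\<^sup>2 / 2)"
    by (intro order_trans[OF sum_abs] sum_mono)
  also have "\<dots> = (\<Sum>i<n. (\<Sum>j<n. \<bar>E i j\<bar>) * ((x i)\<^sup>2 / 2)) + (\<Sum>i<n. \<Sum>j<n. \<bar>E i j\<bar> * ((y j)\<^sup>2 / 2))"
    by (simp add: sum.distrib sum_distrib_right sum_divide_distrib)
  also have "(\<Sum>i<n. \<Sum>j<n. \<bar>E i j\<bar> * ((y j)\<^sup>2 / 2)) = (\<Sum>j<n. (\<Sum>i<n. \<bar>E i j\<bar>) * ((y j)\<^sup>2 / 2))"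
    by (subst sum.swap) (simp add: sum_distrib_right sum_divide_distrib)
  also have "(\<Sum>i<n. (\<Sum>j<n. \<bar>E i j\<bar>) * ((x i)\<^sup>2 / 2)) + \<dots> \<le> (\<Sum>i<n. \<epsilon> * ((x i)\<^sup>2 / 2)) + (\<Sum>j<n. \<epsilon> * ((y j)\<^sup>2 / 2))"
    by (intro add_mono sum_mono mult_right_mono assms) auto
  also have "\<dots> = \<epsilon> * (sq_norm n x + sq_norm n y) / 2"
    by (simp add: sq_norm_def sum_distrib_left add_divide_distrib distrib_left sum_divide_distrib)
  finally show ?thesis .
qed

lemma gershgorin_lower_bound:
  assumes diag: "\<And>i. i < n \<Longrightarrow> a \<le> E i i"
    and sym: "\<And>i j. i < n \<Longrightarrow> j < n \<Longrightarrow> E i j = E j i"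
    and off: "\<And>i. i < n \<Longrightarrow> (\<Sum>j\<in>{..<n} - {i}. \<bar>E i j\<bar>) \<le> \<rho>"
  shows "(a - \<rho>) * sq_norm n y \<le> quadratic_form n E y"
proof -
  define O' where "O' = (\<lambda>i j. if i = j then 0 else E i j)"
  have row: "(\<Sum>j<n. \<bar>O' i j\<bar>) \<le> \<rho>" if "i < n" for i
  proof -
    have "(\<Sum>j<n. \<bar>O' i j\<bar>) = (\<Sum>j\<in>{..<n} - {i}. \<bar>O' i j\<bar>)"
      by (rule sum.mono_neutral_right) (auto simp: O'_def)
    also have "\<dots> = (\<Sum>j\<in>{..<n} - {i}. \<bar>E i j\<bar>)"
      by (rule sum.cong) (auto simp: O'_def)
    finally show ?thesis using off[OF that] by simp
  qed
  have col: "(\<Sum>i<n. \<bar>O' i j\<bar>) \<le> \<rho>" if "j < n" for j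
  proof -
    have "(\<Sum>i<n. \<bar>O' i j\<bar>) = (\<Sum>i<n. \<bar>O' j i\<bar>)"
      using sym that by (intro sum.cong) (auto simp: O'_def)
    then show ?thesis using row[OF that] by simp
  qed
  have "\<bar>\<Sum>i<n. \<Sum>j<n. O' i j * y i * y j\<bar> \<le> \<rho> * sq_norm n y"
    using bilinear_row_sum_bound[of n O' \<rho> y y] row col by simp
  moreover have "quadratic_form n E y = (\<Sum>i<n. E i i * (y i)\<^sup>2) + (\<Sum>i<n. \<Sum>j<n. O' i j * y i * y j)"
  proof -
    have "(\<Sum>j<n. E i j * y i * y j) = E i i * (y i)\<^sup>2 + (\<Sum>j<n. O' i j * y i * y j)" if "i < n" for i
    proof -
      have "(\<Sum>j<n. E i j * y i * y j) = (\<Sum>j<n. (if j = i then E i i * (y i)\<^sup>2 else 0) + O' i j * y i * y j)"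
        by (intro sum.cong) (auto simp: O'_def power2_eq_square)
      then show ?thesis using that by (simp add: sum.distrib)
    qed
    then show ?thesis by (simp add: quadratic_form_def sum.distrib)
  qed
  moreover have "a * sq_norm n y \<le> (\<Sum>i<n. E i i * (y i)\<^sup>2)"
    unfolding sq_norm_def sum_distrib_left by (intro sum_mono mult_right_mono diag) auto
  ultimately show ?thesis by (simp add: left_diff_distrib)
qed

section \<open>A Fejer minorant of a positive spectral density\<close>

definition tent :: "real \<Rightarrow> real \<Rightarrow> real" where
  "tent T x = max 0 (1 - \<bar>x\<bar> / T)"

lemma tent_bounds:
  assumes "0 < T"
  shows "0 \<le> tent T x" "tent T x \<le> 1" "T < \<bar>x\<bar> \<Longrightarrow> tent T x = 0"
proof -
  show "0 \<le> tent T x" by (simp add: tent_def)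
  show "tent T x \<le> 1" using assms by (simp add: tent_def)
  show "tent T x = 0" if "T < \<bar>x\<bar>"
  proof -
    have "1 \<le> \<bar>x\<bar> / T" using that assms by (simp add: le_divide_eq)
    then show ?thesis by (simp add: tent_def)
  qed
qed

lemma tent_measurable [measurable]: "tent T \<in> borel_measurable borel"
  unfolding tent_def by measurable

lemma tent_integrable:
  assumes "0 < T"
  shows "integrable lborel (tent T)"
proof (rule Bochner_Integration.integrable_bound)
  show "integrable lborel (indicat_real {-T..T})"
    by (rule integrable_real_indicator) (auto simp: emeasure_lborel_Icc_eq)
  show "tent T \<in> borel_measurable lborel" by simp
  have "norm (tent T x) \<le> norm (indicat_real {-T..T} x)" for x
    using tent_bounds[OF assms, of x] by (cases "T < \<bar>x\<bar>") (auto simp: indicator_def)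
  then show "AE x in lborel. norm (tent T x) \<le> norm (indicat_real {-T..T} x)"
    by (rule AE_I2)
qed

lemma tent_transform_integrable:
  assumes "0 < T"
  shows "complex_integrable lborel (\<lambda>x. complex_of_real (tent T x) * cis (x * y))"
proof (rule Bochner_Integration.integrable_bound[OF tent_integrable[OF assms]])
  have "(\<lambda>x::real. cis (x * y)) \<in> borel_measurable borel"
    by (intro borel_measurable_continuous_onI continuous_intros)
  then show "(\<lambda>x. complex_of_real (tent T x) * cis (x * y)) \<in> borel_measurable lborel"
    by simp
qed (auto simp: norm_mult)

definition tent_transform :: "real \<Rightarrow> real \<Rightarrow> complex" where
  "tent_transform T y = (LINT x|lborel. complex_of_real (tent T x) * cis (x * y))"

text \<open>
  The tent is affine on each side of its apex, so that the two halves are integrated by separate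
  antiderivatives.
\<close>

lemma tent_transform_antiderivative:
  assumes T: "0 < T"
    and F: "\<And>x. (F has_vector_derivative (complex_of_real (1 - x / T) * cis (x * y))) (at x)"
    and G: "\<And>x. (G has_vector_derivative (complex_of_real (1 + x / T) * cis (x * y))) (at x)"
  shows "tent_transform T y = F T - F 0 + (G 0 - G (- T))"
proof -
  let ?f = "\<lambda>x. complex_of_real (1 - x / T) * cis (x * y)"
  let ?g = "\<lambda>x. complex_of_real (1 + x / T) * cis (x * y)"
  have 1: "has_bochner_integral lborel (\<lambda>x. indicator {0..T} x *\<^sub>R ?f x) (F T - F 0)"
    using T by (intro has_bochner_integral_FTC_Icc has_vector_derivative_at_within[OF F] continuous_intros) auto
  have 2: "has_bochner_integral lborel (\<lambda>x. indicator {-T..0} x *\<^sub>R ?g x) (G 0 - G (-T))"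
    using T by (intro has_bochner_integral_FTC_Icc has_vector_derivative_at_within[OF G] continuous_intros) auto
  have "tent_transform T y = (LINT x|lborel. indicator {0..T} x *\<^sub>R ?f x + indicator {-T..0} x *\<^sub>R ?g x)"
    unfolding tent_transform_def
  proof (rule integral_cong_AE)
    show "AE x in lborel. complex_of_real (tent T x) * cis (x * y) =
        indicator {0..T} x *\<^sub>R ?f x + indicator {-T..0} x *\<^sub>R ?g x"
      using AE_lborel_singleton[of "0::real"]
    proof eventually_elim
      case (elim x)
      consider "0 < x" "x \<le> T" | "x < 0" "-T \<le> x" | "T < \<bar>x\<bar>"
        using elim by linarith
      then show ?case
      proof cases
        case 1
        then have "tent T x = 1 - x / T" using T by (simp add: tent_def max_def divide_le_eq)
        then show ?thesis using 1 by simp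
      next
        case 2
        then have "tent T x = 1 + x / T" using T divide_right_mono[of "- T" x T] by (simp add: tent_def)
        then show ?thesis using 2 by simp
      next
        case 3
        then show ?thesis using T tent_bounds(3)[OF T, of x] by (auto simp: indicator_def)
      qed
    qed
    show "(\<lambda>x. complex_of_real (tent T x) * cis (x * y)) \<in> borel_measurable lborel"
      using tent_transform_integrable[OF T] by (rule borel_measurable_integrable)
    show "(\<lambda>x. indicator {0..T} x *\<^sub>R ?f x + indicator {-T..0} x *\<^sub>R ?g x) \<in> borel_measurable lborel"
      using 1 2 by (intro borel_measurable_add) (auto simp: has_bochner_integral_iff)
  qed
  also have "\<dots> = F T - F 0 + (G 0 - G (-T))"
    using has_bochner_integral_add[OF 1 2] by (rule has_bochner_integral_integral_eq)
  finally show ?thesis .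
qed

lemma tent_transform_0:
  assumes T: "0 < T"
  shows "tent_transform T 0 = complex_of_real T"
proof -
  have d: "((\<lambda>x. complex_of_real (x + a * x\<^sup>2 / (2 * T))) has_vector_derivative complex_of_real (1 + a * x / T)) (at x)" for a x
  proof (rule bounded_linear.has_vector_derivative[OF bounded_linear_of_real])
    have "((\<lambda>x. x + a * x\<^sup>2 / (2 * T)) has_real_derivative (1 + a * x / T)) (at x)"
      using T by (auto intro!: derivative_eq_intros)
    then show "((\<lambda>x. x + a * x\<^sup>2 / (2 * T)) has_vector_derivative (1 + a * x / T)) (at x)"
      by (simp add: has_real_derivative_iff_has_vector_derivative)
  qed
  have half: "T\<^sup>2 / (2 * T) = T / 2" using T by (simp add: power2_eq_square)
  have "tent_transform T 0 = complex_of_real (T + (-1) * T\<^sup>2 / (2 * T)) - complex_of_real (0 + (-1) * 0\<^sup>2 / (2 * T))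
      + (complex_of_real (0 + 1 * 0\<^sup>2 / (2 * T)) - complex_of_real (- T + 1 * (- T)\<^sup>2 / (2 * T)))"
    using d[of "-1"] d[of 1] by (intro tent_transform_antiderivative[OF T]) simp_all
  also have "\<dots> = complex_of_real T"
    using half T by (simp only: of_real_diff[symmetric] of_real_add[symmetric]) simp
  finally show ?thesis .
qed

text \<open>
  The transform is the Fejer kernel \<open>2 (1 - cos (T y)) / (T y\<^sup>2)\<close>.
\<close>

lemma tent_transform_bound:
  assumes T: "0 < T" and y: "y \<noteq> 0"
  shows "norm (tent_transform T y) \<le> 4 / (T * y\<^sup>2)"
proof -
  define w where "w = \<i> * complex_of_real y"
  have w: "w \<noteq> 0" "norm w = \<bar>y\<bar>" using y by (auto simp: w_def norm_mult)
  have cis: "((\<lambda>x. cis (x * y)) has_vector_derivative (w * cis (x * y))) (at x)" for x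
  proof -
    have "exp (x *\<^sub>R w) = cis (x * y)" for x
      by (simp add: w_def cis_conv_exp scaleR_conv_of_real mult_ac)
    then show ?thesis using exp_scaleR_has_vector_derivative_left[of w x] by simp
  qed
  have lin: "((\<lambda>x. complex_of_real (1 + a * x / T)) has_vector_derivative complex_of_real (a / T)) (at x)" for a x
  proof (rule bounded_linear.has_vector_derivative[OF bounded_linear_of_real])
    have "((\<lambda>x. 1 + a * x / T) has_real_derivative (a / T)) (at x)"
      using T by (auto intro!: derivative_eq_intros)
    then show "((\<lambda>x. 1 + a * x / T) has_vector_derivative (a / T)) (at x)"
      by (simp add: has_real_derivative_iff_has_vector_derivative)
  qed
  let ?H = "\<lambda>a x. (complex_of_real (1 + a * x / T) * cis (x * y)) * (1 / w) - cis (x * y) * (complex_of_real (a / T) / w\<^sup>2)"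
  have H: "(?H a has_vector_derivative (complex_of_real (1 + a * x / T) * cis (x * y))) (at x)" for a x
  proof -
    have eq: "(A * (w * C) + D * C) * (1 / w) - (w * C) * (D / w\<^sup>2) = A * C" for A C D :: complex
      using w(1) by (simp add: field_simps power2_eq_square)
    have "(?H a has_vector_derivative
       (complex_of_real (1 + a * x / T) * (w * cis (x * y)) + complex_of_real (a / T) * cis (x * y)) * (1 / w)
         - (w * cis (x * y)) * (complex_of_real (a / T) / w\<^sup>2)) (at x)"
      by (intro has_vector_derivative_diff has_vector_derivative_mult_left has_vector_derivative_mult lin cis)
    then show ?thesis unfolding eq .
  qed
  have "tent_transform T y = ?H (-1) T - ?H (-1) 0 + (?H 1 0 - ?H 1 (- T))"
    using H[of "-1"] H[of 1] by (intro tent_transform_antiderivative[OF T]) simp_all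
  also have "\<dots> = (cis (T * y) + cis (- (T * y)) - 2) / (complex_of_real T * w\<^sup>2)"
  proof -
    define C where "C = complex_of_real T"
    have C: "C \<noteq> 0" using T by (simp add: C_def)
    have eq: "E * (1 / C / w\<^sup>2) - (1 / w + 1 / C / w\<^sup>2) * (-1) * (-1) + ((1 / w - 1 / C / w\<^sup>2) + E' * (1 / C / w\<^sup>2))
       = (E + E' - 2) / (C * w\<^sup>2)" for E E' :: complex
      using C w(1) by (simp add: add_divide_distrib diff_divide_distrib)
    show ?thesis using T eq[of "cis (T * y)" "cis (- (T * y))"] by (simp add: C_def)
  qed
  also have "norm \<dots> \<le> 4 / (T * y\<^sup>2)"
  proof -
    have "norm (cis (T * y) + cis (- (T * y)) - 2) \<le> norm (cis (T * y)) + norm (cis (- (T * y))) + norm (2 :: complex)"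
      by (meson norm_triangle_ineq norm_triangle_ineq4 order_trans add_right_mono)
    then have "norm (cis (T * y) + cis (- (T * y)) - 2) \<le> 4" by simp
    then show ?thesis
      using T w by (simp add: norm_divide norm_mult norm_power divide_right_mono)
  qed
  finally show ?thesis .
qed

definition tent_kernel :: "real \<Rightarrow> 'a::euclidean_space \<Rightarrow> real" where
  "tent_kernel T f = (\<Prod>b\<in>Basis. tent T (inner f b))"

definition tent_kernel_transform :: "real \<Rightarrow> 'a::euclidean_space \<Rightarrow> real" where
  "tent_kernel_transform T s = Re (\<Prod>b\<in>Basis. tent_transform T (inner s b))"

text \<open>
  Lebesgue measure is a product measure and the exponential of an inner product factors over the
  coordinates, so the integral is the product of one-dimensional transforms.
\<close>

lemma tent_kernel_cosine_transform:
  assumes T: "0 < T"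
  shows "cosine_transform (tent_kernel_transform T) (tent_kernel T :: 'a::euclidean_space \<Rightarrow> real)"
proof -
  interpret product_sigma_finite "\<lambda>_::'a. lborel :: real measure"
    by standard
  let ?h = "\<lambda>s b x. complex_of_real (tent T x) * cis (x * inner s b)"
  let ?P = "\<lambda>s f. \<Prod>b\<in>Basis. ?h s b (inner f b)"
  let ?e = "\<lambda>f. \<Sum>b\<in>(Basis::'a set). f b *\<^sub>R b"
  have P: "?P s f = complex_of_real (tent_kernel T f) * cis (inner f s)" for s f :: 'a
  proof -
    have "cis (inner f s) = (\<Prod>b\<in>Basis. cis (inner f b * inner s b))"
      by (simp add: cis_conv_exp euclidean_inner[of f s] sum_distrib_left exp_sum)
    then show ?thesis by (simp add: tent_kernel_def prod.distrib)
  qed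
  have e: "inner (?e f) b = f b" if "b \<in> Basis" for f and b :: 'a
    using that by (simp add: inner_sum_left inner_Basis if_distrib sum.delta cong: if_cong)
  have P_e: "?P s (?e f) = (\<Prod>b\<in>Basis. ?h s b (f b))" for s :: 'a and f
    by (intro prod.cong refl) (simp add: e)
  have Pm: "?P s \<in> borel_measurable borel" for s :: 'a
  proof -
    have "(\<lambda>x. cis (x * a)) \<in> borel_measurable borel" for a :: real
      by (intro borel_measurable_continuous_onI continuous_intros)
    note [measurable] = measurable_compose[OF _ this]
    show ?thesis by measurable
  qed
  have em: "?e \<in> measurable (\<Pi>\<^sub>M b\<in>Basis. lborel) borel"
    by measurable
  have int: "complex_integrable lborel (?P s)" and val: "(LINT f|lborel. ?P s f) = (\<Prod>b\<in>Basis. tent_transform T (inner s b))" for s :: 'a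
  proof -
    have "complex_integrable (\<Pi>\<^sub>M b\<in>Basis. lborel) (\<lambda>f. \<Prod>b\<in>Basis. ?h s b (f b))"
      by (intro product_integrable_prod tent_transform_integrable T) simp
    then show "complex_integrable lborel (?P s)"
      unfolding lborel_eq[where 'a='a] by (subst integrable_distr_eq[OF em Pm]) (simp only: P_e)
    have "(LINT f|lborel. ?P s f) = integral\<^sup>L (\<Pi>\<^sub>M b\<in>Basis. lborel) (\<lambda>f. \<Prod>b\<in>Basis. ?h s b (f b))"
      unfolding lborel_eq[where 'a='a] by (subst integral_distr[OF em Pm]) (simp only: P_e)
    also have "\<dots> = (\<Prod>b\<in>Basis. LINT x|lborel. ?h s b x)"
      by (intro product_integral_prod tent_transform_integrable T) simp
    finally show "(LINT f|lborel. ?P s f) = (\<Prod>b\<in>Basis. tent_transform T (inner s b))"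
      by (simp add: tent_transform_def)
  qed
  have Re_P: "Re (?P s f) = tent_kernel T f * cos (inner f s)" for s f :: 'a
    unfolding P by simp
  show ?thesis
    unfolding cosine_transform_def
  proof (intro conjI allI)
    show "integrable lborel (tent_kernel T :: 'a \<Rightarrow> real)"
      using integrable_Re[OF int[of 0]] unfolding Re_P by simp
    fix s :: 'a
    show "tent_kernel_transform T s = (LINT f|lborel. tent_kernel T f * cos (inner f s))"
      using integral_Re[OF int[of s]] unfolding Re_P val by (simp add: tent_kernel_transform_def)
  qed
qed

lemma tent_kernel_bounds:
  assumes "0 < T"
  shows "0 \<le> tent_kernel T f" "tent_kernel T f \<le> 1"
    "b \<in> Basis \<Longrightarrow> T < \<bar>inner f b\<bar> \<Longrightarrow> tent_kernel T f = 0"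
  using tent_bounds[OF assms]
  by (auto simp: tent_kernel_def intro!: prod_nonneg prod_le_1)

text \<open>
  At every frequency the form of the matrix \<open>cos \<langle>f, s i - s j\<rangle>\<close> is a sum of two squares, hence
  nonnegative, and spectral densities can be compared pointwise.
\<close>

lemma quadratic_form_tent_minorant:
  assumes F: "cosine_transform c chat" and T: "0 < T" and m: "0 \<le> m"
    and nonneg: "\<And>f. 0 \<le> chat f"
    and box: "\<And>f. (\<And>b. b \<in> Basis \<Longrightarrow> \<bar>inner f b\<bar> \<le> T) \<Longrightarrow> m \<le> chat f"
  shows "m * quadratic_form n (\<lambda>i j. tent_kernel_transform T (s i - s j)) y
      \<le> quadratic_form n (\<lambda>i j. c (s i - s j)) y"
proof -
  let ?P = "\<lambda>f. quadratic_form n (\<lambda>i j. 1 * cos (inner f (s i - s j))) y"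
  have P: "0 \<le> ?P f" for f
  proof -
    have "quadratic_form n (\<lambda>i j. 1) x = (\<Sum>i<n. x i)\<^sup>2" for x
      by (simp add: quadratic_form_def power2_eq_square sum_product)
    then show ?thesis by (simp only: quadratic_form_modulate) simp
  qed
  note K = quadratic_form_fourier[OF tent_kernel_cosine_transform[OF T], where n = n and E = "\<lambda>_ _. 1" and s = s and y = y]
  note C = quadratic_form_fourier[OF F, where n = n and E = "\<lambda>_ _. 1" and s = s and y = y]
  have "m * quadratic_form n (\<lambda>i j. 1 * tent_kernel_transform T (s i - s j)) y = (LINT f|lborel. m * (tent_kernel T f * ?P f))"
    by (simp only: K(1) integral_mult_right_zero)
  also have "\<dots> \<le> (LINT f|lborel. chat f * ?P f)"
  proof (rule integral_mono[OF integrable_mult_right[OF K(2)] C(2)])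
    fix f
    have "m * tent_kernel T f \<le> chat f"
    proof (cases "\<forall>b\<in>Basis. \<bar>inner f b\<bar> \<le> T")
      case True
      have "m * tent_kernel T f \<le> m" using mult_left_mono[OF tent_kernel_bounds(2)[OF T] m] by simp
      then show ?thesis using box[of f] True by fastforce
    next
      case False
      then show ?thesis using tent_kernel_bounds(3)[OF T, of _ f] nonneg by (auto simp: not_le)
    qed
    then show "m * (tent_kernel T f * ?P f) \<le> chat f * ?P f"
      using mult_right_mono[OF _ P] by (simp only: mult.assoc[symmetric])
  qed
  also have "\<dots> = quadratic_form n (\<lambda>i j. 1 * c (s i - s j)) y"
    by (rule C(1)[symmetric])
  finally show ?thesis by simp
qed

section \<open>Sites near the integer lattice\<close>

text \<open>
  What the estimates use of an enumeration of the grid.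
\<close>

definition integer_sites :: "(nat \<Rightarrow> real ^ 'd) \<Rightarrow> bool" where
  "integer_sites v \<longleftrightarrow> inj_on v {1..} \<and> (\<forall>i\<ge>1. \<forall>b. v i $ b \<in> \<int>)"

definition near_sites :: "real \<Rightarrow> (nat \<Rightarrow> real ^ 'd) \<Rightarrow> (nat \<Rightarrow> real ^ 'd) \<Rightarrow> bool" where
  "near_sites \<tau> v s \<longleftrightarrow> (\<forall>i\<ge>1. \<forall>b. \<bar>s i $ b - v i $ b\<bar> \<le> \<tau>)"

lemma card_real_grid:
  "card {x :: real ^ 'd. \<forall>j. x $ j \<in> real ` {1..I}} = I ^ CARD('d)"
proof -
  have "{x :: real ^ 'd. \<forall>j. x $ j \<in> real ` {1..I}} = vec_lambda ` (UNIV \<rightarrow>\<^sub>E real ` {1..I})"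
  proof (intro equalityI subsetI)
    fix x :: "real ^ 'd" assume "x \<in> {x. \<forall>j. x $ j \<in> real ` {1..I}}"
    then have "vec_nth x \<in> UNIV \<rightarrow>\<^sub>E real ` {1..I}" by (simp only: PiE_UNIV_domain) auto
    then show "x \<in> vec_lambda ` (UNIV \<rightarrow>\<^sub>E real ` {1..I})"
      by (metis image_eqI vec_nth_inverse)
  qed (auto simp: PiE_UNIV_domain Pi_iff)
  moreover have "inj_on vec_lambda (UNIV \<rightarrow>\<^sub>E real ` {1..I} :: ('d \<Rightarrow> real) set)"
    by (intro inj_onI) (simp add: vec_lambda_inject)
  moreover have "card (UNIV \<rightarrow>\<^sub>E real ` {1..I} :: ('d \<Rightarrow> real) set) = I ^ CARD('d)"
    by (simp add: card_PiE card_image)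
  ultimately show ?thesis by (simp add: card_image)
qed

text \<open>
  The first \<open>I ^ CARD('d)\<close> indices are mapped onto a set with exactly that many elements, hence
  injectively.
\<close>

lemma enumerates_grid_integer_sites:
  fixes v :: "nat \<Rightarrow> real ^ 'd"
  assumes "enumerates_grid v"
  shows "integer_sites v"
proof -
  have grid: "v ` {1..I ^ CARD('d)} = {x. \<forall>j. x $ j \<in> real ` {1..I}}" if "1 \<le> I" for I
    using assms that by (simp add: enumerates_grid_def)
  have inj: "inj_on v {1..I ^ CARD('d)}" if "1 \<le> I" for I
    by (intro eq_card_imp_inj_on finite_atLeastAtMost) (simp only: grid[OF that] card_real_grid card_atLeastAtMost diff_Suc_1 Suc_eq_plus1[symmetric])
  have le: "i \<in> {1..I ^ CARD('d)}" if "1 \<le> i" "i \<le> I" for i I :: nat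
    using that self_le_power[of I "CARD('d)"] by (auto simp: Suc_le_eq)
  show ?thesis
    unfolding integer_sites_def
  proof (intro conjI allI impI inj_onI)
    fix i j assume "i \<in> {1..}" "j \<in> {1..}" "v i = v j"
    then show "i = j"
      using inj_onD[OF inj[of "max i j"], of i j] le[of i "max i j"] le[of j "max i j"] by auto
  next
    fix i :: nat and b :: 'd assume "1 \<le> i"
    then have "v i \<in> {x. \<forall>j. x $ j \<in> real ` {1..i}}"
      using grid[of i] le[of i i] by blast
    then have "v i $ b \<in> real ` {1..i}" by simp
    then show "v i $ b \<in> \<int>" by auto
  qed
qed

definition offset :: "(nat \<Rightarrow> real ^ 'd) \<Rightarrow> nat \<Rightarrow> nat \<Rightarrow> 'd \<Rightarrow> int" where
  "offset v i j = (\<lambda>b. \<lfloor>v (Suc i) $ b - v (Suc j) $ b\<rfloor>)"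

lemma of_int_offset:
  assumes "integer_sites v"
  shows "of_int (offset v i j b) = v (Suc i) $ b - v (Suc j) $ b"
proof -
  have "v (Suc i) $ b - v (Suc j) $ b \<in> \<int>"
    using assms by (auto simp: integer_sites_def)
  then show ?thesis by (simp add: offset_def)
qed

lemma inj_offset:
  assumes "integer_sites v"
  shows "inj (offset v i)"
proof (rule injI)
  fix j k assume eq: "offset v i j = offset v i k"
  have "v (Suc j) $ b = v (Suc k) $ b" for b
    using of_int_offset[OF assms, of i j b] of_int_offset[OF assms, of i k b] by (simp add: eq)
  then have "v (Suc j) = v (Suc k)" by (simp add: Finite_Cartesian_Product.vec_eq_iff)
  then show "j = k"
    using assms by (auto simp: integer_sites_def inj_on_def)
qed

lemma offset_near:
  assumes "integer_sites v" "near_sites \<tau> v s"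
  shows "\<bar>(s (Suc i) - s (Suc j)) $ b - of_int (offset v i j b)\<bar> \<le> 2 * \<tau>"
proof -
  have "\<bar>s (Suc i) $ b - v (Suc i) $ b\<bar> \<le> \<tau>" "\<bar>s (Suc j) $ b - v (Suc j) $ b\<bar> \<le> \<tau>"
    using assms(2) by (auto simp: near_sites_def)
  then show ?thesis by (simp add: of_int_offset[OF assms(1)])
qed

text \<open>
  The offsets of the neighbours of a site are distinct integer points of a cube whose size depends
  only on the radius.
\<close>

lemma neighbour_count:
  assumes v: "integer_sites (v :: nat \<Rightarrow> real ^ 'd)" and \<tau>: "\<tau> < 1 / 2"
  shows "\<exists>W. \<forall>s n i. near_sites \<tau> v s \<longrightarrow>
     card {j. j < n \<and> norm (s (Suc i) - s (Suc j)) \<le> C} \<le> W"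
proof -
  define U :: "('d \<Rightarrow> int) set" where "U = (UNIV \<rightarrow>\<^sub>E {- \<lceil>C + 1\<rceil>..\<lceil>C + 1\<rceil>})"
  have U: "finite U" unfolding U_def by (intro finite_PiE) auto
  have "card {j. j < n \<and> norm (s (Suc i) - s (Suc j)) \<le> C} \<le> card U"
    if s: "near_sites \<tau> v s" for s n i
  proof (rule card_inj_on_le[OF _ _ U])
    show "inj_on (offset v i) {j. j < n \<and> norm (s (Suc i) - s (Suc j)) \<le> C}"
      using inj_offset[OF v] by (rule inj_on_subset) simp
    show "offset v i ` {j. j < n \<and> norm (s (Suc i) - s (Suc j)) \<le> C} \<subseteq> U"
    proof
      fix u assume "u \<in> offset v i ` {j. j < n \<and> norm (s (Suc i) - s (Suc j)) \<le> C}"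
      then obtain j where j: "norm (s (Suc i) - s (Suc j)) \<le> C" "u = offset v i j" by auto
      have "u b \<in> {- \<lceil>C + 1\<rceil>..\<lceil>C + 1\<rceil>}" for b
      proof -
        have "\<bar>(s (Suc i) - s (Suc j)) $ b\<bar> \<le> C"
          using component_le_norm_cart[of "s (Suc i) - s (Suc j)" b] j(1) by linarith
        then have "\<bar>of_int (u b)\<bar> \<le> C + 1"
          using offset_near[OF v s, of i j b] \<tau> unfolding j(2) by linarith
        then have "\<bar>of_int (u b)\<bar> \<le> real_of_int \<lceil>C + 1\<rceil>"
          using le_of_int_ceiling[of "C + 1"] by linarith
        then have "\<bar>u b\<bar> \<le> \<lceil>C + 1\<rceil>" by linarith
        then show ?thesis by (auto simp: abs_le_iff)
      qed
      then show "u \<in> U" by (simp add: U_def PiE_UNIV_domain)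
    qed
  qed
  then show ?thesis by blast
qed

text \<open>
  The sum of \<open>1 / m\<^sup>2\<close> over \<open>m \<ge> 1\<close> is at most \<open>2\<close>, by comparison with a telescoping sum.
\<close>

lemma sum_inverse_squares_le:
  assumes "0 \<le> q"
  shows "(\<Sum>m\<in>{- int N..int N}. if m = 0 then 1 else q / (real_of_int m)\<^sup>2) \<le> 1 + 4 * q"
proof -
  let ?f = "\<lambda>m::int. if m = 0 then 1 else q / (real_of_int m)\<^sup>2"
  have one: "(\<Sum>m=1..Suc k. 1 / (real m)\<^sup>2) \<le> 2 - 1 / real (Suc k)" for k
  proof (induction k)
    case (Suc k)
    have "1 / (real (Suc (Suc k)))\<^sup>2 \<le> 1 / (real (Suc k) * real (Suc (Suc k)))"
      by (intro divide_left_mono) (simp_all add: power2_eq_square)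
    also have "\<dots> = 1 / real (Suc k) - 1 / real (Suc (Suc k))"
      by (simp add: field_simps)
    finally show ?case using Suc by simp
  qed simp
  have "(\<Sum>m\<in>{- int N..int N}. ?f m) = ?f 0 + (\<Sum>m\<in>int ` {1..N}. ?f m) + (\<Sum>m\<in>(\<lambda>k. - int k) ` {1..N}. ?f m)"
  proof -
    have split: "{- int N..int N} = insert 0 (int ` {1..N} \<union> (\<lambda>k. - int k) ` {1..N})"
    proof (intro equalityI subsetI)
      fix m :: int assume m: "m \<in> {- int N..int N}"
      consider "m = 0" | "0 < m" | "m < 0" by linarith
      then show "m \<in> insert 0 (int ` {1..N} \<union> (\<lambda>k. - int k) ` {1..N})"
      proof cases
        case 2
        then have "m = int (nat m)" "nat m \<in> {1..N}" using m by auto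
        then show ?thesis by blast
      next
        case 3
        then have "m = - int (nat (- m))" "nat (- m) \<in> {1..N}" using m by auto
        then show ?thesis by blast
      qed simp
    qed auto
    show ?thesis
      unfolding split by (subst sum.insert, simp, force, subst sum.union_disjoint) (auto simp: algebra_simps)
  qed
  also have "(\<Sum>m\<in>int ` {1..N}. ?f m) = q * (\<Sum>m=1..N. 1 / (real m)\<^sup>2)"
    by (subst sum.reindex) (auto simp: inj_on_def sum_distrib_left intro!: sum.cong)
  also have "(\<Sum>m\<in>(\<lambda>k. - int k) ` {1..N}. ?f m) = q * (\<Sum>m=1..N. 1 / (real m)\<^sup>2)"
    by (subst sum.reindex) (auto simp: inj_on_def sum_distrib_left intro!: sum.cong)
  finally have total: "(\<Sum>m\<in>{- int N..int N}. ?f m) = ?f 0 + q * (\<Sum>m=1..N. 1 / (real m)\<^sup>2) + q * (\<Sum>m=1..N. 1 / (real m)\<^sup>2)" .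
  have "(\<Sum>m=1..N. 1 / (real m)\<^sup>2) \<le> 2"
  proof (cases N)
    case (Suc k)
    have "0 \<le> 1 / real (Suc k)" by simp
    then show ?thesis using one[of k] unfolding Suc by linarith
  qed simp
  from mult_left_mono[OF this assms] show ?thesis unfolding total by simp
qed

lemma norm_tent_transform_le:
  assumes "0 < T"
  shows "norm (tent_transform T y) \<le> T"
proof -
  have "norm (tent_transform T y) \<le> (LINT x|lborel. norm (complex_of_real (tent T x) * cis (x * y)))"
    unfolding tent_transform_def by (rule integral_norm_bound)
  also have "\<dots> = (LINT x|lborel. tent T x)"
    using tent_bounds(1)[OF assms] by (simp add: norm_mult)
  also have "\<dots> = T"
    using tent_transform_0[OF assms] by (simp add: tent_transform_def)
  finally show ?thesis .
qed

lemma tent_kernel_transform_cart: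
  "tent_kernel_transform T (s :: real ^ 'd) = Re (\<Prod>b\<in>UNIV. tent_transform T (s $ b))"
proof -
  have B: "(Basis :: (real ^ 'd) set) = (\<lambda>i. axis i 1) ` UNIV"
    by (auto simp: Basis_vec_def)
  have inj: "inj (\<lambda>i. axis i 1 :: real ^ 'd)"
    by (auto simp: inj_def axis_eq_axis)
  have "(\<Prod>b\<in>Basis. tent_transform T (inner s b)) = (\<Prod>b\<in>UNIV. tent_transform T (inner s (axis b 1)))"
    unfolding B by (subst prod.reindex[OF inj]) (simp add: o_def)
  then show ?thesis
    by (simp add: tent_kernel_transform_def inner_axis)
qed

lemma tent_kernel_transform_0:
  assumes "0 < T"
  shows "tent_kernel_transform T (0 :: real ^ 'd) = T ^ CARD('d)"
  by (simp add: tent_kernel_transform_cart tent_transform_0[OF assms] flip: of_real_power)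

lemma tent_kernel_transform_even:
  assumes "0 < T"
  shows "tent_kernel_transform T (- s) = tent_kernel_transform T s"
proof -
  have "tent_kernel_transform T u = (LINT f|lborel. tent_kernel T f * cos (inner f u))" for u :: 'a
    using tent_kernel_cosine_transform[OF assms, where 'a='a] by (simp add: cosine_transform_def)
  then show ?thesis by simp
qed

text \<open>
  A difference of sites is within \<open>2 \<tau>\<close> of its offset in each coordinate, so a coordinate \<open>m \<noteq> 0\<close>
  of the offset contributes a factor at most \<open>T q / m\<^sup>2\<close> and a coordinate \<open>0\<close> a factor at most \<open>T\<close>.
  The offsets of the other sites are distinct and nonzero, so the sum is bounded by the sum of the
  products of these factors over all integer points of a cube, less the term of the origin. The sum
  over the cube is a power of a one-dimensional sum.
\<close>

lemma tent_kernel_off_diagonal: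
  fixes v :: "nat \<Rightarrow> real ^ 'd"
  assumes v: "integer_sites v" and s: "near_sites \<tau> v s" and \<tau>: "0 \<le> \<tau>" "\<tau> < 1 / 2" and T: "0 < T" and i: "i < n"
    and q: "q = 4 / (T * (1 - 2 * \<tau>))\<^sup>2"
  shows "(\<Sum>j\<in>{..<n} - {i}. \<bar>tent_kernel_transform T (s (Suc i) - s (Suc j))\<bar>)
     \<le> T ^ CARD('d) * ((1 + 4 * q) ^ CARD('d) - 1)"
proof -
  define \<phi> :: "int \<Rightarrow> real" where "\<phi> m = (if m = 0 then 1 else q / (real_of_int m)\<^sup>2)" for m
  have q0: "0 \<le> q" by (simp add: q)
  have \<phi>0: "0 \<le> \<phi> m" for m using q0 by (simp add: \<phi>_def)
  have one: "norm (tent_transform T x) \<le> T * \<phi> m" if "\<bar>x - of_int m\<bar> \<le> 2 * \<tau>" for x m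
  proof (cases "m = 0")
    case True
    then show ?thesis using norm_tent_transform_le[OF T] by (simp add: \<phi>_def)
  next
    case False
    then have m1: "1 \<le> \<bar>real_of_int m\<bar>" by linarith
    have "(1 - 2 * \<tau>) * \<bar>real_of_int m\<bar> = \<bar>real_of_int m\<bar> - 2 * \<tau> * \<bar>real_of_int m\<bar>"
      by (simp add: algebra_simps)
    also have "\<dots> \<le> \<bar>real_of_int m\<bar> - 2 * \<tau>"
      using mult_left_mono[OF m1, of "2 * \<tau>"] \<tau> by simp
    also have "\<dots> \<le> \<bar>x\<bar>" using that by linarith
    finally have lower: "(1 - 2 * \<tau>) * \<bar>real_of_int m\<bar> \<le> \<bar>x\<bar>" .
    have pos: "0 < (1 - 2 * \<tau>) * \<bar>real_of_int m\<bar>" using \<tau> m1 by (intro mult_pos_pos) auto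
    then have x: "x \<noteq> 0" using lower by auto
    have sq: "((1 - 2 * \<tau>) * \<bar>real_of_int m\<bar>)\<^sup>2 \<le> x\<^sup>2"
      using power_mono[OF lower, of 2] pos by simp
    have "norm (tent_transform T x) \<le> 4 / (T * x\<^sup>2)"
      by (rule tent_transform_bound[OF T x])
    also have "\<dots> \<le> 4 / (T * ((1 - 2 * \<tau>) * \<bar>real_of_int m\<bar>)\<^sup>2)"
      using sq pos T by (intro divide_left_mono mult_left_mono mult_pos_pos) auto
    also have "\<dots> = T * \<phi> m"
      using T False by (simp add: \<phi>_def q power_mult_distrib power2_eq_square)
    finally show ?thesis .
  qed
  \<comment> \<open>a cube that contains all offsets of the given sites\<close>
  define N where "N = nat (Max (insert 0 ((\<lambda>(j, b). \<bar>offset v i j b\<bar>) ` ({..<n} \<times> UNIV))))"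
  define U :: "('d \<Rightarrow> int) set" where "U = (UNIV \<rightarrow>\<^sub>E {- int N..int N})"
  have fU: "finite U" unfolding U_def by (intro finite_PiE) auto
  have in_U: "offset v i j \<in> U" if "j < n" for j
  proof -
    have "\<bar>offset v i j b\<bar> \<le> int N" for b
    proof -
      have "\<bar>offset v i j b\<bar> \<le> Max (insert 0 ((\<lambda>(j, b). \<bar>offset v i j b\<bar>) ` ({..<n} \<times> UNIV)))"
        using that by (intro Max_ge) auto
      then show ?thesis by (simp add: N_def)
    qed
    then show ?thesis by (auto simp: U_def PiE_UNIV_domain abs_le_iff minus_le_iff)
  qed
  have zero: "offset v i j = (\<lambda>_. 0) \<longleftrightarrow> j = i" for j
  proof -
    have "offset v i i = (\<lambda>_. 0)" by (simp add: offset_def)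
    then show ?thesis using inj_offset[OF v, of i] by (metis injD)
  qed
  have "(\<Sum>j\<in>{..<n} - {i}. \<bar>tent_kernel_transform T (s (Suc i) - s (Suc j))\<bar>)
      \<le> (\<Sum>j\<in>{..<n} - {i}. \<Prod>b\<in>UNIV. T * \<phi> (offset v i j b))"
  proof (rule sum_mono)
    fix j
    have "\<bar>tent_kernel_transform T (s (Suc i) - s (Suc j))\<bar> \<le> norm (\<Prod>b\<in>UNIV. tent_transform T ((s (Suc i) - s (Suc j)) $ b))"
      unfolding tent_kernel_transform_cart by (rule abs_Re_le_cmod)
    also have "\<dots> \<le> (\<Prod>b\<in>UNIV. T * \<phi> (offset v i j b))"
      unfolding prod_norm[symmetric] by (intro prod_mono conjI norm_ge_zero one offset_near[OF v s])
    finally show "\<bar>tent_kernel_transform T (s (Suc i) - s (Suc j))\<bar> \<le> (\<Prod>b\<in>UNIV. T * \<phi> (offset v i j b))" .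
  qed
  also have "\<dots> = (\<Sum>u\<in>offset v i ` ({..<n} - {i}). \<Prod>b\<in>UNIV. T * \<phi> (u b))"
    using inj_offset[OF v, of i] by (subst sum.reindex) (auto intro: inj_on_subset)
  also have "\<dots> \<le> (\<Sum>u\<in>U - {\<lambda>_. 0}. \<Prod>b\<in>UNIV. T * \<phi> (u b))"
    using fU in_U zero T \<phi>0 by (intro sum_mono2) (auto intro!: prod_nonneg mult_nonneg_nonneg)
  also have "\<dots> = (\<Sum>u\<in>U. \<Prod>b\<in>UNIV. T * \<phi> (u b)) - T ^ CARD('d)"
    using fU by (subst sum_diff1) (auto simp: U_def PiE_UNIV_domain \<phi>_def)
  also have "(\<Sum>u\<in>U. \<Prod>b\<in>UNIV. T * \<phi> (u b)) = (\<Prod>b\<in>(UNIV::'d set). \<Sum>m\<in>{- int N..int N}. T * \<phi> m)"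
    unfolding U_def by (rule prod_sum_PiE[symmetric]) auto
  also have "\<dots> = T ^ CARD('d) * (\<Sum>m\<in>{- int N..int N}. \<phi> m) ^ CARD('d)"
    by (simp add: sum_distrib_left[symmetric] power_mult_distrib)
  also have "\<dots> \<le> T ^ CARD('d) * (1 + 4 * q) ^ CARD('d)"
    using T sum_inverse_squares_le[OF q0, of N] \<phi>0
    by (intro mult_left_mono power_mono sum_nonneg) (auto simp: \<phi>_def)
  finally show ?thesis by (simp add: algebra_simps)
qed

text \<open>
  Eigenvalues are bounded below uniformly in the number of sites and in their position. By the
  minorant it suffices to treat the Fejer kernel; for a suitable \<open>T\<close> its off-diagonal row sums are at
  most half of the diagonal entry \<open>T ^ CARD('d)\<close>.
\<close>

lemma spectral_lower_bound:
  fixes v :: "nat \<Rightarrow> real ^ 'd"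
  assumes v: "integer_sites v" and \<tau>: "0 \<le> \<tau>" "\<tau> < 1 / 2"
    and F: "cosine_transform c chat" and cont: "continuous_on UNIV chat" and pos: "\<And>f. 0 < chat f"
  shows "\<exists>\<mu>>0. \<forall>n s y. near_sites \<tau> v s \<longrightarrow>
     \<mu> * sq_norm n y \<le> quadratic_form n (\<lambda>i j. c (s (Suc i) - s (Suc j))) y"
proof -
  \<comment> \<open>chosen so that the excess of the lattice sum over the term of the origin is exactly one half\<close>
  define q0 where "q0 = (root CARD('d) (3 / 2) - 1) / 4"
  have q0: "0 < q0" "(1 + 4 * q0) ^ CARD('d) = 3 / 2"
  proof -
    have "1 + 4 * q0 = root CARD('d) (3 / 2)" by (simp add: q0_def field_simps)
    moreover have "1 < root CARD('d) (3 / 2)" by simp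
    ultimately show "0 < q0" "(1 + 4 * q0) ^ CARD('d) = 3 / 2"
      by (linarith, simp add: real_root_pow_pos2)
  qed
  define T where "T = 2 / (sqrt q0 * (1 - 2 * \<tau>))"
  have T: "0 < T" using q0 \<tau> by (simp add: T_def)
  have q: "q0 = 4 / (T * (1 - 2 * \<tau>))\<^sup>2"
  proof -
    have "T * (1 - 2 * \<tau>) = 2 / sqrt q0" 
    proof -
      have "2 / (a * b) * b = 2 / a" if "b \<noteq> 0" for a b :: real using that by simp
      from this[of "1 - 2 * \<tau>" "sqrt q0"] show ?thesis using \<tau> unfolding T_def by linarith
    qed
    then show ?thesis using q0(1) by (simp add: power_divide)
  qed
  define B :: "(real ^ 'd) set" where "B = cbox (\<chi> b. - T) (\<chi> b. T)"
  have "0 \<in> B" using T by (simp add: B_def mem_box_cart)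
  moreover have "compact B" by (simp add: B_def)
  ultimately obtain f0 where f0: "\<And>f. f \<in> B \<Longrightarrow> chat f0 \<le> chat f"
    using continuous_attains_inf[OF _ _ continuous_on_subset[OF cont], of B] by blast
  have "chat f0 * (T ^ CARD('d) / 2) * sq_norm n y \<le> quadratic_form n (\<lambda>i j. c (s (Suc i) - s (Suc j))) y"
    if s: "near_sites \<tau> v s" for n s y
  proof -
    have "(T ^ CARD('d) - T ^ CARD('d) * ((1 + 4 * q0) ^ CARD('d) - 1)) * sq_norm n y
        \<le> quadratic_form n (\<lambda>i j. tent_kernel_transform T (s (Suc i) - s (Suc j))) y"
    proof (rule gershgorin_lower_bound)
      fix i j
      show "tent_kernel_transform T (s (Suc i) - s (Suc j)) = tent_kernel_transform T (s (Suc j) - s (Suc i))"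
        using tent_kernel_transform_even[OF T, of "s (Suc i) - s (Suc j)"] by simp
    qed (use tent_kernel_transform_0[OF T, where 'd='d] tent_kernel_off_diagonal[OF v s \<tau> T _ q] in auto)
    moreover have "T ^ CARD('d) - T ^ CARD('d) * ((1 + 4 * q0) ^ CARD('d) - 1) = T ^ CARD('d) / 2"
      unfolding q0 by simp
    ultimately have "T ^ CARD('d) / 2 * sq_norm n y \<le> quadratic_form n (\<lambda>i j. tent_kernel_transform T (s (Suc i) - s (Suc j))) y"
      by (simp only:)
    then have "chat f0 * (T ^ CARD('d) / 2 * sq_norm n y) \<le> chat f0 * quadratic_form n (\<lambda>i j. tent_kernel_transform T (s (Suc i) - s (Suc j))) y"
      using less_imp_le[OF pos[of f0]] by (rule mult_left_mono)
    also have "\<dots> \<le> quadratic_form n (\<lambda>i j. c (s (Suc i) - s (Suc j))) y"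
    proof (rule quadratic_form_tent_minorant[OF F T])
      fix f :: "real ^ 'd" assume "\<And>b. b \<in> Basis \<Longrightarrow> \<bar>inner f b\<bar> \<le> T"
      then have "\<bar>f $ b\<bar> \<le> T" for b
        by (simp add: cart_eq_inner_axis axis_in_Basis_iff)
      then show "chat f0 \<le> chat f"
        by (intro f0) (simp add: B_def mem_box_cart abs_le_iff minus_le_iff)
    qed (use pos less_imp_le in auto)
    finally show ?thesis by (simp add: mult.assoc)
  qed
  moreover have "0 < chat f0 * (T ^ CARD('d) / 2)" using pos T by simp
  ultimately show ?thesis by blast
qed

section \<open>Coercive matrices and their perturbation\<close>

definition bilinear_form :: "nat \<Rightarrow> (nat \<Rightarrow> nat \<Rightarrow> real) \<Rightarrow> (nat \<Rightarrow> real) \<Rightarrow> (nat \<Rightarrow> real) \<Rightarrow> real" where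
  "bilinear_form n E x y = (\<Sum>i<n. \<Sum>j<n. E i j * x i * y j)"

abbreviation entries :: "real mat \<Rightarrow> nat \<Rightarrow> nat \<Rightarrow> real" where
  "entries A i j \<equiv> A $$ (i, j)"

text \<open>
  Symmetric with smallest eigenvalue at least \<open>\<mu>\<close>, expressed without eigenvalues.
\<close>

definition coercive :: "nat \<Rightarrow> real \<Rightarrow> real mat \<Rightarrow> bool" where
  "coercive n \<mu> A \<longleftrightarrow> A \<in> carrier_mat n n \<and> (\<forall>i<n. \<forall>j<n. A $$ (i, j) = A $$ (j, i)) \<and>
     (\<forall>x. \<mu> * sq_norm n x \<le> quadratic_form n (entries A) x)"

lemma quadratic_form_bilinear: "quadratic_form n E x = bilinear_form n E x x"
  by (simp add: quadratic_form_def bilinear_form_def)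

lemma bilinear_form_rows: "bilinear_form n E x y = (\<Sum>i<n. x i * (\<Sum>j<n. E i j * y j))"
  by (simp add: bilinear_form_def sum_distrib_left mult_ac)

lemma bilinear_form_sym:
  assumes "\<And>i j. i < n \<Longrightarrow> j < n \<Longrightarrow> E i j = E j i"
  shows "bilinear_form n E x y = bilinear_form n E y x"
proof -
  have "bilinear_form n E x y = (\<Sum>j<n. \<Sum>i<n. E i j * x i * y j)"
    unfolding bilinear_form_def by (rule sum.swap)
  also have "\<dots> = bilinear_form n E y x"
    unfolding bilinear_form_def using assms by (intro sum.cong) (auto simp: mult_ac)
  finally show ?thesis .
qed

lemma sq_norm_pos_iff: "0 < sq_norm n x \<longleftrightarrow> (\<exists>i<n. x i \<noteq> 0)"
proof -
  have "sq_norm n x = 0 \<longleftrightarrow> (\<forall>i<n. x i = 0)"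
    unfolding sq_norm_def by (subst sum_nonneg_eq_0_iff) auto
  then show ?thesis using sq_norm_nonneg[of n x] by (auto simp: less_le)
qed

lemma mat_mult_entry:
  assumes "A \<in> carrier_mat n n" "B \<in> carrier_mat n n" "i < n" "j < n"
  shows "(A * B) $$ (i, j) = (\<Sum>k<n. A $$ (i, k) * B $$ (k, j))"
  using assms by (auto simp: scalar_prod_def atLeast0LessThan)

lemma mat_vec_entry:
  assumes "A \<in> carrier_mat n n" "x \<in> carrier_vec n" "i < n"
  shows "vec_index (A *\<^sub>v x) i = (\<Sum>j<n. A $$ (i, j) * vec_index x j)"
  using assms by (auto simp: scalar_prod_def atLeast0LessThan)

lemma scalar_prod_mat_vec:
  assumes "A \<in> carrier_mat n n" "x \<in> carrier_vec n"
  shows "scalar_prod x (A *\<^sub>v x) = quadratic_form n (entries A) (vec_index x)"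
proof -
  have "scalar_prod x (A *\<^sub>v x) = (\<Sum>i<n. vec_index x i * vec_index (A *\<^sub>v x) i)"
    using assms by (simp add: scalar_prod_def atLeast0LessThan)
  also have "\<dots> = (\<Sum>i<n. vec_index x i * (\<Sum>j<n. A $$ (i, j) * vec_index x j))"
    by (intro sum.cong refl, subst mat_vec_entry[OF assms]) auto
  finally show ?thesis by (simp add: quadratic_form_bilinear bilinear_form_rows)
qed

lemma coercive_positive_definite:
  assumes "coercive n \<mu> A" "0 < \<mu>"
  shows "positive_definite A"
proof -
  have A: "A \<in> carrier_mat n n" and sym: "\<And>i j. i < n \<Longrightarrow> j < n \<Longrightarrow> A $$ (i, j) = A $$ (j, i)"
    and low: "\<And>x. \<mu> * sq_norm n x \<le> quadratic_form n (entries A) x"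
    using assms(1) by (auto simp: coercive_def)
  show ?thesis
    unfolding positive_definite_def
  proof (intro conjI ballI impI)
    show "square_mat A" using A by simp
    show "transpose_mat A = A" using A sym by (intro eq_matI) auto
    fix x :: "real Matrix.vec" assume x: "x \<in> carrier_vec (dim_row A)" "x \<noteq> 0\<^sub>v (dim_row A)"
    then have "x \<in> carrier_vec n" and "\<exists>i<n. vec_index x i \<noteq> 0"
      using A by (auto intro: eq_vecI)
    then show "0 < scalar_prod x (A *\<^sub>v x)"
      using low[of "vec_index x"] sq_norm_pos_iff[of n "vec_index x"] assms(2)
      by (simp add: scalar_prod_mat_vec[OF A]) (smt (verit) mult_pos_pos)
  qed
qed

text \<open>
  Write the eigenvector as \<open>u + \<i> w\<close> and the eigenvalue as \<open>a + \<i> b\<close>. Pairing the real part of the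
  eigenvalue equation with \<open>w\<close> and the imaginary part with \<open>u\<close>, symmetry of \<open>S\<close> leaves
  \<open>b (\<langle>u, Q u\<rangle> + \<langle>w, Q w\<rangle>) = 0\<close>, so \<open>b = 0\<close> because \<open>Q\<close> is positive.
\<close>

lemma symmetric_pencil_eigenvalue:
  fixes v :: "nat \<Rightarrow> complex"
  assumes S: "\<And>i j. i < n \<Longrightarrow> j < n \<Longrightarrow> S i j = S j i" and Q: "\<And>i j. i < n \<Longrightarrow> j < n \<Longrightarrow> Q i j = Q j i"
    and pos: "\<And>x. 0 < sq_norm n x \<Longrightarrow> 0 < quadratic_form n Q x"
    and v: "\<exists>i<n. v i \<noteq> 0"
    and eig: "\<And>i. i < n \<Longrightarrow> (\<Sum>j<n. complex_of_real (S i j) * v j) = z * (\<Sum>j<n. complex_of_real (Q i j) * v j)"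
  shows "\<exists>a u. z = complex_of_real a \<and> 0 < sq_norm n u \<and> quadratic_form n S u = a * quadratic_form n Q u"
proof -
  define u w where "u = (\<lambda>j. Re (v j))" and "w = (\<lambda>j. Im (v j))"
  define a b where "a = Re z" and "b = Im z"
  have re: "(\<Sum>j<n. S i j * u j) = a * (\<Sum>j<n. Q i j * u j) - b * (\<Sum>j<n. Q i j * w j)" if "i < n" for i
    using arg_cong[OF eig[OF that], of Re] by (simp add: u_def w_def a_def b_def)
  have im: "(\<Sum>j<n. S i j * w j) = a * (\<Sum>j<n. Q i j * w j) + b * (\<Sum>j<n. Q i j * u j)" if "i < n" for i
    using arg_cong[OF eig[OF that], of Im] by (simp add: u_def w_def a_def b_def)
  have u: "bilinear_form n S x u = a * bilinear_form n Q x u - b * bilinear_form n Q x w" for x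
    unfolding bilinear_form_rows sum_distrib_left[of a] sum_distrib_left[of b] sum_subtractf[symmetric]
    by (intro sum.cong refl) (simp only: lessThan_iff re, simp add: algebra_simps)
  have w: "bilinear_form n S x w = a * bilinear_form n Q x w + b * bilinear_form n Q x u" for x
    unfolding bilinear_form_rows sum_distrib_left[of a] sum_distrib_left[of b] sum.distrib[symmetric]
    by (intro sum.cong refl) (simp only: lessThan_iff im, simp add: algebra_simps)
  have "bilinear_form n S w u = bilinear_form n S u w" "bilinear_form n Q w u = bilinear_form n Q u w"
    using bilinear_form_sym[of n S, OF S] bilinear_form_sym[of n Q, OF Q] by blast+
  then have "b * (quadratic_form n Q u + quadratic_form n Q w) = 0"
    using u[of w] w[of u] by (simp add: quadratic_form_bilinear algebra_simps)
  moreover have some: "0 < sq_norm n u \<or> 0 < sq_norm n w"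
    using v unfolding sq_norm_pos_iff by (auto simp: u_def w_def complex_eq_iff)
  moreover have "0 \<le> quadratic_form n Q x" for x
  proof (cases "0 < sq_norm n x")
    case False
    then have "\<And>i. i < n \<Longrightarrow> x i = 0" by (simp add: sq_norm_pos_iff)
    then show ?thesis by (simp add: quadratic_form_def)
  qed (use pos in \<open>simp add: less_imp_le\<close>)
  then have "0 < quadratic_form n Q u + quadratic_form n Q w"
    using some pos by (metis add_nonneg_pos add_pos_nonneg)
  ultimately have b: "b = 0" by simp
  then have z: "z = complex_of_real a" by (simp add: a_def b_def complex_eq_iff)
  have "quadratic_form n S u = a * quadratic_form n Q u" "quadratic_form n S w = a * quadratic_form n Q w"
    using u[of u] w[of w] b by (simp_all add: quadratic_form_bilinear)
  then show ?thesis using z some by blast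
qed

text \<open>
  Over the complex numbers the characteristic polynomial is a product of linear factors, and its
  value at \<open>0\<close> is the determinant up to the sign \<open>(- 1) ^ n\<close>. Real roots keep their multiplicities
  in the complex polynomial.
\<close>

lemma det_eq_prod_real_eigenvalues:
  fixes P :: "real mat"
  assumes P: "P \<in> carrier_mat n n"
    and real: "\<And>z v. v \<in> carrier_vec n \<Longrightarrow> v \<noteq> 0\<^sub>v n \<Longrightarrow> map_mat complex_of_real P *\<^sub>v v = z \<cdot>\<^sub>v v \<Longrightarrow> z \<in> \<real>"
  shows "det P = (\<Prod>x | eigenvalue P x. x ^ Polynomial.order x (char_poly P))"
    and "(\<Sum>x | eigenvalue P x. Polynomial.order x (char_poly P)) = n"
    and "finite {x. eigenvalue P x}"
proof -
  interpret h: map_poly_inj_idom_divide_hom complex_of_real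
    by (unfold_locales) auto
  define p where "p = char_poly P"
  define q where "q = map_poly complex_of_real p"
  have CP: "map_mat complex_of_real P \<in> carrier_mat n n" using P by simp
  have q: "q = char_poly (map_mat complex_of_real P)"
    unfolding q_def p_def by (rule of_real_hom.char_poly_hom[OF P, symmetric])
  have monic: "degree q = n" "lead_coeff q = 1"
    using degree_monic_char_poly[OF CP] unfolding q by auto
  then have q0: "q \<noteq> 0" by auto
  have p0: "p \<noteq> 0" using q0 by (auto simp: q_def)
  have root: "poly q (complex_of_real x) = complex_of_real (poly p x)" for x
    unfolding q_def by (simp add: of_real_hom.poly_map_poly)
  have ev: "{x. eigenvalue P x} = {x. poly p x = 0}"
    unfolding p_def eigenvalue_root_char_poly[OF P] ..
  show fin: "finite {x. eigenvalue P x}"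
    unfolding ev by (rule poly_roots_finite[OF p0])
  have roots: "{z. poly q z = 0} = complex_of_real ` {x. poly p x = 0}"
  proof (intro equalityI subsetI)
    fix z assume z: "z \<in> {z. poly q z = 0}"
    then have "eigenvalue (map_mat complex_of_real P) z"
      unfolding eigenvalue_root_char_poly[OF CP] q by simp
    then obtain v where "eigenvector (map_mat complex_of_real P) v z" unfolding eigenvalue_def by blast
    then have "v \<in> carrier_vec n" "v \<noteq> 0\<^sub>v n" "map_mat complex_of_real P *\<^sub>v v = z \<cdot>\<^sub>v v"
      using P unfolding eigenvector_def by simp_all
    then have "z \<in> \<real>" by (rule real)
    then obtain x where "z = complex_of_real x" by (auto elim: Reals_cases)
    then show "z \<in> complex_of_real ` {x. poly p x = 0}" using z root[of x] by simp
  qed (use root in auto)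
  have fac: "q = (\<Prod>x\<in>{x. poly p x = 0}. [:- complex_of_real x, 1:] ^ Polynomial.order x p)"
  proof -
    have "q = Polynomial.smult (lead_coeff q) (\<Prod>z | poly q z = 0. [:- z, 1:] ^ Polynomial.order z q)"
      by (rule complex_poly_decompose[symmetric])
    also have "\<dots> = (\<Prod>z\<in>complex_of_real ` {x. poly p x = 0}. [:- z, 1:] ^ Polynomial.order z q)"
      by (simp only: monic(2) roots Polynomial.smult_1_left)
    also have "\<dots> = (\<Prod>x\<in>{x. poly p x = 0}. [:- complex_of_real x, 1:] ^ Polynomial.order (complex_of_real x) q)"
      by (subst prod.reindex) (auto simp: inj_on_def)
    also have "\<dots> = (\<Prod>x\<in>{x. poly p x = 0}. [:- complex_of_real x, 1:] ^ Polynomial.order x p)"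
      unfolding q_def h.order_hom ..
    finally show ?thesis .
  qed
  show deg: "(\<Sum>x | eigenvalue P x. Polynomial.order x (char_poly P)) = n"
  proof -
    have "degree q = (\<Sum>x\<in>{x. poly p x = 0}. degree ([:- complex_of_real x, 1:] ^ Polynomial.order x p))"
      by (subst fac, rule degree_prod_sum_eq) auto
    then show ?thesis
      unfolding ev p_def[symmetric] by (simp add: monic degree_power_eq)
  qed
  have "complex_of_real (poly p 0) = poly q 0" using root[of 0] by simp
  also have "\<dots> = complex_of_real (\<Prod>x\<in>{x. poly p x = 0}. (- x) ^ Polynomial.order x p)"
    by (subst fac) (simp add: poly_prod)
  finally have "poly p 0 = (\<Prod>x\<in>{x. poly p x = 0}. (- x) ^ Polynomial.order x p)"
    by (simp only: of_real_eq_iff)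
  also have "\<dots> = (\<Prod>x\<in>{x. poly p x = 0}. (- 1) ^ Polynomial.order x p * x ^ Polynomial.order x p)"
    by (intro prod.cong refl power_minus)
  also have "\<dots> = (- 1) ^ n * (\<Prod>x\<in>{x. poly p x = 0}. x ^ Polynomial.order x p)"
    unfolding prod.distrib deg[symmetric] power_sum ev p_def[symmetric] ..
  finally have 1: "poly p 0 = (- 1) ^ n * (\<Prod>x\<in>{x. poly p x = 0}. x ^ Polynomial.order x p)" .
  have "- char_matrix P 0 = (- 1) \<cdot>\<^sub>m P"
    using P by (intro eq_matI) (auto simp: char_matrix_def)
  then have "poly p 0 = (- 1) ^ n * det P"
    unfolding p_def char_poly_matrix[OF P] using P by simp
  with 1 show "det P = (\<Prod>x | eigenvalue P x. x ^ Polynomial.order x (char_poly P))"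
    unfolding ev p_def[symmetric] by simp
qed

lemma complexified_eigenvector:
  fixes P :: "real mat"
  assumes P: "P \<in> carrier_mat n n" and x: "eigenvalue P x"
  obtains v where "v \<in> carrier_vec n" "v \<noteq> 0\<^sub>v n"
    "map_mat complex_of_real P *\<^sub>v v = complex_of_real x \<cdot>\<^sub>v v"
proof -
  obtain v where "eigenvector P v x" using x unfolding eigenvalue_def by blast
  then have v: "v \<in> carrier_vec n" "v \<noteq> 0\<^sub>v n" "P *\<^sub>v v = x \<cdot>\<^sub>v v"
    using P unfolding eigenvector_def by simp_all
  have "map_mat complex_of_real P *\<^sub>v map_vec complex_of_real v = complex_of_real x \<cdot>\<^sub>v map_vec complex_of_real v"
    using arg_cong[OF v(3), of "map_vec complex_of_real"] P v(1)
    by (simp add: of_real_hom.mult_mat_vec_hom[OF P v(1)] of_real_hom.vec_hom_smult)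
  moreover have "map_vec complex_of_real v \<noteq> 0\<^sub>v n"
    using v by (metis of_real_hom.vec_hom_zero_iff)
  ultimately show thesis using v(1) that[of "map_vec complex_of_real v"] by simp
qed

lemma det_bounds_real_eigenvalues:
  fixes P :: "real mat"
  assumes P: "P \<in> carrier_mat n n" and lo: "0 \<le> lo"
    and real: "\<And>z v. v \<in> carrier_vec n \<Longrightarrow> v \<noteq> 0\<^sub>v n \<Longrightarrow> map_mat complex_of_real P *\<^sub>v v = z \<cdot>\<^sub>v v \<Longrightarrow>
       \<exists>a. z = complex_of_real a \<and> lo \<le> a \<and> a \<le> hi"
  shows "lo ^ n \<le> det P" "det P \<le> hi ^ n"
proof -
  have R: "z \<in> \<real>" if "v \<in> carrier_vec n" "v \<noteq> 0\<^sub>v n" "map_mat complex_of_real P *\<^sub>v v = z \<cdot>\<^sub>v v" for z v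
    using real[OF that] by auto
  have E: "det P = (\<Prod>x | eigenvalue P x. x ^ Polynomial.order x (char_poly P))"
    "(\<Sum>x | eigenvalue P x. Polynomial.order x (char_poly P)) = n" "finite {x. eigenvalue P x}"
    by (rule det_eq_prod_real_eigenvalues[OF P R]; assumption)+
  have ev: "lo \<le> x" "x \<le> hi" if x: "eigenvalue P x" for x
  proof -
    obtain v where "v \<in> carrier_vec n" "v \<noteq> 0\<^sub>v n" "map_mat complex_of_real P *\<^sub>v v = complex_of_real x \<cdot>\<^sub>v v"
      by (rule complexified_eigenvector[OF P x])
    then have "\<exists>a. complex_of_real x = complex_of_real a \<and> lo \<le> a \<and> a \<le> hi" by (rule real)
    then show "lo \<le> x" "x \<le> hi" by auto
  qed
  have "lo ^ n = (\<Prod>x | eigenvalue P x. lo ^ Polynomial.order x (char_poly P))"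
    using E(2)[unfolded power_sum[symmetric]] by (simp add: power_sum[symmetric] E(2))
  also have "\<dots> \<le> det P"
    unfolding E(1) using ev lo by (intro prod_mono conjI power_mono zero_le_power) auto
  finally show "lo ^ n \<le> det P" .
  have "det P \<le> (\<Prod>x | eigenvalue P x. hi ^ Polynomial.order x (char_poly P))"
    unfolding E(1) using ev lo by (intro prod_mono conjI power_mono zero_le_power) (auto intro: order_trans[OF lo])
  also have "\<dots> = hi ^ n"
    by (simp add: power_sum[symmetric] E(2))
  finally show "det P \<le> hi ^ n" .
qed

lemma coercive_eigenvalue:
  assumes A: "coercive n \<mu> A" "0 < \<mu>"
    and v: "v \<in> carrier_vec n" "v \<noteq> 0\<^sub>v n" "map_mat complex_of_real A *\<^sub>v v = z \<cdot>\<^sub>v v"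
  shows "\<exists>a. z = complex_of_real a \<and> \<mu> \<le> a"
proof -
  have AC: "A \<in> carrier_mat n n" using A by (simp add: coercive_def)
  have qf_id: "quadratic_form n (\<lambda>i j. if i = j then 1 else 0) x = sq_norm n x" for x
  proof -
    have "(\<Sum>j<n. (if i = j then 1 else 0) * x i * x j) = (x i)\<^sup>2" if "i < n" for i
    proof -
      have "(\<Sum>j<n. (if i = j then 1 else 0) * x i * x j) = (\<Sum>j<n. if i = j then x i * x j else 0)"
        by (intro sum.cong) auto
      then show ?thesis using that by (simp add: power2_eq_square)
    qed
    then show ?thesis by (simp add: quadratic_form_def sq_norm_def)
  qed
  have "\<exists>a u. z = complex_of_real a \<and> 0 < sq_norm n u \<and>
      quadratic_form n (entries A) u = a * quadratic_form n (\<lambda>i j. if i = j then 1 else 0) u"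
  proof (rule symmetric_pencil_eigenvalue[where v = "vec_index v"])
    show "\<exists>i<n. vec_index v i \<noteq> 0" using v(1,2) by (auto intro: eq_vecI)
    fix i assume i: "i < n"
    have "(\<Sum>j<n. complex_of_real (A $$ (i, j)) * vec_index v j) = vec_index (map_mat complex_of_real A *\<^sub>v v) i"
      using AC v(1) i by (auto simp: scalar_prod_def atLeast0LessThan)
    also have "\<dots> = z * vec_index v i" unfolding v(3) using v(1) i by simp
    also have "vec_index v i = (\<Sum>j<n. complex_of_real (if i = j then 1 else 0) * vec_index v j)"
    proof -
      have "(\<Sum>j<n. complex_of_real (if i = j then 1 else 0) * vec_index v j) = (\<Sum>j<n. if i = j then vec_index v j else 0)"
        by (intro sum.cong) auto
      then show ?thesis using i by simp
    qed
    finally show "(\<Sum>j<n. complex_of_real (A $$ (i, j)) * vec_index v j) = z * (\<Sum>j<n. complex_of_real (if i = j then 1 else 0) * vec_index v j)" .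
  qed (use A in \<open>auto simp: coercive_def qf_id\<close>)
  then obtain a u where au: "z = complex_of_real a" "0 < sq_norm n u" "quadratic_form n (entries A) u = a * sq_norm n u"
    unfolding qf_id by blast
  have "\<mu> * sq_norm n u \<le> a * sq_norm n u"
    using A(1) au(3) by (metis coercive_def)
  then show ?thesis using au by auto
qed

text \<open>
  All eigenvalues are positive, so that the restriction to positive eigenvalues in \<open>det_plus\<close> is no
  restriction.
\<close>

lemma coercive_det:
  assumes A: "coercive n \<mu> A" "0 < \<mu>"
  shows "0 < det A" "det_plus A = det A"
proof -
  have AC: "A \<in> carrier_mat n n" using A by (simp add: coercive_def)
  have R: "z \<in> \<real>" if "v \<in> carrier_vec n" "v \<noteq> 0\<^sub>v n" "map_mat complex_of_real A *\<^sub>v v = z \<cdot>\<^sub>v v" for z v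
    using coercive_eigenvalue[OF A that] by auto
  have E: "det A = (\<Prod>x | eigenvalue A x. x ^ Polynomial.order x (char_poly A))"
    "(\<Sum>x | eigenvalue A x. Polynomial.order x (char_poly A)) = n" "finite {x. eigenvalue A x}"
    by (rule det_eq_prod_real_eigenvalues[OF AC R]; assumption)+
  have ev: "0 < x" if x: "eigenvalue A x" for x
  proof -
    obtain v where "v \<in> carrier_vec n" "v \<noteq> 0\<^sub>v n" "map_mat complex_of_real A *\<^sub>v v = complex_of_real x \<cdot>\<^sub>v v"
      by (rule complexified_eigenvector[OF AC x])
    then have "\<exists>a. complex_of_real x = complex_of_real a \<and> \<mu> \<le> a" by (rule coercive_eigenvalue[OF A])
    then show ?thesis using A(2) by auto
  qed
  show "0 < det A"
    unfolding E(1) using ev by (intro prod_pos) auto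
  show "det_plus A = det A"
    unfolding det_plus_def E(1) using ev by (intro prod.cong) auto
qed

lemma coercive_inverse:
  assumes A: "coercive n \<mu> A" "0 < \<mu>"
  shows "inv_mat A \<in> carrier_mat n n" "A * inv_mat A = 1\<^sub>m n" "inv_mat A * A = 1\<^sub>m n"
    "moore_penrose A = inv_mat A"
    "\<And>i j. i < n \<Longrightarrow> j < n \<Longrightarrow> inv_mat A $$ (i, j) = inv_mat A $$ (j, i)"
proof -
  have AC: "A \<in> carrier_mat n n" using A by (simp add: coercive_def)
  have "A \<in> Units (ring_mat TYPE(real) n ())"
    using coercive_det(1)[OF A] by (intro det_non_zero_imp_unit[OF AC]) auto
  then obtain B where B: "mat_inverse A = Some B" using mat_inverse(1)[OF AC, where b = "()"] by (cases "mat_inverse A") auto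
  then have inv: "inv_mat A = B" by (simp add: inv_mat_def)
  have B': "A * B = 1\<^sub>m n" "B * A = 1\<^sub>m n" "B \<in> carrier_mat n n" using mat_inverse(2)[OF AC B] by auto
  show "inv_mat A \<in> carrier_mat n n" "A * inv_mat A = 1\<^sub>m n" "inv_mat A * A = 1\<^sub>m n"
    using B' inv by auto
  have At: "transpose_mat A = A" using A AC by (intro eq_matI) (auto simp: coercive_def)
  have mp: "is_moore_penrose A B"
    using AC B' by (auto simp: is_moore_penrose_def)
  have unique: "C = B" if C: "is_moore_penrose A C" for C
  proof -
    have CC: "C \<in> carrier_mat n n" and ACA: "A * C * A = A" using C AC by (auto simp: is_moore_penrose_def)
    have AC1: "A * C = 1\<^sub>m n"
    proof -
      have "A * C = A * C * (A * B)" using B' AC CC by simp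
      also have "\<dots> = (A * C * A) * B"
        using AC B' CC by (intro assoc_mult_mat[symmetric, of _ n n _ n _ n]) auto
      finally show ?thesis unfolding ACA using B' by simp
    qed
    have "C = (B * A) * C" using B' CC by simp
    also have "\<dots> = B * (A * C)" using AC B' CC by (intro assoc_mult_mat[of _ n n _ n _ n]) auto
    also have "\<dots> = B" unfolding AC1 using B' by simp
    finally show ?thesis .
  qed
  show "moore_penrose A = inv_mat A"
    unfolding moore_penrose_def inv by (rule the_equality, rule mp, rule unique)
  have "transpose_mat B * A = 1\<^sub>m n"
    using transpose_mult[OF AC B'(3)] B'(1) At by simp
  then have "transpose_mat B * A * B = B" using B' by simp
  then have "transpose_mat B * (A * B) = B" using AC B' by (subst assoc_mult_mat[symmetric, of _ n n _ n _ n]) auto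
  then have Bt: "transpose_mat B = B" using B' by simp
  show "inv_mat A $$ (i, j) = inv_mat A $$ (j, i)" if "i < n" "j < n" for i j
    unfolding inv using arg_cong[OF Bt, of "\<lambda>M. M $$ (j, i)"] that B' by simp
qed

lemma coercive_solve:
  assumes A: "coercive n \<mu> A" "0 < \<mu>" and i: "i < n"
  shows "(\<Sum>j<n. A $$ (i, j) * (\<Sum>k<n. inv_mat A $$ (j, k) * x k)) = x i"
proof -
  note I = coercive_inverse[OF A]
  have AC: "A \<in> carrier_mat n n" using A by (simp add: coercive_def)
  have "(\<Sum>j<n. A $$ (i, j) * (\<Sum>k<n. inv_mat A $$ (j, k) * x k)) = (\<Sum>k<n. (\<Sum>j<n. A $$ (i, j) * inv_mat A $$ (j, k)) * x k)"
    unfolding sum_distrib_left sum_distrib_right by (subst sum.swap) (simp add: mult_ac)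
  also have "\<dots> = (\<Sum>k<n. (A * inv_mat A) $$ (i, k) * x k)"
    by (intro sum.cong refl, subst mat_mult_entry[OF AC I(1) i]) auto
  also have "\<dots> = (\<Sum>k<n. if i = k then x k else 0)"
    unfolding I(2) using i by (intro sum.cong) auto
  finally show ?thesis using i by simp
qed

text \<open>
  If \<open>y\<close> solves \<open>A y = x\<close> then \<open>\<mu> \<parallel>y\<parallel>\<^sup>2 \<le> \<langle>y, A y\<rangle> = \<langle>y, x\<rangle>\<close>, and the right-hand side is at most
  \<open>\<mu> / 2 \<parallel>y\<parallel>\<^sup>2 + \<parallel>x\<parallel>\<^sup>2 / (2 \<mu>)\<close>.
\<close>

lemma coercive_inverse_norm:
  assumes A: "coercive n \<mu> A" "0 < \<mu>"
  shows "sq_norm n (\<lambda>i. \<Sum>j<n. inv_mat A $$ (i, j) * x j) \<le> sq_norm n x / \<mu>\<^sup>2"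
proof -
  define y where "y = (\<lambda>i. \<Sum>j<n. inv_mat A $$ (i, j) * x j)"
  have "\<mu> * sq_norm n y \<le> quadratic_form n (entries A) y"
    using A by (simp add: coercive_def)
  also have "\<dots> = (\<Sum>i<n. y i * x i)"
    unfolding quadratic_form_bilinear bilinear_form_rows
    by (intro sum.cong refl) (simp add: y_def coercive_solve[OF A])
  also have "\<dots> \<le> (\<Sum>i<n. \<mu> / 2 * (y i)\<^sup>2 + 1 / (2 * \<mu>) * (x i)\<^sup>2)"
  proof (rule sum_mono)
    fix i
    have "0 \<le> (\<mu> * y i - x i)\<^sup>2 / (2 * \<mu>)" using A(2) by simp
    also have "\<dots> = \<mu> / 2 * (y i)\<^sup>2 + 1 / (2 * \<mu>) * (x i)\<^sup>2 - y i * x i"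
      using A(2) by (simp add: power2_eq_square field_simps)
    finally show "y i * x i \<le> \<mu> / 2 * (y i)\<^sup>2 + 1 / (2 * \<mu>) * (x i)\<^sup>2" by simp
  qed
  also have "\<dots> = \<mu> / 2 * sq_norm n y + 1 / (2 * \<mu>) * sq_norm n x"
    by (simp only: sum.distrib sq_norm_def sum_distrib_left)
  finally have "\<mu> / 2 * sq_norm n y \<le> 1 / (2 * \<mu>) * sq_norm n x" by simp
  then have "sq_norm n y * \<mu>\<^sup>2 \<le> sq_norm n x"
    using A(2) by (simp add: field_simps power2_eq_square)
  then show ?thesis unfolding y_def[symmetric] using A(2) by (simp add: le_divide_eq)
qed

text \<open>
  The resolvent identity: the inverses \<open>B\<close> and \<open>B'\<close> of \<open>A\<close> and \<open>A'\<close> satisfy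
  \<open>B' - B = - B (A' - A) B'\<close>, so the form at \<open>x\<close> is the bilinear form of \<open>A' - A\<close> at \<open>B x\<close> and \<open>B' x\<close>.
\<close>

lemma inverse_perturbation:
  assumes A: "coercive n \<mu> A" and A': "coercive n \<mu> A'" and \<mu>: "0 < \<mu>"
    and D: "\<And>x y. \<bar>bilinear_form n (\<lambda>i j. A' $$ (i, j) - A $$ (i, j)) x y\<bar> \<le> \<epsilon> * (sq_norm n x + sq_norm n y) / 2"
    and \<epsilon>: "0 \<le> \<epsilon>"
  shows "\<bar>quadratic_form n (\<lambda>i j. inv_mat A' $$ (i, j) - inv_mat A $$ (i, j)) x\<bar> \<le> \<epsilon> / \<mu>\<^sup>2 * sq_norm n x"
proof -
  define y y' where "y = (\<lambda>i. \<Sum>j<n. inv_mat A $$ (i, j) * x j)" and "y' = (\<lambda>i. \<Sum>j<n. inv_mat A' $$ (i, j) * x j)"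
  have sym: "\<And>i j. i < n \<Longrightarrow> j < n \<Longrightarrow> A $$ (i, j) = A $$ (j, i)" using A by (auto simp: coercive_def)
  have split: "quadratic_form n (\<lambda>i j. inv_mat A' $$ (i, j) - inv_mat A $$ (i, j)) x = (\<Sum>i<n. x i * y' i) - (\<Sum>i<n. x i * y i)"
    unfolding quadratic_form_bilinear bilinear_form_rows y_def y'_def
    by (simp add: left_diff_distrib right_diff_distrib sum_subtractf)
  have "(\<Sum>i<n. x i * y i) = (\<Sum>i<n. y i * (\<Sum>j<n. A' $$ (i, j) * y' j))"
    by (intro sum.cong refl) (simp add: y'_def coercive_solve[OF A' \<mu>])
  then have 1: "(\<Sum>i<n. x i * y i) = bilinear_form n (entries A') y y'"
    by (simp add: bilinear_form_rows)
  have "(\<Sum>i<n. x i * y' i) = (\<Sum>i<n. y' i * (\<Sum>j<n. A $$ (i, j) * y j))"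
    by (intro sum.cong refl) (simp add: y_def coercive_solve[OF A \<mu>])
  then have "(\<Sum>i<n. x i * y' i) = bilinear_form n (entries A) y' y"
    by (simp add: bilinear_form_rows)
  also have "\<dots> = bilinear_form n (entries A) y y'"
    by (rule bilinear_form_sym[OF sym])
  finally have 2: "(\<Sum>i<n. x i * y' i) = bilinear_form n (entries A) y y'" .
  have "quadratic_form n (\<lambda>i j. inv_mat A' $$ (i, j) - inv_mat A $$ (i, j)) x = - bilinear_form n (\<lambda>i j. A' $$ (i, j) - A $$ (i, j)) y y'"
    unfolding split 1 2 by (simp add: bilinear_form_def left_diff_distrib sum_subtractf)
  then have "\<bar>quadratic_form n (\<lambda>i j. inv_mat A' $$ (i, j) - inv_mat A $$ (i, j)) x\<bar> \<le> \<epsilon> * (sq_norm n y + sq_norm n y') / 2"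
    using D[of y y'] by simp
  also have "\<dots> \<le> \<epsilon> * (sq_norm n x / \<mu>\<^sup>2 + sq_norm n x / \<mu>\<^sup>2) / 2"
    using coercive_inverse_norm[OF A \<mu>, of x] coercive_inverse_norm[OF A' \<mu>, of x] \<epsilon>
    unfolding y_def[symmetric] y'_def[symmetric] by (intro divide_right_mono mult_left_mono add_mono) auto
  also have "\<dots> = \<epsilon> / \<mu>\<^sup>2 * sq_norm n x" by simp
  finally show ?thesis .
qed

text \<open>
  The eigenvalues of \<open>A\<close>-inverse times \<open>A'\<close> are quotients of the two quadratic forms at a common
  vector and so lie within \<open>\<epsilon> / \<mu>\<close> of \<open>1\<close>; the determinant is the product of \<open>n\<close> of them.
\<close>

lemma log_det_perturbation:
  assumes A: "coercive n \<mu> A" and A': "coercive n \<mu> A'" and \<mu>: "0 < \<mu>"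
    and D: "\<And>x. \<bar>quadratic_form n (\<lambda>i j. A' $$ (i, j) - A $$ (i, j)) x\<bar> \<le> \<epsilon> * sq_norm n x"
    and \<epsilon>: "0 \<le> \<epsilon>" "\<epsilon> \<le> \<mu> / 2"
  shows "\<bar>ln (det A') - ln (det A)\<bar> \<le> real n * (2 * \<epsilon> / \<mu>)"
proof -
  define \<rho> where "\<rho> = \<epsilon> / \<mu>"
  have \<rho>: "0 \<le> \<rho>" "\<rho> \<le> 1 / 2" using \<epsilon> \<mu> by (auto simp: \<rho>_def divide_le_eq)
  note I = coercive_inverse[OF A \<mu>]
  have AC: "A \<in> carrier_mat n n" and AC': "A' \<in> carrier_mat n n" using A A' by (simp_all add: coercive_def)
  define P where "P = inv_mat A * A'"
  have P: "P \<in> carrier_mat n n" using I AC' by (simp add: P_def)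
  have AP: "A * P = A'"
  proof -
    have "A * P = (A * inv_mat A) * A'"
      unfolding P_def using AC AC' I by (intro assoc_mult_mat[symmetric, of _ n n _ n _ n]) auto
    then show ?thesis using I AC' by simp
  qed
  have eig: "\<exists>a. z = complex_of_real a \<and> 1 - \<rho> \<le> a \<and> a \<le> 1 + \<rho>"
    if v: "v \<in> carrier_vec n" "v \<noteq> 0\<^sub>v n" "map_mat complex_of_real P *\<^sub>v v = z \<cdot>\<^sub>v v" for z v
  proof -
    have "map_mat complex_of_real A' *\<^sub>v v = map_mat complex_of_real A *\<^sub>v (map_mat complex_of_real P *\<^sub>v v)"
      unfolding AP[symmetric] of_real_hom.mat_hom_mult[OF AC P]
      using AC P v by (intro assoc_mult_mat_vec[of _ n n _ n]) auto
    also have "\<dots> = z \<cdot>\<^sub>v (map_mat complex_of_real A *\<^sub>v v)"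
      unfolding v(3) using AC v(1) by (intro mult_mat_vec[of _ n n]) auto
    finally have eq: "map_mat complex_of_real A' *\<^sub>v v = z \<cdot>\<^sub>v (map_mat complex_of_real A *\<^sub>v v)" .
    have "\<exists>a u. z = complex_of_real a \<and> 0 < sq_norm n u \<and> quadratic_form n (entries A') u = a * quadratic_form n (entries A) u"
    proof (rule symmetric_pencil_eigenvalue[where v = "vec_index v"])
      show "\<exists>i<n. vec_index v i \<noteq> 0" using v(1,2) by (auto intro: eq_vecI)
      show "0 < quadratic_form n (entries A) x" if "0 < sq_norm n x" for x
        using A \<mu> mult_pos_pos[OF \<mu> that] unfolding coercive_def by (meson less_le_trans)
      fix i assume i: "i < n"
      show "(\<Sum>j<n. complex_of_real (A' $$ (i, j)) * vec_index v j) = z * (\<Sum>j<n. complex_of_real (A $$ (i, j)) * vec_index v j)"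
        using arg_cong[OF eq, of "\<lambda>w. vec_index w i"] AC AC' v(1) i
        by (simp add: scalar_prod_def atLeast0LessThan)
    qed (use A A' in \<open>auto simp: coercive_def\<close>)
    then obtain a u where au: "z = complex_of_real a" "0 < sq_norm n u" "quadratic_form n (entries A') u = a * quadratic_form n (entries A) u"
      by blast
    have low: "\<mu> * sq_norm n u \<le> quadratic_form n (entries A) u" using A by (simp add: coercive_def)
    then have qpos: "0 < quadratic_form n (entries A) u" using mult_pos_pos[OF \<mu> au(2)] by linarith
    have "quadratic_form n (\<lambda>i j. A' $$ (i, j) - A $$ (i, j)) u = (a - 1) * quadratic_form n (entries A) u"
      using au(3) by (simp add: quadratic_form_def left_diff_distrib sum_subtractf)
    then have "\<bar>a - 1\<bar> * quadratic_form n (entries A) u \<le> \<epsilon> * sq_norm n u"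
      using D[of u] qpos by (simp add: abs_mult)
    also have "\<dots> = \<rho> * (\<mu> * sq_norm n u)" using \<mu> by (simp add: \<rho>_def)
    also have "\<dots> \<le> \<rho> * quadratic_form n (entries A) u" by (rule mult_left_mono[OF low \<rho>(1)])
    finally have "\<bar>a - 1\<bar> \<le> \<rho>" using qpos by simp
    then have "1 - \<rho> \<le> a \<and> a \<le> 1 + \<rho>" by linarith
    then show ?thesis using au(1) by blast
  qed
  have b: "(1 - \<rho>) ^ n \<le> det P" "det P \<le> (1 + \<rho>) ^ n"
    by (rule det_bounds_real_eigenvalues[OF P _ eig]; use \<rho> in simp)+
  have d: "0 < det A" "0 < det A'" using coercive_det(1)[OF A \<mu>] coercive_det(1)[OF A' \<mu>] .
  have "det A' = det A * det P" unfolding AP[symmetric] by (rule det_mult[OF AC P])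
  then have dP: "det P = det A' / det A" "0 < det P" using d by (auto simp: zero_less_mult_iff)
  have L: "ln (det P) = ln (det A') - ln (det A)" unfolding dP(1) using d by (simp add: ln_div)
  have "ln (det P) \<le> ln ((1 + \<rho>) ^ n)" using b dP(2) \<rho> by (subst ln_le_cancel_iff) auto
  also have "\<dots> = real n * ln (1 + \<rho>)" using \<rho> by (simp add: ln_realpow)
  also have "\<dots> \<le> real n * (2 * \<rho>)" using ln_add_one_self_le_self[OF \<rho>(1)] \<rho> by (intro mult_left_mono) auto
  finally have up: "ln (det P) \<le> real n * (2 * \<rho>)" .
  have "- (2 * \<rho>) \<le> ln (1 - \<rho>)"
  proof -
    have "- \<rho> - 2 * \<rho>\<^sup>2 \<le> ln (1 - \<rho>)" by (rule ln_one_minus_pos_lower_bound[OF \<rho>])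
    moreover have "2 * \<rho>\<^sup>2 \<le> \<rho>" using mult_left_mono[OF \<rho>(2), of "2 * \<rho>"] \<rho>(1) by (simp add: power2_eq_square)
    ultimately show ?thesis by linarith
  qed
  then have "real n * (- (2 * \<rho>)) \<le> real n * ln (1 - \<rho>)" by (intro mult_left_mono) auto
  also have "\<dots> = ln ((1 - \<rho>) ^ n)" using \<rho> by (simp add: ln_realpow)
  also have "\<dots> \<le> ln (det P)" using b dP(2) \<rho> by (subst ln_le_cancel_iff) auto
  finally show ?thesis using up unfolding L \<rho>_def by simp
qed

lemma scaled_kl_eq:
  assumes K: "coercive n \<nu> K" "0 < \<nu>" and R: "coercive n \<mu> R" "0 < \<mu>"
  shows "scaled_kl n K R = (ln (det R) - ln (det K)) / real n
     + (\<Sum>i<n. \<Sum>j<n. inv_mat R $$ (i, j) * K $$ (i, j)) / real n - 1"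
proof -
  note I = coercive_inverse[OF K] and J = coercive_inverse[OF R]
  have KC: "K \<in> carrier_mat n n" and RC: "R \<in> carrier_mat n n" using K R by (simp_all add: coercive_def)
  have "det K * det (inv_mat K) = 1" using det_mult[OF KC I(1)] I(2) by simp
  then have dI: "det (inv_mat K) = 1 / det K" using coercive_det(1)[OF K] by (simp add: field_simps)
  have "ln (det (R * inv_mat K)) = ln (det R) - ln (det K)"
    unfolding det_mult[OF RC I(1)] dI using coercive_det(1)[OF K] coercive_det(1)[OF R] by (simp add: ln_div)
  moreover have "mat_trace (K * inv_mat R) = (\<Sum>i<n. \<Sum>j<n. inv_mat R $$ (i, j) * K $$ (i, j))"
  proof -
    have "mat_trace (K * inv_mat R) = (\<Sum>i<n. (K * inv_mat R) $$ (i, i))"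
      using KC by (simp add: mat_trace_def)
    also have "\<dots> = (\<Sum>i<n. \<Sum>j<n. K $$ (i, j) * inv_mat R $$ (j, i))"
      by (intro sum.cong refl) (simp only: mat_mult_entry[OF KC J(1)] lessThan_iff)
    also have "\<dots> = (\<Sum>i<n. \<Sum>j<n. inv_mat R $$ (i, j) * K $$ (i, j))"
      using J(5) by (intro sum.cong refl) (simp add: mult.commute)
    finally show ?thesis .
  qed
  ultimately show ?thesis by (simp add: scaled_kl_def)
qed

lemma truncated_likelihood_eq:
  assumes R: "coercive n \<mu> R" "0 < \<mu>" and z: "z \<in> carrier_vec n"
  shows "truncated_likelihood n R z = ln (det R) / real n + quadratic_form n (entries (inv_mat R)) (vec_index z) / real n"
  unfolding truncated_likelihood_def coercive_det(2)[OF R] coercive_inverse(4)[OF R]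
    scalar_prod_mat_vec[OF coercive_inverse(1)[OF R] z] by simp

section \<open>Covariance models at lattice-like sites\<close>

lemma cov_mat_entry: "i < n \<Longrightarrow> j < n \<Longrightarrow> cov_mat n c s $$ (i, j) = c (s (Suc i) - s (Suc j))"
  by (simp add: cov_mat_def)

lemma cov_mat_carrier: "cov_mat n c s \<in> carrier_mat n n"
  by (simp add: cov_mat_def)

lemma quadratic_form_cong:
  assumes "\<And>i j. i < n \<Longrightarrow> j < n \<Longrightarrow> E i j = E' i j"
  shows "quadratic_form n E x = quadratic_form n E' x"
  unfolding quadratic_form_def by (intro sum.cong refl) (simp add: assms)

lemma bilinear_form_cong:
  assumes "\<And>i j. i < n \<Longrightarrow> j < n \<Longrightarrow> E i j = E' i j"
  shows "bilinear_form n E x y = bilinear_form n E' x y"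
  unfolding bilinear_form_def by (intro sum.cong refl) (simp add: assms)

lemma coercive_cov_mat:
  assumes "\<And>s. c (- s) = c s"
    and "\<And>y. \<mu> * sq_norm n y \<le> quadratic_form n (\<lambda>i j. c (s (Suc i) - s (Suc j))) y"
  shows "coercive n \<mu> (cov_mat n c s)"
  unfolding coercive_def
proof (intro conjI allI impI)
  show "cov_mat n c s \<in> carrier_mat n n" by (rule cov_mat_carrier)
  fix i j assume "i < n" "j < n"
  then show "cov_mat n c s $$ (i, j) = cov_mat n c s $$ (j, i)"
    using assms(1)[of "s (Suc i) - s (Suc j)"] by (simp add: cov_mat_entry)
next
  fix y
  have "quadratic_form n (entries (cov_mat n c s)) y = quadratic_form n (\<lambda>i j. c (s (Suc i) - s (Suc j))) y"
    by (rule quadratic_form_cong) (simp add: cov_mat_entry)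
  then show "\<mu> * sq_norm n y \<le> quadratic_form n (entries (cov_mat n c s)) y"
    using assms(2) by simp
qed

lemma coercive_perturbation:
  assumes A: "coercive n \<mu> A" and A': "A' \<in> carrier_mat n n"
    and sym: "\<And>i j. i < n \<Longrightarrow> j < n \<Longrightarrow> A' $$ (i, j) = A' $$ (j, i)"
    and D: "\<And>x. \<bar>quadratic_form n (\<lambda>i j. A' $$ (i, j) - A $$ (i, j)) x\<bar> \<le> \<epsilon> * sq_norm n x"
  shows "coercive n (\<mu> - \<epsilon>) A'"
  unfolding coercive_def
proof (intro conjI allI impI A' sym)
  fix x
  have "quadratic_form n (\<lambda>i j. A' $$ (i, j) - A $$ (i, j)) x = quadratic_form n (entries A') x - quadratic_form n (entries A) x"
    by (simp add: quadratic_form_def left_diff_distrib sum_subtractf)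
  moreover have "\<mu> * sq_norm n x \<le> quadratic_form n (entries A) x"
    using A by (simp add: coercive_def)
  ultimately show "(\<mu> - \<epsilon>) * sq_norm n x \<le> quadratic_form n (entries A') x"
    using D[of x] by (simp add: left_diff_distrib)
qed

lemma coercive_mono:
  assumes "coercive n \<mu> A" "\<nu> \<le> \<mu>"
  shows "coercive n \<nu> A"
  using assms mult_right_mono[OF assms(2) sq_norm_nonneg] unfolding coercive_def by (meson order_trans)

text \<open>
  A kernel of range \<open>C\<close> has at most \<open>W\<close> nonzero entries in each row.
\<close>

lemma local_kernel_bilinear_bound:
  assumes W: "\<And>i. card {j. j < n \<and> norm (s (Suc i) - s (Suc j)) \<le> C} \<le> W"
    and bd: "\<And>x. \<bar>c x\<bar> \<le> e" and supp: "\<And>x. C < norm x \<Longrightarrow> c x = 0" and even: "\<And>x. c (- x) = c x"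
  shows "\<bar>bilinear_form n (\<lambda>i j. c (s (Suc i) - s (Suc j))) x y\<bar> \<le> real W * e * (sq_norm n x + sq_norm n y) / 2"
proof -
  have e: "0 \<le> e" using bd[of 0] by linarith
  have row: "(\<Sum>j<n. \<bar>c (s (Suc i) - s (Suc j))\<bar>) \<le> real W * e" for i
  proof -
    have "(\<Sum>j<n. \<bar>c (s (Suc i) - s (Suc j))\<bar>) = (\<Sum>j | j < n \<and> norm (s (Suc i) - s (Suc j)) \<le> C. \<bar>c (s (Suc i) - s (Suc j))\<bar>)"
      using supp by (intro sum.mono_neutral_right) (auto simp: not_le)
    also have "\<dots> \<le> real (card {j. j < n \<and> norm (s (Suc i) - s (Suc j)) \<le> C}) * e"
      by (rule sum_bounded_above) (rule bd)
    also have "\<dots> \<le> real W * e"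
      using W[of i] e by (intro mult_right_mono) auto
    finally show ?thesis .
  qed
  have col: "(\<Sum>i<n. \<bar>c (s (Suc i) - s (Suc j))\<bar>) \<le> real W * e" for j
  proof -
    have "c (s (Suc i) - s (Suc j)) = c (s (Suc j) - s (Suc i))" for i
      using even[of "s (Suc i) - s (Suc j)"] by simp
    then show ?thesis using row[of j] by simp
  qed
  show ?thesis
    unfolding bilinear_form_def by (rule bilinear_row_sum_bound[OF row col])
qed

text \<open>
  The premise \<open>tr\<close> is the conclusion of the trace bound for \<open>K\<close>; it turns the perturbation of the
  inverse into one of the trace term.
\<close>

lemma scaled_kl_perturbation:
  assumes K: "coercive n \<nu> K" "0 < \<nu>"
    and A: "coercive n \<mu> A" and A': "coercive n \<mu> A'" and \<mu>: "0 < \<mu>"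
    and D: "\<And>x y. \<bar>bilinear_form n (\<lambda>i j. A' $$ (i, j) - A $$ (i, j)) x y\<bar> \<le> \<epsilon> * (sq_norm n x + sq_norm n y) / 2"
    and tr: "\<And>E e. (\<And>x. \<bar>quadratic_form n E x\<bar> \<le> e * sq_norm n x) \<Longrightarrow> \<bar>\<Sum>i<n. \<Sum>j<n. E i j * K $$ (i, j)\<bar> \<le> e * \<kappa> * real n"
    and \<epsilon>: "0 \<le> \<epsilon>" "\<epsilon> \<le> \<mu> / 2" and n: "1 \<le> n"
  shows "\<bar>scaled_kl n K A' - scaled_kl n K A\<bar> \<le> (2 / \<mu> + \<kappa> / \<mu>\<^sup>2) * \<epsilon>"
proof -
  have D': "\<bar>quadratic_form n (\<lambda>i j. A' $$ (i, j) - A $$ (i, j)) x\<bar> \<le> \<epsilon> * sq_norm n x" for x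
    using D[of x x] by (simp add: quadratic_form_bilinear)
  have 1: "\<bar>ln (det A') - ln (det A)\<bar> \<le> real n * (2 * \<epsilon> / \<mu>)"
    by (rule log_det_perturbation[OF A A' \<mu> D' \<epsilon>])
  have 2: "\<bar>\<Sum>i<n. \<Sum>j<n. (inv_mat A' $$ (i, j) - inv_mat A $$ (i, j)) * K $$ (i, j)\<bar> \<le> \<epsilon> / \<mu>\<^sup>2 * \<kappa> * real n"
    by (rule tr[OF inverse_perturbation[OF A A' \<mu> D \<epsilon>(1)]])
  have "scaled_kl n K A' - scaled_kl n K A = (ln (det A') - ln (det A)) / real n
      + (\<Sum>i<n. \<Sum>j<n. (inv_mat A' $$ (i, j) - inv_mat A $$ (i, j)) * K $$ (i, j)) / real n"
    unfolding scaled_kl_eq[OF K A \<mu>] scaled_kl_eq[OF K A' \<mu>]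
    by (simp add: left_diff_distrib sum_subtractf diff_divide_distrib)
  also have "\<bar>\<dots>\<bar> \<le> real n * (2 * \<epsilon> / \<mu>) / real n + \<epsilon> / \<mu>\<^sup>2 * \<kappa> * real n / real n"
    using divide_right_mono[OF 1, of "real n"] divide_right_mono[OF 2, of "real n"]
    by (intro order_trans[OF abs_triangle_ineq] add_mono) simp_all
  also have "\<dots> = (2 / \<mu> + \<kappa> / \<mu>\<^sup>2) * \<epsilon>"
    using n by (simp add: algebra_simps)
  finally show ?thesis .
qed

lemma cosine_transform_continuous:
  assumes "cosine_transform c chat"
  shows "continuous_on UNIV c"
proof -
  have ic: "integrable lborel chat" and c: "\<And>s. c s = (LINT f|lborel. chat f * cos (inner f s))"
    using assms by (auto simp: cosine_transform_def)
  have "isCont c s" for s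
    unfolding continuous_at_sequentially o_def c
  proof (intro allI impI)
    fix x :: "nat \<Rightarrow> 'a" assume x: "x \<longlonglongrightarrow> s"
    show "(\<lambda>n. LINT f|lborel. chat f * cos (inner f (x n))) \<longlonglongrightarrow> (LINT f|lborel. chat f * cos (inner f s))"
    proof (rule integral_dominated_convergence[where w = "\<lambda>f. \<bar>chat f\<bar>"])
      show "AE f in lborel. (\<lambda>n. chat f * cos (inner f (x n))) \<longlonglongrightarrow> chat f * cos (inner f s)"
        by (intro AE_I2 tendsto_intros x)
      show "\<And>n. AE f in lborel. norm (chat f * cos (inner f (x n))) \<le> \<bar>chat f\<bar>"
        by (intro AE_I2) (simp add: abs_mult mult_left_le)
    qed (use ic cosine_transform_integrable[OF assms] in \<open>auto intro: borel_measurable_integrable\<close>)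
  qed
  then show ?thesis by (simp add: continuous_on_eq_continuous_at)
qed

lemma positive_spectral_familyD:
  assumes "positive_spectral_family T c chat" "\<eta> \<in> T"
  shows "cosine_transform (c \<eta>) (chat \<eta>)" "continuous_on UNIV (chat \<eta>)" "0 < chat \<eta> f"
proof -
  show "cosine_transform (c \<eta>) (chat \<eta>)" "0 < chat \<eta> f"
    using assms fourier_inversion_cosine_transform by (auto simp: positive_spectral_family_def)
  have "continuous_on UNIV ((\<lambda>(\<eta>, f). chat \<eta> f) \<circ> (\<lambda>f. (\<eta>, f)))"
    using assms by (intro continuous_on_compose continuous_intros)
      (auto simp: positive_spectral_family_def elim!: continuous_on_subset)
  then show "continuous_on UNIV (chat \<eta>)" by (simp add: o_def)
qed

lemma covariance_model_bounded:
  fixes k :: "real ^ 'p \<Rightarrow> real ^ 'd \<Rightarrow> real"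
  assumes "covariance_model \<Theta> k dk khat"
  obtains A where "0 \<le> A" "\<And>\<theta> s. \<theta> \<in> \<Theta> \<Longrightarrow> \<bar>k \<theta> s\<bar> \<le> A" "\<And>\<theta> s i. \<theta> \<in> \<Theta> \<Longrightarrow> \<bar>dk i \<theta> s\<bar> \<le> A"
    and "\<And>\<theta> s. \<theta> \<in> \<Theta> \<Longrightarrow> 1 \<le> norm s \<Longrightarrow> \<bar>k \<theta> s\<bar> \<le> A / norm s"
proof -
  have "\<exists>A \<alpha>. 0 < \<alpha> \<and> (\<forall>\<theta>\<in>\<Theta>. \<forall>s.
      \<bar>k \<theta> s\<bar> \<le> A / (1 + norm s powr (real CARD('d) + \<alpha>)) \<and>
      (\<forall>i. \<bar>dk i \<theta> s\<bar> \<le> A / (1 + norm s powr (real CARD('d) + \<alpha>))))"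
    using assms by (simp add: covariance_model_def)
  then obtain A \<alpha> where \<alpha>: "0 < \<alpha>" and AA: "\<forall>\<theta>\<in>\<Theta>. \<forall>s.
      \<bar>k \<theta> s\<bar> \<le> A / (1 + norm s powr (real CARD('d) + \<alpha>)) \<and>
      (\<forall>i. \<bar>dk i \<theta> s\<bar> \<le> A / (1 + norm s powr (real CARD('d) + \<alpha>)))"
    by blast
  then have A: "\<bar>k \<theta> s\<bar> \<le> A / (1 + norm s powr (real CARD('d) + \<alpha>))"
    "\<bar>dk i \<theta> s\<bar> \<le> A / (1 + norm s powr (real CARD('d) + \<alpha>))" if "\<theta> \<in> \<Theta>" for \<theta> s i
    using that by blast+
  have le: "\<bar>A\<bar> / (1 + norm s powr p) \<le> \<bar>A\<bar>" for p and s :: "real ^ 'd"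
    using divide_left_mono[of 1 "1 + norm s powr p" "\<bar>A\<bar>"] by (simp add: add_pos_nonneg)
  have up: "A / (1 + norm s powr p) \<le> \<bar>A\<bar> / (1 + norm s powr p)" for p and s :: "real ^ 'd"
    by (intro divide_right_mono) auto
  show thesis
  proof
    show "0 \<le> \<bar>A\<bar>" by simp
    show "\<bar>k \<theta> s\<bar> \<le> \<bar>A\<bar>" if "\<theta> \<in> \<Theta>" for \<theta> s
      using A(1)[OF that, of s] le up order_trans by meson
    show "\<bar>dk i \<theta> s\<bar> \<le> \<bar>A\<bar>" if "\<theta> \<in> \<Theta>" for \<theta> s i
      using A(2)[OF that, of i s] le up order_trans by meson
    show "\<bar>k \<theta> s\<bar> \<le> \<bar>A\<bar> / norm s" if "\<theta> \<in> \<Theta>" and s: "1 \<le> norm s" for \<theta> s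
    proof -
      have "1 \<le> real CARD('d) + \<alpha>" using \<alpha> by (simp add: add_increasing2 Suc_le_eq)
      then have "norm s powr 1 \<le> norm s powr (real CARD('d) + \<alpha>)" using s by (intro powr_mono) auto
      then have "norm s \<le> 1 + norm s powr (real CARD('d) + \<alpha>)" using s by simp
      then have "\<bar>A\<bar> / (1 + norm s powr (real CARD('d) + \<alpha>)) \<le> \<bar>A\<bar> / norm s"
        using s by (intro divide_left_mono) (auto intro!: mult_pos_pos add_pos_nonneg)
      then show ?thesis using A(1)[OF that(1), of s] up order_trans by meson
    qed
  qed
qed

lemma covariance_model_lipschitz:
  fixes k :: "real ^ 'p \<Rightarrow> real ^ 'd \<Rightarrow> real"
  assumes M: "covariance_model \<Theta> k dk khat" and conv: "convex \<Theta>"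
  obtains L where "0 \<le> L" "\<And>\<theta> \<theta>' s. \<theta> \<in> \<Theta> \<Longrightarrow> \<theta>' \<in> \<Theta> \<Longrightarrow> \<bar>k \<theta> s - k \<theta>' s\<bar> \<le> L * dist \<theta> \<theta>'"
proof -
  obtain A where A: "0 \<le> A" "\<And>\<theta> s i. \<theta> \<in> \<Theta> \<Longrightarrow> \<bar>dk i \<theta> s\<bar> \<le> A"
    using covariance_model_bounded[OF M] by metis
  have "\<bar>k \<theta> s - k \<theta>' s\<bar> \<le> real CARD('p) * A * dist \<theta> \<theta>'" if "\<theta> \<in> \<Theta>" "\<theta>' \<in> \<Theta>" for \<theta> \<theta>' s
  proof -
    have "norm (k \<theta> s - k \<theta>' s) \<le> real CARD('p) * A * norm (\<theta> - \<theta>')"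
    proof (rule differentiable_bound[OF conv _ _ that(1,2), where f' = "\<lambda>\<eta> h. \<Sum>i\<in>UNIV. dk i \<eta> s * h $ i"])
      fix \<eta> assume \<eta>: "\<eta> \<in> \<Theta>"
      show "((\<lambda>\<eta>. k \<eta> s) has_derivative (\<lambda>h. \<Sum>i\<in>UNIV. dk i \<eta> s * h $ i)) (at \<eta> within \<Theta>)"
        using M \<eta> by (simp add: covariance_model_def has_gradient_on_def)
      show "onorm (\<lambda>h. \<Sum>i\<in>UNIV. dk i \<eta> s * h $ i) \<le> real CARD('p) * A"
      proof (rule onorm_le)
        fix h :: "real ^ 'p"
        have "norm (\<Sum>i\<in>UNIV. dk i \<eta> s * h $ i) \<le> (\<Sum>i\<in>(UNIV::'p set). A * norm h)"
          using A \<eta> by (intro sum_norm_le) (auto simp: abs_mult intro!: mult_mono component_le_norm_cart)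
        then show "norm (\<Sum>i\<in>UNIV. dk i \<eta> s * h $ i) \<le> real CARD('p) * A * norm h" by simp
      qed
    qed
    then show ?thesis by (simp add: dist_norm)
  qed
  moreover have "0 \<le> real CARD('p) * A" using A by simp
  ultimately show thesis using that by blast
qed

lemma covariance_model_continuous:
  fixes k :: "real ^ 'p \<Rightarrow> real ^ 'd \<Rightarrow> real"
  assumes M: "covariance_model \<Theta> k dk khat" and conv: "convex \<Theta>"
  shows "continuous_on (\<Theta> \<times> UNIV) (\<lambda>(\<theta>, s). k \<theta> s)"
proof -
  obtain L where L: "0 \<le> L" "\<And>\<theta> \<theta>' s. \<theta> \<in> \<Theta> \<Longrightarrow> \<theta>' \<in> \<Theta> \<Longrightarrow> \<bar>k \<theta> s - k \<theta>' s\<bar> \<le> L * dist \<theta> \<theta>'"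
    using covariance_model_lipschitz[OF M conv] by blast
  have psf: "positive_spectral_family \<Theta> k khat" using M by (simp add: covariance_model_def)
  have cont: "isCont (k \<theta>) s" if "\<theta> \<in> \<Theta>" for \<theta> s
    using cosine_transform_continuous[OF positive_spectral_familyD(1)[OF psf that]]
    unfolding continuous_on_eq_continuous_at[OF open_UNIV] by blast
  show ?thesis
    unfolding continuous_on_sequentially
  proof (intro allI ballI impI)
    fix x a assume a: "a \<in> \<Theta> \<times> (UNIV :: (real ^ 'd) set)" and x: "(\<forall>n. x n \<in> \<Theta> \<times> UNIV) \<and> x \<longlonglongrightarrow> a"
    have f: "(\<lambda>n. fst (x n)) \<longlonglongrightarrow> fst a" and s: "(\<lambda>n. snd (x n)) \<longlonglongrightarrow> snd a"
      using tendsto_fst[OF conjunct2[OF x]] tendsto_snd[OF conjunct2[OF x]] .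
    have k: "(\<lambda>n. k (fst a) (snd (x n))) \<longlonglongrightarrow> k (fst a) (snd a)"
      by (rule isCont_tendsto_compose[OF _ s]) (use cont a in \<open>auto simp: mem_Times_iff\<close>)
    have "(\<lambda>n. L * dist (fst (x n)) (fst a)) \<longlonglongrightarrow> L * 0"
      by (rule tendsto_mult_left[OF iffD1[OF tendsto_dist_iff f]])
    then have lim: "(\<lambda>n. L * dist (fst (x n)) (fst a)) \<longlonglongrightarrow> 0" by simp
    have "(\<lambda>n. k (fst (x n)) (snd (x n)) - k (fst a) (snd (x n))) \<longlonglongrightarrow> 0"
    proof (rule Lim_null_comparison[OF always_eventually lim], rule allI)
      fix n
      have "fst (x n) \<in> \<Theta>" "fst a \<in> \<Theta>" using x a by (auto simp: mem_Times_iff)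
      then show "norm (k (fst (x n)) (snd (x n)) - k (fst a) (snd (x n))) \<le> L * dist (fst (x n)) (fst a)"
        using L(2) by simp
    qed
    from tendsto_add[OF this k] show "((\<lambda>(\<theta>, s). k \<theta> s) \<circ> x) \<longlonglongrightarrow> (\<lambda>(\<theta>, s). k \<theta> s) a"
      by (simp add: o_def case_prod_beta)
  qed
qed

text \<open>
  The variance \<open>k \<theta> 0\<close> attains its infimum on the compact parameter set, and at the minimizer
  it is positive by the lower bound for a single site.
\<close>

lemma covariance_model_variance_bound:
  fixes k :: "real ^ 'p \<Rightarrow> real ^ 'd \<Rightarrow> real"
  assumes M: "covariance_model \<Theta> k dk khat" and conv: "convex \<Theta>" and comp: "compact \<Theta>" and ne: "\<theta>0 \<in> \<Theta>"
    and v: "integer_sites (v :: nat \<Rightarrow> real ^ 'd)"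
  obtains \<kappa> where "0 < \<kappa>" "\<And>\<theta>. \<theta> \<in> \<Theta> \<Longrightarrow> \<kappa> \<le> k \<theta> 0"
proof -
  have "continuous_on \<Theta> ((\<lambda>(\<theta>, s). k \<theta> s) \<circ> (\<lambda>\<theta>. (\<theta>, 0)))"
    by (intro continuous_on_compose continuous_intros continuous_on_subset[OF covariance_model_continuous[OF M conv]]) auto
  then have "continuous_on \<Theta> (\<lambda>\<theta>. k \<theta> 0)" by (simp add: o_def)
  then obtain \<theta>1 where \<theta>1: "\<theta>1 \<in> \<Theta>" "\<And>\<theta>. \<theta> \<in> \<Theta> \<Longrightarrow> k \<theta>1 0 \<le> k \<theta> 0"
    using continuous_attains_inf[OF comp] ne by blast
  have "positive_spectral_family \<Theta> k khat" using M by (simp add: covariance_model_def)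
  note S = positive_spectral_familyD[OF this \<theta>1(1)]
  obtain \<mu> where \<mu>: "0 < \<mu>" "\<And>n s y. near_sites 0 v s \<Longrightarrow>
     \<mu> * sq_norm n y \<le> quadratic_form n (\<lambda>i j. k \<theta>1 (s (Suc i) - s (Suc j))) y"
    using spectral_lower_bound[OF v _ _ S, of 0] by auto
  have "\<mu> \<le> k \<theta>1 0"
    using \<mu>(2)[of v 1 "\<lambda>_. 1"] by (simp add: near_sites_def sq_norm_def quadratic_form_def)
  then show thesis using that[of "k \<theta>1 0"] \<mu>(1) \<theta>1 by auto
qed

text \<open>
  The taper supplies a bound that does not involve \<open>\<theta>\<close>; the Schur product with \<open>k \<theta>\<close> multiplies it by
  the variance \<open>k \<theta> 0\<close>.
\<close>

lemma tapered_coercive: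
  fixes k :: "real ^ 'p \<Rightarrow> real ^ 'd \<Rightarrow> real"
  assumes M: "covariance_model \<Theta> k dk khat" and conv: "convex \<Theta>" and comp: "compact \<Theta>" and ne: "\<theta>0 \<in> \<Theta>"
    and v: "integer_sites v" and \<tau>: "0 \<le> \<tau>" "\<tau> < 1 / 2"
    and t: "cosine_transform t that" "continuous_on UNIV that" "\<And>f. 0 < that f" "\<And>s. t (- s) = t s"
  obtains \<mu> where "0 < \<mu>" "\<And>n \<theta> s. \<theta> \<in> \<Theta> \<Longrightarrow> near_sites \<tau> v s \<Longrightarrow> coercive n \<mu> (cov_mat n (\<lambda>x. k \<theta> x * t x) s)"
proof -
  obtain \<kappa> where \<kappa>: "0 < \<kappa>" "\<And>\<theta>. \<theta> \<in> \<Theta> \<Longrightarrow> \<kappa> \<le> k \<theta> 0"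
    using covariance_model_variance_bound[OF M conv comp ne v] by blast
  obtain \<mu> where \<mu>: "0 < \<mu>" "\<And>n s y. near_sites \<tau> v s \<Longrightarrow>
     \<mu> * sq_norm n y \<le> quadratic_form n (\<lambda>i j. t (s (Suc i) - s (Suc j))) y"
    using spectral_lower_bound[OF v \<tau> t(1-3)] by auto
  have "coercive n (\<mu> * \<kappa>) (cov_mat n (\<lambda>x. k \<theta> x * t x) s)" if \<theta>: "\<theta> \<in> \<Theta>" and s: "near_sites \<tau> v s" for n \<theta> s
  proof (rule coercive_cov_mat)
    show "k \<theta> (- s) * t (- s) = k \<theta> s * t s" for s
      using M \<theta> t(4) by (simp add: covariance_model_def covariance_function_def)
    fix y
    have "positive_spectral_family \<Theta> k khat" using M by (simp add: covariance_model_def)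
    note S = positive_spectral_familyD[OF this \<theta>]
    have "\<mu> * \<kappa> * sq_norm n y \<le> \<mu> * k \<theta> 0 * sq_norm n y"
      using \<mu>(1) \<kappa>(2)[OF \<theta>] sq_norm_nonneg by (intro mult_right_mono mult_left_mono) auto
    also have "\<dots> \<le> quadratic_form n (\<lambda>i j. t (s (Suc i) - s (Suc j)) * k \<theta> (s (Suc i) - s (Suc j))) y"
      by (rule schur_product_lower_bound[OF S(1) less_imp_le[OF S(3)] \<mu>(2)[OF s], where s = "\<lambda>i. s (Suc i)"])
    finally show "\<mu> * \<kappa> * sq_norm n y \<le> quadratic_form n (\<lambda>i j. k \<theta> (s (Suc i) - s (Suc j)) * t (s (Suc i) - s (Suc j))) y"
      by (simp add: mult.commute)
  qed
  then show thesis using that[of "\<mu> * \<kappa>"] \<mu>(1) \<kappa>(1) by simp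
qed

text \<open>
  In each row the entries are small except for the boundedly many that belong to neighbours within a
  fixed radius.
\<close>

lemma sum_squares_decay:
  fixes c :: "real ^ 'd \<Rightarrow> real"
  assumes v: "integer_sites v" and \<tau>: "\<tau> < 1 / 2"
    and A: "\<And>s. \<bar>c s\<bar> \<le> A" and decay: "\<And>s. 1 \<le> norm s \<Longrightarrow> \<bar>c s\<bar> \<le> A / norm s" and \<epsilon>: "0 < \<epsilon>"
  obtains n0 where "\<And>n s. n0 \<le> n \<Longrightarrow> near_sites \<tau> v s \<Longrightarrow>
      (\<Sum>i<n. \<Sum>j<n. (c (s (Suc i) - s (Suc j)))\<^sup>2) \<le> \<epsilon> * (real n)\<^sup>2"
proof -
  have A0: "0 \<le> A" using A[of 0] by linarith
  \<comment> \<open>beyond this radius the squared covariance is at most \<open>\<epsilon> / 2\<close>\<close>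
  define \<rho> where "\<rho> = max 1 (A / sqrt (\<epsilon> / 2))"
  obtain W where W: "\<And>s n i. near_sites \<tau> v s \<Longrightarrow> card {j. j < n \<and> norm (s (Suc i) - s (Suc j)) \<le> \<rho>} \<le> W"
    using neighbour_count[OF v \<tau>, of \<rho>] by auto
  have far: "(c x)\<^sup>2 \<le> \<epsilon> / 2" if "\<rho> < norm x" for x
  proof -
    have x: "1 \<le> norm x" "A / sqrt (\<epsilon> / 2) \<le> norm x" using that by (auto simp: \<rho>_def)
    have "A \<le> norm x * sqrt (\<epsilon> / 2)" using x(2) \<epsilon> by (simp add: pos_divide_le_eq)
    then have "A / norm x \<le> sqrt (\<epsilon> / 2)" using x(1) by (subst pos_divide_le_eq) (auto simp: mult.commute)
    then have "\<bar>c x\<bar> \<le> sqrt (\<epsilon> / 2)" using decay[OF x(1)] by linarith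
    then have "\<bar>c x\<bar>\<^sup>2 \<le> (sqrt (\<epsilon> / 2))\<^sup>2" by (intro power_mono) auto
    then show ?thesis using \<epsilon> by simp
  qed
  \<comment> \<open>from here on the neighbours contribute at most \<open>\<epsilon> n / 2\<close> to each row\<close>
  define n0 where "n0 = nat \<lceil>2 * real W * A\<^sup>2 / \<epsilon>\<rceil>"
  have "(\<Sum>i<n. \<Sum>j<n. (c (s (Suc i) - s (Suc j)))\<^sup>2) \<le> \<epsilon> * (real n)\<^sup>2" if n: "n0 \<le> n" and s: "near_sites \<tau> v s" for n s
  proof -
    have n': "2 * real W * A\<^sup>2 / \<epsilon> \<le> real n" using n unfolding n0_def by linarith
    have row: "(\<Sum>j<n. (c (s (Suc i) - s (Suc j)))\<^sup>2) \<le> \<epsilon> * real n" for i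
    proof -
      let ?N = "{j. j < n \<and> norm (s (Suc i) - s (Suc j)) \<le> \<rho>}"
      have "(\<Sum>j<n. (c (s (Suc i) - s (Suc j)))\<^sup>2) \<le> (\<Sum>j<n. (if j \<in> ?N then A\<^sup>2 else 0) + \<epsilon> / 2)"
      proof (rule sum_mono)
        fix j assume "j \<in> {..<n}"
        have "(c (s (Suc i) - s (Suc j)))\<^sup>2 \<le> A\<^sup>2"
          using power_mono[OF A[of "s (Suc i) - s (Suc j)"], of 2] by simp
        then show "(c (s (Suc i) - s (Suc j)))\<^sup>2 \<le> (if j \<in> ?N then A\<^sup>2 else 0) + \<epsilon> / 2"
          using far[of "s (Suc i) - s (Suc j)"] \<open>j \<in> {..<n}\<close> \<epsilon> by (auto simp: not_le)
      qed
      also have "\<dots> = real (card ?N) * A\<^sup>2 + real n * (\<epsilon> / 2)"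
        by (simp add: sum.distrib sum.If_cases Int_def lessThan_def)
      also have "\<dots> \<le> real W * A\<^sup>2 + real n * (\<epsilon> / 2)"
        using W[OF s] by (intro add_right_mono mult_right_mono) auto
      also have "\<dots> \<le> \<epsilon> * real n"
        using n' \<epsilon> by (simp add: pos_divide_le_eq mult_ac)
      finally show ?thesis .
    qed
    have "(\<Sum>i<n. \<Sum>j<n. (c (s (Suc i) - s (Suc j)))\<^sup>2) \<le> (\<Sum>i<n. \<epsilon> * real n)"
      by (rule sum_mono) (rule row)
    then show ?thesis by (simp add: power2_eq_square mult_ac)
  qed
  then show thesis using that by blast
qed

section \<open>Fourth moments of Gaussian fields\<close>

text \<open>
  A Gaussian law of mean \<open>0\<close> is either a centred normal law or the point mass at \<open>0\<close>.
\<close>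

lemma (in prob_space) centred_gaussian_moments:
  assumes Y: "gaussian_rv M Y" and mean: "expectation Y = 0"
  shows "integrable M Y" "integrable M (\<lambda>\<omega>. (Y \<omega>)\<^sup>2)" "integrable M (\<lambda>\<omega>. (Y \<omega>) ^ 4)"
    "expectation (\<lambda>\<omega>. (Y \<omega>) ^ 4) = 3 * (expectation (\<lambda>\<omega>. (Y \<omega>)\<^sup>2))\<^sup>2"
proof -
  have m [measurable]: "Y \<in> borel_measurable M" using Y by (simp add: gaussian_rv_def)
  have "integrable M Y \<and> integrable M (\<lambda>\<omega>. (Y \<omega>)\<^sup>2) \<and> integrable M (\<lambda>\<omega>. (Y \<omega>) ^ 4) \<and>
    expectation (\<lambda>\<omega>. (Y \<omega>) ^ 4) = 3 * (expectation (\<lambda>\<omega>. (Y \<omega>)\<^sup>2))\<^sup>2"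
  proof (cases "\<exists>\<mu>. AE \<omega> in M. Y \<omega> = \<mu>")
    case True
    then obtain \<mu> where \<mu>: "AE \<omega> in M. Y \<omega> = \<mu>" by blast
    have "expectation Y = expectation (\<lambda>_. \<mu>)" by (rule integral_cong_AE) (use \<mu> in auto)
    then have "\<mu> = 0" using mean by (simp add: prob_space)
    then have z: "AE \<omega> in M. Y \<omega> = 0" using \<mu> by simp
    have p: "integrable M (\<lambda>\<omega>. (Y \<omega>) ^ p) \<and> expectation (\<lambda>\<omega>. (Y \<omega>) ^ p) = 0" if "0 < p" for p
    proof -
      have ae: "AE \<omega> in M. (Y \<omega>) ^ p = 0" using z by eventually_elim (use that in simp)
      have "integrable M (\<lambda>\<omega>. (Y \<omega>) ^ p) = integrable M (\<lambda>_. 0 :: real)"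
        by (rule integrable_cong_AE) (use ae in auto)
      moreover have "expectation (\<lambda>\<omega>. (Y \<omega>) ^ p) = expectation (\<lambda>_. 0)"
        by (rule integral_cong_AE) (use ae in auto)
      ultimately show ?thesis by simp
    qed
    show ?thesis using p[of 1] p[of 2] p[of 4] by simp
  next
    case False
    then obtain \<mu> \<sigma> where \<sigma>: "0 < \<sigma>" and D: "distributed M lborel Y (\<lambda>x. ennreal (normal_density \<mu> \<sigma> x))"
      using Y by (auto simp: gaussian_rv_def)
    have "expectation Y = \<mu>"
      using distributed_integral[OF D, of "\<lambda>x. x"] integral_normal_moment_nz_1[OF \<sigma>, of \<mu>] by simp
    then have \<mu>: "\<mu> = 0" using mean by simp
    have mom: "integrable M (\<lambda>\<omega>. (Y \<omega>) ^ (2 * k)) \<and> expectation (\<lambda>\<omega>. (Y \<omega>) ^ (2 * k)) = fact (2 * k) / ((2 / \<sigma>\<^sup>2) ^ k * fact k)" for k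
      using distributed_integral[OF D, of "\<lambda>x. x ^ (2 * k)"] distributed_integrable[OF D, of "\<lambda>x. x ^ (2 * k)"]
        normal_moment_even[OF \<sigma>, of \<mu> k] unfolding \<mu> by (simp add: has_bochner_integral_iff)
    have 1: "integrable M Y"
      using distributed_integrable[OF D, of "\<lambda>x. x"] integrable_normal_moment_nz_1[OF \<sigma>, of \<mu>] by simp
    have 2: "integrable M (\<lambda>\<omega>. (Y \<omega>)\<^sup>2)" "expectation (\<lambda>\<omega>. (Y \<omega>)\<^sup>2) = \<sigma>\<^sup>2"
      using mom[of 1] by simp_all
    have 4: "integrable M (\<lambda>\<omega>. (Y \<omega>) ^ 4)" "expectation (\<lambda>\<omega>. (Y \<omega>) ^ 4) = 3 * (\<sigma>\<^sup>2)\<^sup>2"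
      using mom[of 2] by (simp_all add: power_divide fact_numeral)
    show ?thesis using 1 2 4 by simp
  qed
  then show "integrable M Y" "integrable M (\<lambda>\<omega>. (Y \<omega>)\<^sup>2)" "integrable M (\<lambda>\<omega>. (Y \<omega>) ^ 4)"
    "expectation (\<lambda>\<omega>. (Y \<omega>) ^ 4) = 3 * (expectation (\<lambda>\<omega>. (Y \<omega>)\<^sup>2))\<^sup>2" by auto
qed

lemma polarization_4:
  fixes a b c d :: real
  shows "192 * (a * b * c * d) =
      (a + b + c + d) ^ 4 - (a + b + c - d) ^ 4 - (a + b - c + d) ^ 4 + (a + b - c - d) ^ 4
    - (a - b + c + d) ^ 4 + (a - b + c - d) ^ 4 + (a - b - c + d) ^ 4 - (a - b - c - d) ^ 4"
proof -
  have quartic: "(x + d) ^ 4 - (x - d) ^ 4 = 8 * d * x ^ 3 + 8 * d ^ 3 * x" for x :: real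
    by (simp add: power4_eq_xxxx power3_eq_cube algebra_simps)
  have "192 * (a * b * c * d) = 8 * d * ((a + b + c) ^ 3 - (a + b - c) ^ 3 - (a - b + c) ^ 3 + (a - b - c) ^ 3)"
    by (simp add: power3_eq_cube algebra_simps)
  then show ?thesis
    using quartic[of "a + b + c"] quartic[of "a + b - c"] quartic[of "a - b + c"] quartic[of "a - b - c"]
    by (simp add: algebra_simps)
qed

lemma double_sum_product:
  fixes f g :: "nat \<Rightarrow> nat \<Rightarrow> real"
  shows "(\<Sum>i<n. \<Sum>j<n. f i j) * (\<Sum>k<n. \<Sum>l<n. g k l) = (\<Sum>i<n. \<Sum>j<n. \<Sum>k<n. \<Sum>l<n. f i j * g k l)"
proof -
  have left: "(\<Sum>i<n. \<Sum>j<n. f i j) * G = (\<Sum>i<n. \<Sum>j<n. f i j * G)" for G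
    by (simp only: sum_distrib_right)
  show ?thesis unfolding left by (simp only: sum_distrib_left)
qed

text \<open>
  Both sides are obtained by polarization: \<open>a b c d\<close> is a signed sum of fourth powers of the
  combinations \<open>a \<plusminus> b \<plusminus> c \<plusminus> d\<close>, whose fourth moments are quadratic in the second moments, and the
  signs remove all but the three pairings.
\<close>

lemma (in prob_space) isserlis_of_fourth_moments:
  fixes a b c d :: "'a \<Rightarrow> real"
  assumes int: "\<And>x y. x \<in> {a, b, c, d} \<Longrightarrow> y \<in> {a, b, c, d} \<Longrightarrow> integrable M (\<lambda>\<omega>. x \<omega> * y \<omega>)"
    and int4: "\<And>p q r. integrable M (\<lambda>\<omega>. (a \<omega> + p * b \<omega> + q * c \<omega> + r * d \<omega>) ^ 4)"
    and fourth: "\<And>p q r. expectation (\<lambda>\<omega>. (a \<omega> + p * b \<omega> + q * c \<omega> + r * d \<omega>) ^ 4)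
       = 3 * (expectation (\<lambda>\<omega>. (a \<omega> + p * b \<omega> + q * c \<omega> + r * d \<omega>)\<^sup>2))\<^sup>2"
  shows "integrable M (\<lambda>\<omega>. a \<omega> * b \<omega> * c \<omega> * d \<omega>)"
    and "expectation (\<lambda>\<omega>. a \<omega> * b \<omega> * c \<omega> * d \<omega>) =
       expectation (\<lambda>\<omega>. a \<omega> * b \<omega>) * expectation (\<lambda>\<omega>. c \<omega> * d \<omega>) +
       expectation (\<lambda>\<omega>. a \<omega> * c \<omega>) * expectation (\<lambda>\<omega>. b \<omega> * d \<omega>) +
       expectation (\<lambda>\<omega>. a \<omega> * d \<omega>) * expectation (\<lambda>\<omega>. b \<omega> * c \<omega>)"
proof -
  let ?E = "\<lambda>x y. expectation (\<lambda>\<omega>. x \<omega> * y \<omega>)"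
  let ?Y = "\<lambda>p q r \<omega>. (a \<omega> + p * b \<omega> + q * c \<omega> + r * d \<omega>) ^ 4"
  have second: "expectation (\<lambda>\<omega>. (a \<omega> + p * b \<omega> + q * c \<omega> + r * d \<omega>)\<^sup>2) =
     ?E a a + p\<^sup>2 * ?E b b + q\<^sup>2 * ?E c c + r\<^sup>2 * ?E d d + 2 * p * ?E a b + 2 * q * ?E a c + 2 * r * ?E a d
     + 2 * p * q * ?E b c + 2 * p * r * ?E b d + 2 * q * r * ?E c d" for p q r
  proof -
    have "(a \<omega> + p * b \<omega> + q * c \<omega> + r * d \<omega>)\<^sup>2 =
       a \<omega> * a \<omega> + p\<^sup>2 * (b \<omega> * b \<omega>) + q\<^sup>2 * (c \<omega> * c \<omega>) + r\<^sup>2 * (d \<omega> * d \<omega>) + 2 * p * (a \<omega> * b \<omega>) + 2 * q * (a \<omega> * c \<omega>)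
       + 2 * r * (a \<omega> * d \<omega>) + 2 * p * q * (b \<omega> * c \<omega>) + 2 * p * r * (b \<omega> * d \<omega>) + 2 * q * r * (c \<omega> * d \<omega>)" for \<omega>
      by (simp add: power2_eq_square algebra_simps)
    then show ?thesis using int by simp
  qed
  have pol: "a \<omega> * b \<omega> * c \<omega> * d \<omega> = (?Y 1 1 1 \<omega> - ?Y 1 1 (-1) \<omega> - ?Y 1 (-1) 1 \<omega> + ?Y 1 (-1) (-1) \<omega>
      - ?Y (-1) 1 1 \<omega> + ?Y (-1) 1 (-1) \<omega> + ?Y (-1) (-1) 1 \<omega> - ?Y (-1) (-1) (-1) \<omega>) / 192" for \<omega>
    using polarization_4[of "a \<omega>" "b \<omega>" "c \<omega>" "d \<omega>"] by simp
  show "integrable M (\<lambda>\<omega>. a \<omega> * b \<omega> * c \<omega> * d \<omega>)"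
    unfolding pol by (intro integrable_divide Bochner_Integration.integrable_add Bochner_Integration.integrable_diff int4)
  have "expectation (\<lambda>\<omega>. a \<omega> * b \<omega> * c \<omega> * d \<omega>) = (expectation (?Y 1 1 1) - expectation (?Y 1 1 (-1)) - expectation (?Y 1 (-1) 1)
      + expectation (?Y 1 (-1) (-1)) - expectation (?Y (-1) 1 1) + expectation (?Y (-1) 1 (-1)) + expectation (?Y (-1) (-1) 1)
      - expectation (?Y (-1) (-1) (-1))) / 192"
    unfolding pol by (simp only: integral_divide_zero Bochner_Integration.integral_add Bochner_Integration.integral_diff
        Bochner_Integration.integrable_add Bochner_Integration.integrable_diff int4)
  also have "\<dots> = ?E a b * ?E c d + ?E a c * ?E b d + ?E a d * ?E b c"
    unfolding fourth second by (simp add: power2_eq_square algebra_simps)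
  finally show "expectation (\<lambda>\<omega>. a \<omega> * b \<omega> * c \<omega> * d \<omega>) = ?E a b * ?E c d + ?E a c * ?E b d + ?E a d * ?E b c" .
qed

text \<open>
  The sites need not be distinct: coefficients that belong to the same site are collected.
\<close>

lemma (in prob_space) gaussian_field_linear:
  assumes Z: "centred_gaussian_field M Z c"
  shows "gaussian_rv M (\<lambda>\<omega>. \<Sum>i\<in>I. x i * Z (s i) \<omega>)" "expectation (\<lambda>\<omega>. \<Sum>i\<in>I. x i * Z (s i) \<omega>) = 0"
proof -
  have G: "gaussian_rv M (\<lambda>\<omega>. \<Sum>s\<in>F. a s * Z s \<omega>)" if "finite F" for F a
    using Z that by (simp add: centred_gaussian_field_def)
  have E: "expectation (Z u) = 0" for u using Z by (simp add: centred_gaussian_field_def)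
  have iZ: "integrable M (Z u)" for u
    using centred_gaussian_moments(1)[of "Z u"] G[of "{u}" "\<lambda>_. 1"] E[of u] by simp
  show "gaussian_rv M (\<lambda>\<omega>. \<Sum>i\<in>I. x i * Z (s i) \<omega>)"
  proof (cases "finite I")
    case True
    have "(\<Sum>i\<in>I. x i * Z (s i) \<omega>) = (\<Sum>u\<in>s ` I. (\<Sum>i | i \<in> I \<and> s i = u. x i) * Z u \<omega>)" for \<omega>
      unfolding sum_distrib_right by (subst sum.image_gen[OF True, of _ s]) (auto intro!: sum.cong)
    then show ?thesis using G[of "s ` I"] True by simp
  next
    case False
    then show ?thesis using G[of "{}"] by simp
  qed
  show "expectation (\<lambda>\<omega>. \<Sum>i\<in>I. x i * Z (s i) \<omega>) = 0"
    by (subst Bochner_Integration.integral_sum) (auto simp: iZ E)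
qed

lemma (in prob_space) gaussian_field_products:
  assumes Z: "centred_gaussian_field M Z c"
  shows "Z u \<in> borel_measurable M" "integrable M (\<lambda>\<omega>. Z u \<omega> * Z w \<omega>)" "expectation (\<lambda>\<omega>. Z u \<omega> * Z w \<omega>) = c (u - w)"
proof -
  have G: "gaussian_rv M (\<lambda>\<omega>. \<Sum>s\<in>F. a s * Z s \<omega>)" if "finite F" for F a
    using Z that by (simp add: centred_gaussian_field_def)
  have E: "expectation (Z u) = 0" for u using Z by (simp add: centred_gaussian_field_def)
  have g: "gaussian_rv M (Z u)" for u using G[of "{u}" "\<lambda>_. 1"] by simp
  show m: "Z u \<in> borel_measurable M" for u using g[of u] by (simp add: gaussian_rv_def)
  note [measurable] = m
  have sq: "integrable M (\<lambda>\<omega>. (Z u \<omega>)\<^sup>2)" for u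
    by (rule centred_gaussian_moments(2)[OF g E])
  show "integrable M (\<lambda>\<omega>. Z u \<omega> * Z w \<omega>)"
  proof (rule Bochner_Integration.integrable_bound[OF Bochner_Integration.integrable_add[OF sq[of u] sq[of w]]])
    have "\<bar>x * y\<bar> \<le> x\<^sup>2 + y\<^sup>2" for x y :: real
    proof -
      have "2 * (\<bar>x\<bar> * \<bar>y\<bar>) \<le> x\<^sup>2 + y\<^sup>2" using sum_squares_bound[of "\<bar>x\<bar>" "\<bar>y\<bar>"] by simp
      moreover have "0 \<le> \<bar>x\<bar> * \<bar>y\<bar>" by simp
      ultimately show ?thesis unfolding abs_mult by linarith
    qed
    then show "AE \<omega> in M. norm (Z u \<omega> * Z w \<omega>) \<le> norm ((Z u \<omega>)\<^sup>2 + (Z w \<omega>)\<^sup>2)"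
      by (intro AE_I2) (simp add: abs_mult)
  qed measurable
  show "expectation (\<lambda>\<omega>. Z u \<omega> * Z w \<omega>) = c (u - w)"
    using Z by (simp add: centred_gaussian_field_def)
qed

lemma (in prob_space) gaussian_field_isserlis:
  assumes Z: "centred_gaussian_field M Z c"
  shows "integrable M (\<lambda>\<omega>. Z s1 \<omega> * Z s2 \<omega> * Z s3 \<omega> * Z s4 \<omega>)"
    and "expectation (\<lambda>\<omega>. Z s1 \<omega> * Z s2 \<omega> * Z s3 \<omega> * Z s4 \<omega>) =
      c (s1 - s2) * c (s3 - s4) + c (s1 - s3) * c (s2 - s4) + c (s1 - s4) * c (s2 - s3)"
proof -
  have lin: "Z s1 \<omega> + p * Z s2 \<omega> + q * Z s3 \<omega> + r * Z s4 \<omega> =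
      (\<Sum>i<4. ([1, p, q, r] ! i) * Z ([s1, s2, s3, s4] ! i) \<omega>)" for p q r \<omega>
    by (simp add: numeral_eq_Suc)
  note P = gaussian_field_products[OF Z]
  note L = gaussian_field_linear[OF Z, where I = "{..<4}" and s = "\<lambda>i. [s1, s2, s3, s4] ! i"]
  note m = centred_gaussian_moments[OF L[where x = "\<lambda>i. [1, p, q, r] ! i" for p q r], folded lin]
  show "integrable M (\<lambda>\<omega>. Z s1 \<omega> * Z s2 \<omega> * Z s3 \<omega> * Z s4 \<omega>)"
    by (rule isserlis_of_fourth_moments(1)) (use P m in auto)
  show "expectation (\<lambda>\<omega>. Z s1 \<omega> * Z s2 \<omega> * Z s3 \<omega> * Z s4 \<omega>) =
      c (s1 - s2) * c (s3 - s4) + c (s1 - s3) * c (s2 - s4) + c (s1 - s4) * c (s2 - s3)"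
    unfolding P(3)[symmetric] by (rule isserlis_of_fourth_moments(2)) (use P m in auto)
qed

text \<open>
  By Isserlis' formula the variance is \<open>2 tr (B K B K)\<close>. With \<open>H = B K\<close> the trace is
  \<open>\<Sum> H i k H k i\<close>, at most the sum of the squares of the entries of \<open>H\<close>, and the columns of \<open>H\<close>
  are the images of those of \<open>K\<close> under \<open>B\<close>.
\<close>

lemma (in prob_space) quadratic_form_variance:
  fixes B :: "nat \<Rightarrow> nat \<Rightarrow> real" and s :: "nat \<Rightarrow> real ^ 'd"
  assumes Z: "centred_gaussian_field M Z c"
    and B: "\<And>i j. i < n \<Longrightarrow> j < n \<Longrightarrow> B i j = B j i"
    and norm: "\<And>x. sq_norm n (\<lambda>i. \<Sum>j<n. B i j * x j) \<le> b * sq_norm n x"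
    and even: "\<And>x. c (- x) = c x"
  shows "integrable M (\<lambda>\<omega>. (quadratic_form n B (\<lambda>i. Z (s i) \<omega>) - (\<Sum>i<n. \<Sum>j<n. B i j * c (s i - s j)))\<^sup>2)"
    and "expectation (\<lambda>\<omega>. (quadratic_form n B (\<lambda>i. Z (s i) \<omega>) - (\<Sum>i<n. \<Sum>j<n. B i j * c (s i - s j)))\<^sup>2)
      \<le> 2 * b * (\<Sum>i<n. \<Sum>j<n. (c (s i - s j))\<^sup>2)"
proof -
  define K where "K = (\<lambda>i j. c (s i - s j))"
  have K: "K i j = K j i" for i j using even[of "s i - s j"] by (simp add: K_def)
  define m where "m = (\<Sum>i<n. \<Sum>j<n. B i j * K i j)"
  let ?z = "\<lambda>i \<omega>. Z (s i) \<omega>"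
  let ?Q = "\<lambda>\<omega>. quadratic_form n B (\<lambda>i. Z (s i) \<omega>)"
  note P = gaussian_field_products[OF Z] and I = gaussian_field_isserlis[OF Z]
  have Q: "?Q \<omega> = (\<Sum>i<n. \<Sum>j<n. B i j * (?z i \<omega> * ?z j \<omega>))" for \<omega>
    by (simp add: quadratic_form_def mult.assoc)
  have iQ: "integrable M ?Q"
    unfolding Q by (intro Bochner_Integration.integrable_sum integrable_mult_right P)
  have EQ: "expectation ?Q = m"
    unfolding Q m_def K_def
    by (subst Bochner_Integration.integral_sum, intro Bochner_Integration.integrable_sum integrable_mult_right P,
        subst Bochner_Integration.integral_sum, intro integrable_mult_right P) (simp only: integral_mult_right_zero P(3))
  have Q2: "(?Q \<omega>)\<^sup>2 = (\<Sum>i<n. \<Sum>j<n. \<Sum>k<n. \<Sum>l<n. B i j * B k l * (?z i \<omega> * ?z j \<omega> * ?z k \<omega> * ?z l \<omega>))" for \<omega>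
    unfolding power2_eq_square Q double_sum_product by (simp only: mult_ac)
  have iQ2: "integrable M (\<lambda>\<omega>. (?Q \<omega>)\<^sup>2)"
    unfolding Q2 by (intro Bochner_Integration.integrable_sum integrable_mult_right I)
  have EQ2: "expectation (\<lambda>\<omega>. (?Q \<omega>)\<^sup>2) = (\<Sum>i<n. \<Sum>j<n. \<Sum>k<n. \<Sum>l<n. B i j * B k l * (K i j * K k l + K i k * K j l + K i l * K j k))"
  proof -
    have 4: "expectation (\<lambda>\<omega>. B i j * B k l * (?z i \<omega> * ?z j \<omega> * ?z k \<omega> * ?z l \<omega>)) = B i j * B k l * (K i j * K k l + K i k * K j l + K i l * K j k)" for i j k l
      by (simp only: integral_mult_right_zero I(2) K_def)
    show ?thesis
      unfolding Q2
      by (subst Bochner_Integration.integral_sum, (intro Bochner_Integration.integrable_sum integrable_mult_right I)[1], intro sum.cong refl)+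
         (rule 4)
  qed
  have S0: "(\<Sum>i<n. \<Sum>j<n. \<Sum>k<n. \<Sum>l<n. B i j * B k l * (K i j * K k l)) = m\<^sup>2"
    unfolding m_def power2_eq_square double_sum_product by (simp only: mult_ac)
  define S1 where "S1 = (\<Sum>i<n. \<Sum>j<n. \<Sum>k<n. \<Sum>l<n. B i j * B k l * (K i l * K j k))"
  have S2: "(\<Sum>i<n. \<Sum>j<n. \<Sum>k<n. \<Sum>l<n. B i j * B k l * (K i k * K j l)) = S1"
  proof -
    have "(\<Sum>k<n. \<Sum>l<n. B i j * B k l * (K i k * K j l)) = (\<Sum>k<n. \<Sum>l<n. B i j * B k l * (K i l * K j k))" for i j
      by (subst sum.swap) (intro sum.cong refl, simp add: B)
    then show ?thesis unfolding S1_def by simp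
  qed
  \<comment> \<open>the product matrix \<open>B K\<close>\<close>
  define H where "H = (\<lambda>i k. \<Sum>j<n. B i j * K j k)"
  have "S1 = (\<Sum>i<n. \<Sum>k<n. H i k * H k i)"
  proof -
    have "(\<Sum>j<n. \<Sum>k<n. \<Sum>l<n. B i j * B k l * (K i l * K j k)) = (\<Sum>k<n. H i k * H k i)" for i
    proof -
      have "(\<Sum>j<n. \<Sum>k<n. \<Sum>l<n. B i j * B k l * (K i l * K j k)) = (\<Sum>k<n. \<Sum>j<n. \<Sum>l<n. B i j * K j k * (B k l * K l i))"
        by (subst sum.swap) (simp add: K[of i] mult_ac)
      then show ?thesis by (simp add: H_def sum_product)
    qed
    then show ?thesis by (simp add: S1_def)
  qed
  also have "\<dots> \<le> (\<Sum>i<n. \<Sum>k<n. ((H i k)\<^sup>2 + (H k i)\<^sup>2) / 2)"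
  proof (intro sum_mono)
    fix i k show "H i k * H k i \<le> ((H i k)\<^sup>2 + (H k i)\<^sup>2) / 2"
      using sum_squares_bound[of "H i k" "H k i"] by simp
  qed
  also have "\<dots> = (\<Sum>k<n. \<Sum>i<n. (H i k)\<^sup>2)"
  proof -
    have "(\<Sum>i<n. \<Sum>k<n. (H i k)\<^sup>2) = (\<Sum>k<n. \<Sum>i<n. (H i k)\<^sup>2)" by (rule sum.swap)
    then show ?thesis by (simp add: sum.distrib add_divide_distrib sum_divide_distrib[symmetric])
  qed
  also have "\<dots> \<le> (\<Sum>k<n. b * (\<Sum>j<n. (K j k)\<^sup>2))"
    using norm[of "\<lambda>j. K j k" for k] by (intro sum_mono) (simp add: sq_norm_def H_def)
  also have "\<dots> = b * (\<Sum>i<n. \<Sum>j<n. (K i j)\<^sup>2)"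
    by (subst sum.swap) (simp add: sum_distrib_left)
  finally have S1: "S1 \<le> b * (\<Sum>i<n. \<Sum>j<n. (K i j)\<^sup>2)" .
  have EQ2': "expectation (\<lambda>\<omega>. (?Q \<omega>)\<^sup>2) = m\<^sup>2 + S1 + S1"
    unfolding EQ2 distrib_left sum.distrib S0 S2 S1_def[symmetric] ..
  have sq: "(?Q \<omega> - m)\<^sup>2 = (?Q \<omega>)\<^sup>2 - 2 * m * ?Q \<omega> + m\<^sup>2" for \<omega>
    by (simp add: power2_diff)
  have "integrable M (\<lambda>\<omega>. (?Q \<omega> - m)\<^sup>2)"
    unfolding sq by (intro Bochner_Integration.integrable_add Bochner_Integration.integrable_diff iQ2 integrable_mult_right iQ) simp
  then show "integrable M (\<lambda>\<omega>. (?Q \<omega> - (\<Sum>i<n. \<Sum>j<n. B i j * c (s i - s j)))\<^sup>2)"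
    by (simp add: m_def K_def)
  have "expectation (\<lambda>\<omega>. (?Q \<omega> - m)\<^sup>2) = expectation (\<lambda>\<omega>. (?Q \<omega>)\<^sup>2) - 2 * m * expectation ?Q + m\<^sup>2"
    unfolding sq using iQ2 iQ by (simp add: prob_space)
  also have "\<dots> = 2 * S1" unfolding EQ EQ2' by (simp add: power2_eq_square)
  also have "\<dots> \<le> 2 * b * (\<Sum>i<n. \<Sum>j<n. (K i j)\<^sup>2)" using S1 by simp
  finally show "expectation (\<lambda>\<omega>. (?Q \<omega> - (\<Sum>i<n. \<Sum>j<n. B i j * c (s i - s j)))\<^sup>2)
      \<le> 2 * b * (\<Sum>i<n. \<Sum>j<n. (c (s i - s j))\<^sup>2)"
    by (simp add: m_def K_def)
qed

text \<open>
  Integrating out the field first, with the sites frozen. Independence of the sites from \<open>G\<close> means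
  that the joint law of the sites and the identity map into \<open>G\<close> is a product measure.
\<close>

lemma nn_integral_independent_bound:
  fixes X :: "nat \<Rightarrow> 'w \<Rightarrow> 'b::topological_space"
  assumes M: "prob_space M" and G: "subalgebra M G" and X: "(\<lambda>\<omega>. \<lambda>i\<in>{1..}. X i \<omega>) \<in> measurable M (\<Pi>\<^sub>M i\<in>{1..}. borel)"
    and indep: "prob_space.indep_set M (sets G)
          (sets (vimage_algebra (space M) (\<lambda>\<omega>. \<lambda>i\<in>{1..}. X i \<omega>) (\<Pi>\<^sub>M i\<in>{1..}. borel)))"
    and F: "F \<in> borel_measurable ((\<Pi>\<^sub>M i\<in>{1..}. borel) \<Otimes>\<^sub>M G)"
    and bd: "\<And>x. (\<integral>\<^sup>+ \<omega>. F (x, \<omega>) \<partial>M) \<le> b"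
  shows "(\<integral>\<^sup>+ \<omega>. F (\<lambda>i\<in>{1..}. X i \<omega>, \<omega>) \<partial>M) \<le> b"
proof -
  interpret prob_space M by fact
  let ?P = "\<Pi>\<^sub>M i\<in>{1..}. borel :: 'b measure" and ?X = "\<lambda>\<omega>. \<lambda>i\<in>{1..}. X i \<omega>"
  let ?G = "restr_to_subalg M G" and ?D = "distr M (\<Pi>\<^sub>M i\<in>{1..}. borel :: 'b measure) (\<lambda>\<omega>. \<lambda>i\<in>{1..}. X i \<omega>)"
  interpret D: prob_space ?D by (rule prob_space_distr[OF X])
  interpret G: prob_space ?G by (rule prob_space_restr_to_subalg[OF G M])
  have idG: "(\<lambda>\<omega>. \<omega>) \<in> measurable M G" by (rule measurable_from_subalg[OF G measurable_ident_sets]) simp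
  have setsG: "sets ?G = sets G" by (rule sets_restr_to_subalg[OF G])
  have spG: "space G = space M" using G by (simp add: subalgebra_def)
  have pairm: "(\<lambda>\<omega>. (?X \<omega>, \<omega>)) \<in> measurable M (?P \<Otimes>\<^sub>M G)"
    by (intro measurable_Pair X idG)
  have joint: "?D \<Otimes>\<^sub>M ?G = distr M (?P \<Otimes>\<^sub>M G) (\<lambda>\<omega>. (?X \<omega>, \<omega>))"
  proof (rule pair_measure_eqI)
    show "sigma_finite_measure ?D" by (rule D.sigma_finite_measure_axioms)
    show "sigma_finite_measure ?G" by (rule G.sigma_finite_measure_axioms)
    show "sets (?D \<Otimes>\<^sub>M ?G) = sets (distr M (?P \<Otimes>\<^sub>M G) (\<lambda>\<omega>. (?X \<omega>, \<omega>)))"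
      unfolding sets_distr by (intro sets_pair_measure_cong) (simp_all add: setsG)
    fix A B assume A: "A \<in> sets ?D" and B: "B \<in> sets ?G"
    have A': "A \<in> sets ?P" and B': "B \<in> sets G" using A B setsG by auto
    let ?V = "?X -` A \<inter> space M"
    have V: "?V \<in> sets (vimage_algebra (space M) ?X ?P)" by (rule in_vimage_algebra[OF A'])
    have Bs: "B \<subseteq> space M" using sets.sets_into_space[OF B'] spG by simp
    have BM: "B \<in> events" using B' G by (auto simp: subalgebra_def)
    have VM: "?V \<in> events" by (rule measurable_sets[OF X A'])
    have "emeasure (distr M (?P \<Otimes>\<^sub>M G) (\<lambda>\<omega>. (?X \<omega>, \<omega>))) (A \<times> B) = emeasure M ((\<lambda>\<omega>. (?X \<omega>, \<omega>)) -` (A \<times> B) \<inter> space M)"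
      using A' B' by (intro emeasure_distr pairm) auto
    also have "(\<lambda>\<omega>. (?X \<omega>, \<omega>)) -` (A \<times> B) \<inter> space M = B \<inter> ?V" using Bs by auto
    also have "emeasure M (B \<inter> ?V) = ennreal (prob B * prob ?V)"
      using indep_setD[OF indep B' V] by (simp add: emeasure_eq_measure)
    also have "\<dots> = emeasure M ?V * emeasure M B"
      by (simp add: emeasure_eq_measure ennreal_mult mult.commute)
    also have "\<dots> = emeasure ?D A * emeasure ?G B"
      using emeasure_distr[OF X A'] emeasure_restr_to_subalg[OF G B'] by simp
    finally show "emeasure ?D A * emeasure ?G B = emeasure (distr M (?P \<Otimes>\<^sub>M G) (\<lambda>\<omega>. (?X \<omega>, \<omega>))) (A \<times> B)" by (rule sym)
  qed
  have F': "F \<in> borel_measurable (?D \<Otimes>\<^sub>M ?G)"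
    using F by (subst measurable_cong_sets[OF sets_pair_measure_cong refl]) (auto simp: setsG)
  have "(\<integral>\<^sup>+ \<omega>. F (?X \<omega>, \<omega>) \<partial>M) = (\<integral>\<^sup>+ p. F p \<partial>distr M (?P \<Otimes>\<^sub>M G) (\<lambda>\<omega>. (?X \<omega>, \<omega>)))"
    by (rule nn_integral_distr[OF pairm, symmetric]) (use F in \<open>simp only: measurable_distr_eq1\<close>)
  also have "\<dots> = (\<integral>\<^sup>+ x. \<integral>\<^sup>+ \<omega>. F (x, \<omega>) \<partial>?G \<partial>?D)"
    unfolding joint[symmetric] by (rule G.nn_integral_fst[OF F', symmetric])
  also have "\<dots> \<le> (\<integral>\<^sup>+ x. b \<partial>?D)"
  proof (rule nn_integral_mono)
    fix x assume "x \<in> space ?D"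
    then have "(\<lambda>\<omega>. F (x, \<omega>)) \<in> borel_measurable G"
      using F by (intro measurable_compose[OF _ F] measurable_Pair) auto
    then show "(\<integral>\<^sup>+ \<omega>. F (x, \<omega>) \<partial>?G) \<le> b"
      using bd[of x] by (simp add: nn_integral_subalgebra2[OF G])
  qed
  also have "\<dots> = b" using D.emeasure_space_1 by simp
  finally show ?thesis .
qed

section \<open>Sampling a Gaussian field at random sites\<close>

lemma det_borel_measurable:
  assumes "\<And>x. F x \<in> carrier_mat n n"
    and "\<And>i j. i < n \<Longrightarrow> j < n \<Longrightarrow> (\<lambda>x. F x $$ (i, j)) \<in> borel_measurable N"
  shows "(\<lambda>x. det (F x) :: real) \<in> borel_measurable N"
proof -
  have dims: "dim_row (F x) = n" "dim_col (F x) = n" for x using assms(1)[of x] by auto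
  have "(\<lambda>x. signof p * (\<Prod>i = 0..<n. F x $$ (i, p i))) \<in> borel_measurable N" if "p permutes {0..<n}" for p
    using that by (intro borel_measurable_times borel_measurable_const borel_measurable_prod assms(2))
      (auto simp: permutes_in_image)
  then show ?thesis unfolding Determinant.det_def dims by (auto intro!: borel_measurable_sum)
qed

text \<open>
  By Cramer's rule the entries of the inverse are quotients of polynomials in the entries.
\<close>

lemma inv_mat_borel_measurable:
  assumes F: "\<And>x. coercive n \<mu> (F x)" and \<mu>: "0 < \<mu>"
    and m: "\<And>i j. i < n \<Longrightarrow> j < n \<Longrightarrow> (\<lambda>x. F x $$ (i, j)) \<in> borel_measurable N"
    and ij: "i < n" "j < n"
  shows "(\<lambda>x. inv_mat (F x) $$ (i, j)) \<in> borel_measurable N"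
proof -
  have C: "F x \<in> carrier_mat n n" for x using F[of x] by (simp add: coercive_def)
  have eq: "inv_mat (F x) $$ (i, j) = cofactor (F x) j i / det (F x)" for x
  proof -
    note I = coercive_inverse[OF F[of x] \<mu>] and A = adj_mat[OF C[of x]]
    have "adj_mat (F x) = (adj_mat (F x) * F x) * inv_mat (F x)"
    proof -
      have "(adj_mat (F x) * F x) * inv_mat (F x) = adj_mat (F x) * (F x * inv_mat (F x))"
        by (rule assoc_mult_mat[OF A(1) C I(1)])
      then show ?thesis using A(1) I(2) by simp
    qed
    also have "\<dots> = det (F x) \<cdot>\<^sub>m inv_mat (F x)"
      unfolding A(3) using I by (simp add: mult_smult_assoc_mat[of _ n n])
    finally have "adj_mat (F x) $$ (i, j) = det (F x) * inv_mat (F x) $$ (i, j)"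
      using I ij by simp
    moreover have "adj_mat (F x) $$ (i, j) = cofactor (F x) j i"
      using C[of x] ij by (simp add: adj_mat_def)
    ultimately show ?thesis using coercive_det(1)[OF F[of x] \<mu>] by (simp add: field_simps)
  qed
  have "(\<lambda>x. det (mat_delete (F x) j i)) \<in> borel_measurable N"
  proof (rule det_borel_measurable[of _ "n - 1"])
    show "mat_delete (F x) j i \<in> carrier_mat (n - 1) (n - 1)" for x
      using mat_delete_carrier[OF C] .
    show "(\<lambda>x. mat_delete (F x) j i $$ (i', j')) \<in> borel_measurable N" if "i' < n - 1" "j' < n - 1" for i' j'
    proof -
      have "mat_delete (F x) j i $$ (i', j') = F x $$ (if i' < j then i' else Suc i', if j' < i then j' else Suc j')" for x
        using that C[of x] by (simp add: mat_delete_def)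
      then show ?thesis using that by (simp only:) (intro m, auto)
    qed
  qed
  moreover have "(\<lambda>x. det (F x)) \<in> borel_measurable N" by (rule det_borel_measurable[OF C m])
  ultimately show ?thesis unfolding eq cofactor_def by measurable
qed

lemma (in prob_space) markov_bound:
  assumes U: "U \<in> borel_measurable M" and b: "(\<integral>\<^sup>+ \<omega>. ennreal (U \<omega>) \<partial>M) \<le> ennreal b" and a: "0 < a" and b0: "0 \<le> b"
  shows "prob {\<omega> \<in> space M. a < U \<omega>} \<le> b / a"
proof -
  note [measurable] = U
  let ?A = "{\<omega> \<in> space M. a < U \<omega>}"
  have "ennreal a * emeasure M ?A = (\<integral>\<^sup>+ \<omega>. ennreal a * indicator ?A \<omega> \<partial>M)"
    by (simp add: nn_integral_cmult_indicator)
  also have "\<dots> \<le> (\<integral>\<^sup>+ \<omega>. ennreal (U \<omega>) \<partial>M)"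
    by (intro nn_integral_mono) (auto simp: indicator_def intro!: ennreal_leI)
  also note b
  finally have "ennreal (a * prob ?A) \<le> ennreal b"
    using a by (simp add: emeasure_eq_measure ennreal_mult)
  then have "a * prob ?A \<le> b" using b0 by simp
  then show ?thesis using a by (simp add: pos_le_divide_eq mult.commute)
qed

text \<open>
  The sites are formed from the truncation of \<open>x\<close> to the unit cube. On the range of the observed
  vectors the truncation is the identity; off that range it keeps the sites near the lattice, so
  that no exceptional arguments need to be excluded from the integrals.
\<close>

definition clip :: "real ^ 'd \<Rightarrow> real ^ 'd" where
  "clip x = (\<chi> j. max (- 1) (min 1 (x $ j)))"

lemma clip_in_unit_cube: "x \<in> unit_cube \<Longrightarrow> clip x = x"
  by (auto simp: clip_def unit_cube_def Finite_Cartesian_Product.vec_eq_iff)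

lemma clip_measurable [measurable]: "clip \<in> borel_measurable borel"
  unfolding clip_def by (intro borel_measurable_continuous_onI continuous_intros)

definition sites :: "real \<Rightarrow> (nat \<Rightarrow> real ^ 'd) \<Rightarrow> (nat \<Rightarrow> real ^ 'd) \<Rightarrow> nat \<Rightarrow> real ^ 'd" where
  "sites \<tau> v x i = v i + \<tau> *\<^sub>R clip (x i)"

lemma near_sites_sites:
  assumes "0 \<le> \<tau>"
  shows "near_sites \<tau> v (sites \<tau> v x)"
proof -
  have "\<bar>clip y $ b\<bar> \<le> 1" for y :: "real ^ 'd" and b by (simp add: clip_def)
  then show ?thesis using assms by (auto simp: near_sites_def sites_def abs_mult intro!: mult_left_le)
qed

lemma sites_measurable:
  assumes "1 \<le> i"
  shows "(\<lambda>x. sites \<tau> v x i) \<in> measurable (\<Pi>\<^sub>M i\<in>{1..}. borel) borel"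
proof -
  have "(\<lambda>x. x i) \<in> measurable (\<Pi>\<^sub>M i\<in>{1..}. borel) (borel :: (real ^ 'd) measure)"
    using assms by (intro measurable_component_singleton) auto
  then show ?thesis unfolding sites_def by measurable
qed

lemma quadratic_form_diff:
  "quadratic_form n (\<lambda>i j. E i j - F i j) x = quadratic_form n E x - quadratic_form n F x"
  by (simp only: quadratic_form_def left_diff_distrib sum_subtractf)

lemma cov_mat_cong:
  assumes "\<And>i. 1 \<le> i \<Longrightarrow> s i = s' i"
  shows "cov_mat n c s = cov_mat n c s'"
  unfolding cov_mat_def using assms by (intro eq_matI) auto

text \<open>
  The situation of the theorem with the covariance model and the taper reduced to what the argument
  needs: a family \<open>c \<theta>\<close> of tapered covariances whose matrices are uniformly coercive and depend on
  \<open>\<theta>\<close> in a Lipschitz way, and the covariance \<open>c0\<close> of the field.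
\<close>

locale tapered_sampling = prob_space M for M :: "'w measure" +
  fixes c :: "real ^ 'p \<Rightarrow> real ^ 'd \<Rightarrow> real" and c0 :: "real ^ 'd \<Rightarrow> real" and \<Theta> :: "(real ^ 'p) set"
    and \<mu> \<nu> L \<tau> :: real and v :: "nat \<Rightarrow> real ^ 'd"
    and Z :: "real ^ 'd \<Rightarrow> 'w \<Rightarrow> real" and X :: "nat \<Rightarrow> 'w \<Rightarrow> real ^ 'd" and G :: "'w measure"
  assumes compact: "compact \<Theta>" and nonempty: "\<Theta> \<noteq> {}"
    and pos: "0 < \<mu>" "0 < \<nu>" "0 \<le> L" "0 \<le> \<tau>"
    and c_continuous: "continuous_on (\<Theta> \<times> UNIV) (\<lambda>(\<theta>, s). c \<theta> s)"
    and c0_continuous: "continuous_on UNIV c0" and c0_even: "\<And>x. c0 (- x) = c0 x"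
    and R_coercive: "\<And>n \<theta> s. \<theta> \<in> \<Theta> \<Longrightarrow> near_sites \<tau> v s \<Longrightarrow> coercive n \<mu> (cov_mat n (c \<theta>) s)"
    and K_coercive: "\<And>n s. near_sites \<tau> v s \<Longrightarrow> coercive n \<nu> (cov_mat n c0 s)"
    and R_lipschitz: "\<And>n \<theta> \<theta>' s x y. \<theta> \<in> \<Theta> \<Longrightarrow> \<theta>' \<in> \<Theta> \<Longrightarrow> near_sites \<tau> v s \<Longrightarrow>
       \<bar>bilinear_form n (\<lambda>i j. cov_mat n (c \<theta>') s $$ (i, j) - cov_mat n (c \<theta>) s $$ (i, j)) x y\<bar>
         \<le> L * dist \<theta> \<theta>' * (sq_norm n x + sq_norm n y) / 2"
    and K_trace: "\<And>n s E e. (\<And>x. \<bar>quadratic_form n E x\<bar> \<le> e * sq_norm n x) \<Longrightarrow>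
       \<bar>\<Sum>i<n. \<Sum>j<n. E i j * cov_mat n c0 s $$ (i, j)\<bar> \<le> e * c0 0 * real n"
    and K_decay: "\<And>\<epsilon>. 0 < \<epsilon> \<Longrightarrow> \<exists>n0. \<forall>n\<ge>n0. \<forall>s. near_sites \<tau> v s \<longrightarrow>
       (\<Sum>i<n. \<Sum>j<n. (c0 (s (Suc i) - s (Suc j)))\<^sup>2) \<le> \<epsilon> * (real n)\<^sup>2"
    and field: "centred_gaussian_field M Z c0"
    and subalg: "subalgebra M G" and joint: "(\<lambda>(s, \<omega>). Z s \<omega>) \<in> borel_measurable (borel \<Otimes>\<^sub>M G)"
    and X_borel: "\<And>i. 1 \<le> i \<Longrightarrow> X i \<in> borel_measurable M"
    and X_cube: "\<And>i \<omega>. 1 \<le> i \<Longrightarrow> \<omega> \<in> space M \<Longrightarrow> X i \<omega> \<in> unit_cube"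
    and indep: "indep_set (sets G)
          (sets (vimage_algebra (space M) (\<lambda>\<omega>. \<lambda>i\<in>{1..}. X i \<omega>) (\<Pi>\<^sub>M i\<in>{1..}. borel)))"
begin

abbreviation S :: "'w \<Rightarrow> nat \<Rightarrow> real ^ 'd" where
  "S \<omega> \<equiv> sites \<tau> v (\<lambda>i\<in>{1..}. X i \<omega>)"

abbreviation K :: "nat \<Rightarrow> 'w \<Rightarrow> real mat" where "K n \<omega> \<equiv> cov_mat n c0 (S \<omega>)"

abbreviation R :: "nat \<Rightarrow> real ^ 'p \<Rightarrow> 'w \<Rightarrow> real mat" where "R n \<theta> \<omega> \<equiv> cov_mat n (c \<theta>) (S \<omega>)"

abbreviation obs :: "'w \<Rightarrow> nat \<Rightarrow> real" where "obs \<omega> i \<equiv> Z (S \<omega> (Suc i)) \<omega>"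

abbreviation divergence :: "nat \<Rightarrow> real ^ 'p \<Rightarrow> 'w \<Rightarrow> real" where
  "divergence n \<theta> \<omega> \<equiv> scaled_kl n (K n \<omega>) (R n \<theta> \<omega>)"

lemma near: "near_sites \<tau> v (sites \<tau> v x)"
  by (rule near_sites_sites[OF pos(4)])

lemma X_prod: "(\<lambda>\<omega>. \<lambda>i\<in>{1..}. X i \<omega>) \<in> measurable M (\<Pi>\<^sub>M i\<in>{1..}. borel)"
  by (intro measurable_restrict X_borel) auto

lemma S_measurable: "1 \<le> i \<Longrightarrow> (\<lambda>\<omega>. S \<omega> i) \<in> borel_measurable M"
  by (rule measurable_compose[OF X_prod sites_measurable])

lemma c0_measurable [measurable]: "c0 \<in> borel_measurable borel"
  by (rule borel_measurable_continuous_onI[OF c0_continuous])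

lemma c_measurable [measurable]:
  "(\<lambda>(\<theta>, s). if \<theta> \<in> \<Theta> then c \<theta> s else 0) \<in> borel_measurable (borel \<Otimes>\<^sub>M borel)"
proof -
  have "closed (\<Theta> \<times> (UNIV :: (real ^ 'd) set))"
    by (intro closed_Times closed_UNIV compact_imp_closed[OF compact])
  then have "(\<lambda>x. if x \<in> \<Theta> \<times> UNIV then (\<lambda>(\<theta>, s). c \<theta> s) x else 0) \<in> borel_measurable borel"
    by (intro borel_measurable_continuous_on_if c_continuous continuous_on_const borel_closed)
  moreover have "(\<lambda>x. if x \<in> \<Theta> \<times> UNIV then (\<lambda>(\<theta>, s). c \<theta> s) x else 0) = (\<lambda>(\<theta>, s). if \<theta> \<in> \<Theta> then c \<theta> s else 0)"
    by (auto simp: fun_eq_iff)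
  ultimately show ?thesis by (simp add: borel_prod)
qed

lemma c_section_measurable: "\<theta> \<in> \<Theta> \<Longrightarrow> c \<theta> \<in> borel_measurable borel"
  using measurable_compose[OF measurable_Pair1'[of \<theta> borel borel] c_measurable] by simp

lemma obs_measurable: "(\<lambda>\<omega>. obs \<omega> i) \<in> borel_measurable M"
proof -
  have "(\<lambda>\<omega>. (S \<omega> (Suc i), \<omega>)) \<in> measurable M (borel \<Otimes>\<^sub>M G)"
    by (intro measurable_Pair S_measurable measurable_from_subalg[OF subalg measurable_ident_sets]) auto
  from measurable_compose[OF this joint] show ?thesis by simp
qed

text \<open>
  Off the space of \<open>M\<close> the parameter is redefined by a fixed element of \<open>\<Theta>\<close>, so that the matrices
  are coercive for every argument.
\<close>

lemma divergence_measurable: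
  assumes \<theta>: "\<theta> \<in> borel_measurable M" "\<And>\<omega>. \<omega> \<in> space M \<Longrightarrow> \<theta> \<omega> \<in> \<Theta>"
  shows "(\<lambda>\<omega>. divergence n (\<theta> \<omega>) \<omega>) \<in> borel_measurable M"
proof -
  obtain \<theta>1 where \<theta>1: "\<theta>1 \<in> \<Theta>" using nonempty by blast
  define \<theta>' where "\<theta>' = (\<lambda>\<omega>. if \<omega> \<in> space M then \<theta> \<omega> else \<theta>1)"
  have \<theta>'m: "\<theta>' \<in> borel_measurable M"
    using \<theta>(1) by (subst measurable_cong[of M \<theta>' \<theta>]) (auto simp: \<theta>'_def)
  have \<theta>'in: "\<theta>' \<omega> \<in> \<Theta>" for \<omega> using \<theta>(2) \<theta>1 by (simp add: \<theta>'_def)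
  have Rm: "(\<lambda>\<omega>. R n (\<theta>' \<omega>) \<omega> $$ (i, j)) \<in> borel_measurable M" if "i < n" "j < n" for i j
  proof -
    have "(\<lambda>\<omega>. (\<theta>' \<omega>, S \<omega> (Suc i) - S \<omega> (Suc j))) \<in> measurable M (borel \<Otimes>\<^sub>M borel)"
      by (intro measurable_Pair \<theta>'m borel_measurable_diff S_measurable) auto
    from measurable_compose[OF this c_measurable] show ?thesis
      using that \<theta>'in by (simp add: cov_mat_entry)
  qed
  have Km: "(\<lambda>\<omega>. K n \<omega> $$ (i, j)) \<in> borel_measurable M" if "i < n" "j < n" for i j
  proof -
    have "(\<lambda>\<omega>. S \<omega> (Suc i) - S \<omega> (Suc j)) \<in> borel_measurable M"
      by (intro borel_measurable_diff S_measurable) auto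
    from measurable_compose[OF this c0_measurable] show ?thesis
      using that by (simp add: cov_mat_entry)
  qed
  note Rc = R_coercive[OF \<theta>'in near] and Kc = K_coercive[OF near]
  have "(\<lambda>\<omega>. divergence n (\<theta>' \<omega>) \<omega>) \<in> borel_measurable M"
    unfolding scaled_kl_eq[OF Kc pos(2) Rc pos(1)]
    by (intro borel_measurable_diff borel_measurable_add borel_measurable_divide borel_measurable_const
        borel_measurable_ln borel_measurable_sum borel_measurable_times det_borel_measurable[of _ n]
        inv_mat_borel_measurable[OF Rc pos(1)] Rm Km cov_mat_carrier) auto
  then show ?thesis
    by (subst measurable_cong[of M _ "\<lambda>\<omega>. divergence n (\<theta>' \<omega>) \<omega>"]) (auto simp: \<theta>'_def)
qed

lemma divergence_lipschitz:
  assumes \<theta>: "\<theta> \<in> \<Theta>" "\<theta>' \<in> \<Theta>" and close: "L * dist \<theta> \<theta>' \<le> \<mu> / 2" and n: "1 \<le> n"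
  shows "\<bar>divergence n \<theta>' \<omega> - divergence n \<theta> \<omega>\<bar> \<le> (2 / \<mu> + c0 0 / \<mu>\<^sup>2) * (L * dist \<theta> \<theta>')"
  using pos(3) by (intro scaled_kl_perturbation[OF K_coercive[OF near] pos(2) R_coercive[OF \<theta>(1) near]
      R_coercive[OF \<theta>(2) near] pos(1) R_lipschitz[OF \<theta> near] K_trace _ close n]) auto

lemma divergence_continuous:
  assumes n: "1 \<le> n"
  shows "continuous_on \<Theta> (\<lambda>\<theta>. divergence n \<theta> \<omega>)"
  unfolding continuous_on_iff
proof (intro ballI allI impI)
  fix \<theta> and \<epsilon> :: real assume \<theta>: "\<theta> \<in> \<Theta>" and \<epsilon>: "0 < \<epsilon>"
  define C where "C = \<bar>2 / \<mu> + c0 0 / \<mu>\<^sup>2\<bar> * L"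
  have C: "0 \<le> C" using pos by (simp add: C_def)
  \<comment> \<open>within this radius the Lipschitz bound applies and stays below \<open>\<epsilon>\<close>\<close>
  define h where "h = min (\<mu> / 2 / (L + 1)) (\<epsilon> / (C + 1))"
  have h: "0 < h" using pos C \<epsilon> by (simp add: h_def)
  have "dist (divergence n \<theta>' \<omega>) (divergence n \<theta> \<omega>) < \<epsilon>" if \<theta>': "\<theta>' \<in> \<Theta>" "dist \<theta>' \<theta> < h" for \<theta>'
  proof -
    have d: "dist \<theta> \<theta>' \<le> \<mu> / 2 / (L + 1)" "dist \<theta> \<theta>' < \<epsilon> / (C + 1)"
      using \<theta>'(2) by (auto simp: h_def dist_commute)
    have "L * dist \<theta> \<theta>' \<le> (L + 1) * dist \<theta> \<theta>'" by (simp add: mult_right_mono)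
    also have "\<dots> \<le> (L + 1) * (\<mu> / 2 / (L + 1))" using d(1) pos by (intro mult_left_mono) auto
    also have "\<dots> = \<mu> / 2"
    proof -
      have "a * (b / a) = b" if "a \<noteq> 0" for a b :: real using that by simp
      from this[of "L + 1" "\<mu> / 2"] show ?thesis using pos by linarith
    qed
    finally have close: "L * dist \<theta> \<theta>' \<le> \<mu> / 2" .
    have "\<bar>divergence n \<theta>' \<omega> - divergence n \<theta> \<omega>\<bar> \<le> (2 / \<mu> + c0 0 / \<mu>\<^sup>2) * (L * dist \<theta> \<theta>')"
      by (rule divergence_lipschitz[OF \<theta> \<theta>'(1) close n])
    also have "\<dots> \<le> \<bar>2 / \<mu> + c0 0 / \<mu>\<^sup>2\<bar> * (L * dist \<theta> \<theta>')"
      using pos by (intro mult_right_mono) auto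
    also have "\<dots> \<le> (C + 1) * dist \<theta> \<theta>'" by (simp add: C_def algebra_simps)
    also have "\<dots> < (C + 1) * (\<epsilon> / (C + 1))" using d(2) C by (intro mult_strict_left_mono) auto
    also have "\<dots> = \<epsilon>" using C by simp
    finally show ?thesis by (simp add: dist_real_def)
  qed
  then show "\<exists>d>0. \<forall>\<theta>'\<in>\<Theta>. dist \<theta>' \<theta> < d \<longrightarrow> dist (divergence n \<theta>' \<omega>) (divergence n \<theta> \<omega>) < \<epsilon>"
    using h by blast
qed

lemma divergence_bdd_below:
  assumes "1 \<le> n"
  shows "bdd_below ((\<lambda>\<theta>. divergence n \<theta> \<omega>) ` \<Theta>)"
  using compact_continuous_image[OF divergence_continuous[OF assms] compact]
  by (intro bounded_imp_bdd_below compact_imp_bounded)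

text \<open>
  By continuity the infimum may be taken over a countable dense subset.
\<close>

lemma divergence_INF_measurable:
  assumes n: "1 \<le> n"
  shows "(\<lambda>\<omega>. INF \<theta>\<in>\<Theta>. divergence n \<theta> \<omega>) \<in> borel_measurable M"
proof -
  obtain T where T: "countable T" "T \<subseteq> \<Theta>" "\<Theta> \<subseteq> closure T" using separable[of \<Theta>] by blast
  have Tne: "T \<noteq> {}" using T nonempty by auto
  have clT: "closure T = \<Theta>"
    using T compact_imp_closed[OF compact] closure_minimal[of T \<Theta>] by blast
  have eq: "(INF \<theta>\<in>\<Theta>. divergence n \<theta> \<omega>) = (INF \<theta>\<in>T. divergence n \<theta> \<omega>)" for \<omega>
  proof (rule antisym)
    show "(INF \<theta>\<in>\<Theta>. divergence n \<theta> \<omega>) \<le> (INF \<theta>\<in>T. divergence n \<theta> \<omega>)"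
      by (rule cINF_superset_mono[OF Tne divergence_bdd_below[OF n] T(2)]) simp
    show "(INF \<theta>\<in>T. divergence n \<theta> \<omega>) \<le> (INF \<theta>\<in>\<Theta>. divergence n \<theta> \<omega>)"
    proof (rule cINF_greatest[OF nonempty])
      fix \<theta> assume "\<theta> \<in> \<Theta>"
      then have cl: "\<theta> \<in> closure T" using T by blast
      have cont: "continuous_on (closure T) (\<lambda>\<theta>. divergence n \<theta> \<omega>)"
        unfolding clT by (rule divergence_continuous[OF n])
      have "(INF \<theta>\<in>T. divergence n \<theta> \<omega>) \<le> divergence n \<theta>' \<omega>" if "\<theta>' \<in> T" for \<theta>'
        using bdd_below_mono[OF divergence_bdd_below[OF n] image_mono[OF T(2)]] that by (rule cINF_lower)
      from continuous_ge_on_closure[OF cont cl this]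
      show "(INF \<theta>\<in>T. divergence n \<theta> \<omega>) \<le> divergence n \<theta> \<omega>" .
    qed
  qed
  show ?thesis
    unfolding eq using T by (intro borel_measurable_cINF_real divergence_measurable) auto
qed

text \<open>
  The deviation of the likelihood from its mean for given sites.
\<close>

definition fluctuation :: "nat \<Rightarrow> real ^ 'p \<Rightarrow> 'w \<Rightarrow> real" where
  "fluctuation n \<theta> \<omega> = (quadratic_form n (entries (inv_mat (R n \<theta> \<omega>))) (obs \<omega>)
      - (\<Sum>i<n. \<Sum>j<n. inv_mat (R n \<theta> \<omega>) $$ (i, j) * K n \<omega> $$ (i, j))) / real n"

text \<open>
  For frozen sites this is the variance of a quadratic form, with \<open>1 / \<mu>\<^sup>2\<close> bounding the squared norm
  of the inverse.
\<close>

lemma fluctuation_second_moment: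
  assumes \<theta>: "\<theta> \<in> \<Theta>" and n: "1 \<le> n" and b: "\<And>s. near_sites \<tau> v s \<Longrightarrow>
       (\<Sum>i<n. \<Sum>j<n. (c0 (s (Suc i) - s (Suc j)))\<^sup>2) \<le> \<epsilon> * (real n)\<^sup>2"
  shows "fluctuation n \<theta> \<in> borel_measurable M"
    and "(\<integral>\<^sup>+ \<omega>. ennreal ((fluctuation n \<theta> \<omega>)\<^sup>2) \<partial>M) \<le> ennreal (2 / \<mu>\<^sup>2 * \<epsilon>)"
proof -
  let ?P = "\<Pi>\<^sub>M i\<in>{1..}. borel :: (real ^ 'd) measure"
  define Q where "Q = (\<lambda>(x, \<omega>). (quadratic_form n (entries (inv_mat (cov_mat n (c \<theta>) (sites \<tau> v x)))) (\<lambda>i. Z (sites \<tau> v x (Suc i)) \<omega>)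
      - (\<Sum>i<n. \<Sum>j<n. inv_mat (cov_mat n (c \<theta>) (sites \<tau> v x)) $$ (i, j) * c0 (sites \<tau> v x (Suc i) - sites \<tau> v x (Suc j)))) / real n)"
  have Q: "fluctuation n \<theta> \<omega> = Q (\<lambda>i\<in>{1..}. X i \<omega>, \<omega>)" for \<omega>
    by (simp add: fluctuation_def Q_def cov_mat_entry)
  note Rc = R_coercive[OF \<theta> near]
  have sm: "(\<lambda>p. sites \<tau> v (fst p) (Suc i)) \<in> borel_measurable (?P \<Otimes>\<^sub>M G)" for i
    by (intro measurable_compose[OF measurable_fst sites_measurable]) simp
  have cm: "(\<lambda>p. f (sites \<tau> v (fst p) (Suc i) - sites \<tau> v (fst p) (Suc j))) \<in> borel_measurable (?P \<Otimes>\<^sub>M G)"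
    if "f \<in> borel_measurable borel" for i j and f :: "real ^ 'd \<Rightarrow> real"
    by (intro measurable_compose[OF _ that] borel_measurable_diff sm)
  have im: "(\<lambda>p. inv_mat (cov_mat n (c \<theta>) (sites \<tau> v (fst p))) $$ (i, j)) \<in> borel_measurable (?P \<Otimes>\<^sub>M G)"
    if "i < n" "j < n" for i j
  proof (rule inv_mat_borel_measurable[OF Rc pos(1) _ that])
    fix i j assume "i < n" "j < n"
    then show "(\<lambda>p. cov_mat n (c \<theta>) (sites \<tau> v (fst p)) $$ (i, j)) \<in> borel_measurable (?P \<Otimes>\<^sub>M G)"
      using cm[OF c_section_measurable[OF \<theta>]] by (simp add: cov_mat_entry)
  qed
  have zm: "(\<lambda>p. Z (sites \<tau> v (fst p) (Suc i)) (snd p)) \<in> borel_measurable (?P \<Otimes>\<^sub>M G)" for i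
    using measurable_compose[OF measurable_Pair[OF sm measurable_snd] joint] by simp
  have Qm: "Q \<in> borel_measurable (?P \<Otimes>\<^sub>M G)"
    unfolding Q_def case_prod_beta quadratic_form_def
    by (intro borel_measurable_divide borel_measurable_diff borel_measurable_sum borel_measurable_times
        borel_measurable_const zm im cm c0_measurable) auto
  have pairm: "(\<lambda>\<omega>. (\<lambda>i\<in>{1..}. X i \<omega>, \<omega>)) \<in> measurable M (?P \<Otimes>\<^sub>M G)"
    by (intro measurable_Pair X_prod measurable_from_subalg[OF subalg measurable_ident_sets]) auto
  show "fluctuation n \<theta> \<in> borel_measurable M"
  proof -
    have "fluctuation n \<theta> = (\<lambda>\<omega>. Q (\<lambda>i\<in>{1..}. X i \<omega>, \<omega>))" by (rule ext) (rule Q)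
    then show ?thesis using measurable_compose[OF pairm Qm] by (simp only:)
  qed
  have "(\<integral>\<^sup>+ \<omega>. ennreal ((Q (\<lambda>i\<in>{1..}. X i \<omega>, \<omega>))\<^sup>2) \<partial>M) \<le> ennreal (2 / \<mu>\<^sup>2 * \<epsilon>)"
  proof (rule nn_integral_independent_bound[where F = "\<lambda>p. ennreal ((Q p)\<^sup>2)", OF prob_space_axioms subalg X_prod indep])
    show "(\<lambda>p. ennreal ((Q p)\<^sup>2)) \<in> borel_measurable (?P \<Otimes>\<^sub>M G)"
      using Qm by measurable
    fix x :: "nat \<Rightarrow> real ^ 'd"
    let ?s = "\<lambda>i. sites \<tau> v x (Suc i)" and ?B = "entries (inv_mat (cov_mat n (c \<theta>) (sites \<tau> v x)))"
    let ?q = "\<lambda>\<omega>. (quadratic_form n ?B (\<lambda>i. Z (?s i) \<omega>) - (\<Sum>i<n. \<Sum>j<n. ?B i j * c0 (?s i - ?s j)))\<^sup>2"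
    have norm: "sq_norm n (\<lambda>i. \<Sum>j<n. ?B i j * y j) \<le> 1 / \<mu>\<^sup>2 * sq_norm n y" for y
      using coercive_inverse_norm[OF Rc pos(1)] by simp
    note V = quadratic_form_variance[OF field coercive_inverse(5)[OF Rc pos(1)] norm c0_even, where s = ?s]
    have "(\<integral>\<^sup>+ \<omega>. ennreal ((Q (x, \<omega>))\<^sup>2) \<partial>M) = (\<integral>\<^sup>+ \<omega>. ennreal (?q \<omega> / (real n)\<^sup>2) \<partial>M)"
      by (simp add: Q_def power_divide)
    also have "\<dots> = ennreal (expectation (\<lambda>\<omega>. ?q \<omega> / (real n)\<^sup>2))"
      using V(1) by (intro nn_integral_eq_integral) auto
    also have "\<dots> \<le> ennreal (2 / \<mu>\<^sup>2 * \<epsilon>)"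
    proof (rule ennreal_leI)
      have "expectation ?q \<le> 2 * (1 / \<mu>\<^sup>2) * (\<Sum>i<n. \<Sum>j<n. (c0 (?s i - ?s j))\<^sup>2)"
        by (rule V(2)) auto
      also have "\<dots> \<le> 2 * (1 / \<mu>\<^sup>2) * (\<epsilon> * (real n)\<^sup>2)"
        by (rule mult_left_mono[OF b[OF near]]) simp
      finally show "expectation (\<lambda>\<omega>. ?q \<omega> / (real n)\<^sup>2) \<le> 2 / \<mu>\<^sup>2 * \<epsilon>"
        using n by (simp add: pos_divide_le_eq mult_ac)
    qed
    finally show "(\<integral>\<^sup>+ \<omega>. ennreal ((Q (x, \<omega>))\<^sup>2) \<partial>M) \<le> ennreal (2 / \<mu>\<^sup>2 * \<epsilon>)" .
  qed
  then show "(\<integral>\<^sup>+ \<omega>. ennreal ((fluctuation n \<theta> \<omega>)\<^sup>2) \<partial>M) \<le> ennreal (2 / \<mu>\<^sup>2 * \<epsilon>)"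
    by (simp only: Q)
qed

lemma fluctuation_tendsto_0:
  assumes \<theta>: "\<theta> \<in> \<Theta>" and \<epsilon>: "0 < \<epsilon>"
  shows "(\<lambda>n. prob {\<omega> \<in> space M. \<epsilon> < \<bar>fluctuation n \<theta> \<omega>\<bar>}) \<longlonglongrightarrow> 0"
proof (rule LIMSEQ_I)
  fix r :: real assume r: "0 < r"
  \<comment> \<open>chosen so that the second moment bound gives the probability \<open>r / 2\<close>\<close>
  define e where "e = r * \<epsilon>\<^sup>2 * \<mu>\<^sup>2 / 4"
  have e: "0 < e" using r \<epsilon> pos by (simp add: e_def)
  obtain n0 where n0: "\<forall>n\<ge>n0. \<forall>s. near_sites \<tau> v s \<longrightarrow>
       (\<Sum>i<n. \<Sum>j<n. (c0 (s (Suc i) - s (Suc j)))\<^sup>2) \<le> e * (real n)\<^sup>2"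
    using K_decay[OF e] by blast
  have "norm (prob {\<omega> \<in> space M. \<epsilon> < \<bar>fluctuation n \<theta> \<omega>\<bar>} - 0) < r" if n: "max 1 n0 \<le> n" for n
  proof -
    have F: "fluctuation n \<theta> \<in> borel_measurable M" "(\<integral>\<^sup>+ \<omega>. ennreal ((fluctuation n \<theta> \<omega>)\<^sup>2) \<partial>M) \<le> ennreal (2 / \<mu>\<^sup>2 * e)"
      using fluctuation_second_moment[OF \<theta>, of n e] n n0 by auto
    have "\<epsilon> < \<bar>y\<bar> \<longleftrightarrow> \<epsilon>\<^sup>2 < y\<^sup>2" for y :: real
      using \<epsilon> abs_le_square_iff[of y \<epsilon>] by (simp add: not_le[symmetric])
    then have "prob {\<omega> \<in> space M. \<epsilon> < \<bar>fluctuation n \<theta> \<omega>\<bar>} = prob {\<omega> \<in> space M. \<epsilon>\<^sup>2 < (fluctuation n \<theta> \<omega>)\<^sup>2}"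
      by simp
    also have "\<dots> \<le> (2 / \<mu>\<^sup>2 * e) / \<epsilon>\<^sup>2"
      using F e \<epsilon> by (intro markov_bound) auto
    also have "\<dots> = r / 2" using \<epsilon> pos by (simp add: e_def)
    finally show ?thesis using r by (simp add: measure_nonneg)
  qed
  then show "\<exists>no. \<forall>n\<ge>no. norm (prob {\<omega> \<in> space M. \<epsilon> < \<bar>fluctuation n \<theta> \<omega>\<bar>} - 0) < r" by blast
qed

lemma mean_square_bound:
  assumes n: "1 \<le> n"
  shows "(\<lambda>\<omega>. sq_norm n (obs \<omega>) / real n) \<in> borel_measurable M"
    and "(\<integral>\<^sup>+ \<omega>. ennreal (sq_norm n (obs \<omega>) / real n) \<partial>M) \<le> ennreal (c0 0)"
proof -
  let ?P = "\<Pi>\<^sub>M i\<in>{1..}. borel :: (real ^ 'd) measure"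
  show "(\<lambda>\<omega>. sq_norm n (obs \<omega>) / real n) \<in> borel_measurable M"
    unfolding sq_norm_def by (intro borel_measurable_divide borel_measurable_sum borel_measurable_power obs_measurable) auto
  let ?F = "\<lambda>p. ennreal ((\<Sum>i<n. (Z (sites \<tau> v (fst p) (Suc i)) (snd p))\<^sup>2) / real n)"
  have "(\<integral>\<^sup>+ \<omega>. ?F (\<lambda>i\<in>{1..}. X i \<omega>, \<omega>) \<partial>M) \<le> ennreal (c0 0)"
  proof (rule nn_integral_independent_bound[OF prob_space_axioms subalg X_prod indep])
    have sm: "(\<lambda>p. sites \<tau> v (fst p) (Suc i)) \<in> borel_measurable (?P \<Otimes>\<^sub>M G)" for i
      by (intro measurable_compose[OF measurable_fst sites_measurable]) simp
    have zm: "(\<lambda>p. Z (sites \<tau> v (fst p) (Suc i)) (snd p)) \<in> borel_measurable (?P \<Otimes>\<^sub>M G)" for i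
      using measurable_compose[OF measurable_Pair[OF sm measurable_snd] joint] by simp
    show "?F \<in> borel_measurable (?P \<Otimes>\<^sub>M G)"
      by (intro measurable_compose[OF _ measurable_ennreal] borel_measurable_divide borel_measurable_sum borel_measurable_power zm) auto
    fix x :: "nat \<Rightarrow> real ^ 'd"
    let ?s = "\<lambda>i. sites \<tau> v x (Suc i)"
    note P = gaussian_field_products[OF field]
    have "(\<integral>\<^sup>+ \<omega>. ?F (x, \<omega>) \<partial>M) = ennreal (expectation (\<lambda>\<omega>. (\<Sum>i<n. Z (?s i) \<omega> * Z (?s i) \<omega>) / real n))"
      unfolding fst_conv snd_conv power2_eq_square
      by (intro nn_integral_eq_integral integrable_divide Bochner_Integration.integrable_sum P(2))
         (auto intro!: sum_nonneg divide_nonneg_nonneg)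
    also have "expectation (\<lambda>\<omega>. (\<Sum>i<n. Z (?s i) \<omega> * Z (?s i) \<omega>) / real n) = c0 0"
      using n by (simp add: P)
    finally show "(\<integral>\<^sup>+ \<omega>. ?F (x, \<omega>) \<partial>M) \<le> ennreal (c0 0)" by simp
  qed
  then show "(\<integral>\<^sup>+ \<omega>. ennreal (sq_norm n (obs \<omega>) / real n) \<partial>M) \<le> ennreal (c0 0)"
    by (simp add: sq_norm_def)
qed

lemma fluctuation_lipschitz:
  assumes \<theta>: "\<theta> \<in> \<Theta>" "\<theta>' \<in> \<Theta>" and n: "1 \<le> n"
  shows "\<bar>fluctuation n \<theta>' \<omega> - fluctuation n \<theta> \<omega>\<bar> \<le> L * dist \<theta> \<theta>' / \<mu>\<^sup>2 * (sq_norm n (obs \<omega>) / real n + c0 0)"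
proof -
  let ?D = "\<lambda>i j. inv_mat (R n \<theta>' \<omega>) $$ (i, j) - inv_mat (R n \<theta> \<omega>) $$ (i, j)"
  have bd: "\<bar>quadratic_form n ?D x\<bar> \<le> L * dist \<theta> \<theta>' / \<mu>\<^sup>2 * sq_norm n x" for x
    using pos by (intro inverse_perturbation[OF R_coercive[OF \<theta>(1) near] R_coercive[OF \<theta>(2) near] pos(1) R_lipschitz[OF \<theta> near]]) auto
  have tr: "\<bar>\<Sum>i<n. \<Sum>j<n. ?D i j * K n \<omega> $$ (i, j)\<bar> \<le> L * dist \<theta> \<theta>' / \<mu>\<^sup>2 * c0 0 * real n"
    by (rule K_trace[OF bd])
  let ?Q = "quadratic_form n ?D (obs \<omega>)" and ?T = "\<Sum>i<n. \<Sum>j<n. ?D i j * K n \<omega> $$ (i, j)" and ?e = "L * dist \<theta> \<theta>' / \<mu>\<^sup>2"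
  have Q: "?Q = quadratic_form n (entries (inv_mat (R n \<theta>' \<omega>))) (obs \<omega>) - quadratic_form n (entries (inv_mat (R n \<theta> \<omega>))) (obs \<omega>)"
    by (rule quadratic_form_diff)
  have T: "?T = (\<Sum>i<n. \<Sum>j<n. inv_mat (R n \<theta>' \<omega>) $$ (i, j) * K n \<omega> $$ (i, j)) - (\<Sum>i<n. \<Sum>j<n. inv_mat (R n \<theta> \<omega>) $$ (i, j) * K n \<omega> $$ (i, j))"
    by (simp only: left_diff_distrib sum_subtractf)
  have arith: "(q' - t') / m - (q - t) / m = ((q' - q) - (t' - t)) / m" for q q' t t' m :: real
    by (simp add: diff_divide_distrib)
  have "fluctuation n \<theta>' \<omega> - fluctuation n \<theta> \<omega> = (?Q - ?T) / real n"
    unfolding fluctuation_def arith Q T ..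
  then have "\<bar>fluctuation n \<theta>' \<omega> - fluctuation n \<theta> \<omega>\<bar> = \<bar>?Q - ?T\<bar> / real n"
    by (simp only: abs_divide abs_of_nat)
  also have "\<dots> \<le> (?e * sq_norm n (obs \<omega>) + ?e * c0 0 * real n) / real n"
    using bd[of "obs \<omega>"] tr by (intro divide_right_mono) linarith+
  also have "\<dots> = ?e * (sq_norm n (obs \<omega>) / real n + c0 0)"
    using n by (simp add: add_divide_distrib distrib_left)
  finally show ?thesis .
qed

text \<open>
  Two errors separate the computed likelihood from the divergence: the perturbation of the matrix and
  the fluctuation. The matrix \<open>R'\<close> is coercive with half the constant, hence the factors.
\<close>

lemma likelihood_approximation:
  assumes \<theta>: "\<theta> \<in> \<Theta>" and n: "1 \<le> n" and R': "R' \<in> carrier_mat n n"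
    "\<And>i j. i < n \<Longrightarrow> j < n \<Longrightarrow> R' $$ (i, j) = R' $$ (j, i)"
    and D: "\<And>x y. \<bar>bilinear_form n (\<lambda>i j. R' $$ (i, j) - R n \<theta> \<omega> $$ (i, j)) x y\<bar> \<le> \<epsilon> * (sq_norm n x + sq_norm n y) / 2"
    and \<epsilon>: "0 \<le> \<epsilon>" "\<epsilon> \<le> \<mu> / 4"
  shows "coercive n (\<mu> / 2) R'"
    and "\<bar>divergence n \<theta> \<omega> - scaled_kl n (K n \<omega>) R'\<bar> \<le> (4 / \<mu> + 4 * c0 0 / \<mu>\<^sup>2) * \<epsilon>"
    and "\<bar>truncated_likelihood n R' (Matrix.vec n (obs \<omega>)) - (divergence n \<theta> \<omega> + ln (det (K n \<omega>)) / real n + 1)\<bar>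
      \<le> (4 / \<mu> + 4 / \<mu>\<^sup>2 * (sq_norm n (obs \<omega>) / real n)) * \<epsilon> + \<bar>fluctuation n \<theta> \<omega>\<bar>"
proof -
  have D': "\<bar>quadratic_form n (\<lambda>i j. R' $$ (i, j) - R n \<theta> \<omega> $$ (i, j)) x\<bar> \<le> \<epsilon> * sq_norm n x" for x
  proof -
    have "e * (a + a) / 2 = e * a" for e a :: real by simp
    then show ?thesis using D[of x x] unfolding quadratic_form_bilinear by (simp only:)
  qed
  have \<mu>2: "0 < \<mu> / 2" "\<epsilon> \<le> \<mu> / 2 / 2" using pos \<epsilon> by auto
  have A: "coercive n (\<mu> / 2) (R n \<theta> \<omega>)"
    using pos by (intro coercive_mono[OF R_coercive[OF \<theta> near]]) simp
  show A': "coercive n (\<mu> / 2) R'"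
    by (rule coercive_mono[OF coercive_perturbation[OF R_coercive[OF \<theta> near] R' D']]) (use \<epsilon> pos in auto)
  note Kc = K_coercive[OF near]
  have "\<bar>scaled_kl n (K n \<omega>) R' - divergence n \<theta> \<omega>\<bar> \<le> (2 / (\<mu> / 2) + c0 0 / (\<mu> / 2)\<^sup>2) * \<epsilon>"
    by (rule scaled_kl_perturbation[OF Kc pos(2) A A' \<mu>2(1) D K_trace \<epsilon>(1) \<mu>2(2) n]) auto
  moreover have "2 / (\<mu> / 2) + c0 0 / (\<mu> / 2)\<^sup>2 = 4 / \<mu> + 4 * c0 0 / \<mu>\<^sup>2"
    by (simp add: power_divide)
  ultimately show "\<bar>divergence n \<theta> \<omega> - scaled_kl n (K n \<omega>) R'\<bar> \<le> (4 / \<mu> + 4 * c0 0 / \<mu>\<^sup>2) * \<epsilon>"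
    by (simp only: abs_minus_commute)
  have "\<bar>ln (det R') - ln (det (R n \<theta> \<omega>))\<bar> / real n \<le> real n * (2 * \<epsilon> / (\<mu> / 2)) / real n"
    by (rule divide_right_mono[OF log_det_perturbation[OF A A' \<mu>2(1) D' \<epsilon>(1) \<mu>2(2)]]) simp
  also have "\<dots> = 4 / \<mu> * \<epsilon>" using n by simp
  finally have 1: "\<bar>ln (det R') - ln (det (R n \<theta> \<omega>))\<bar> / real n \<le> 4 / \<mu> * \<epsilon>" .
  let ?D = "\<lambda>i j. inv_mat R' $$ (i, j) - inv_mat (R n \<theta> \<omega>) $$ (i, j)"
  have "\<bar>quadratic_form n ?D (obs \<omega>)\<bar> \<le> \<epsilon> / (\<mu> / 2)\<^sup>2 * sq_norm n (obs \<omega>)"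
    by (rule inverse_perturbation[OF A A' \<mu>2(1) D \<epsilon>(1)])
  then have "\<bar>quadratic_form n ?D (obs \<omega>)\<bar> / real n \<le> \<epsilon> / (\<mu> / 2)\<^sup>2 * sq_norm n (obs \<omega>) / real n"
    by (rule divide_right_mono) simp
  also have "\<dots> = 4 / \<mu>\<^sup>2 * (sq_norm n (obs \<omega>) / real n) * \<epsilon>"
    by (simp add: power_divide)
  finally have 2: "\<bar>quadratic_form n ?D (obs \<omega>)\<bar> / real n \<le> 4 / \<mu>\<^sup>2 * (sq_norm n (obs \<omega>) / real n) * \<epsilon>" .
  have qcong: "quadratic_form n E (vec_index (Matrix.vec n (obs \<omega>))) = quadratic_form n E (obs \<omega>)" for E
    by (simp add: quadratic_form_def)
  have split: "truncated_likelihood n R' (Matrix.vec n (obs \<omega>)) - (divergence n \<theta> \<omega> + ln (det (K n \<omega>)) / real n + 1)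
     = (ln (det R') - ln (det (R n \<theta> \<omega>))) / real n + quadratic_form n ?D (obs \<omega>) / real n + fluctuation n \<theta> \<omega>"
  proof -
    have arith: "(a' / m + q' / m) - ((a - k) / m + t / m - 1 + k / m + 1) = (a' - a) / m + (q' - q) / m + (q - t) / m"
      for a a' q q' t k m :: real by (simp add: diff_divide_distrib)
    show ?thesis
      unfolding truncated_likelihood_eq[OF A' \<mu>2(1) vec_carrier] scaled_kl_eq[OF Kc pos(2) A \<mu>2(1)] qcong fluctuation_def
        quadratic_form_diff by (rule arith)
  qed
  have arith: "\<bar>x\<bar> \<le> (a + b) * e + \<bar>w\<bar>" if "x = y / real n + z / real n + w" "\<bar>y\<bar> / real n \<le> a * e" "\<bar>z\<bar> / real n \<le> b * e"
    for x y z w a b e :: real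
    using that abs_triangle_ineq[of "y / real n + z / real n" w] abs_triangle_ineq[of "y / real n" "z / real n"]
    by (simp add: distrib_right)
  show "\<bar>truncated_likelihood n R' (Matrix.vec n (obs \<omega>)) - (divergence n \<theta> \<omega> + ln (det (K n \<omega>)) / real n + 1)\<bar>
      \<le> (4 / \<mu> + 4 / \<mu>\<^sup>2 * (sq_norm n (obs \<omega>) / real n)) * \<epsilon> + \<bar>fluctuation n \<theta> \<omega>\<bar>"
    by (rule arith[OF split 1 2])
qed

end

section \<open>Near-optimality of the minimizer\<close>

context tapered_sampling
begin

lemma variance_nonneg: "0 \<le> c0 0"
proof -
  have "c0 0 = expectation (\<lambda>\<omega>. Z 0 \<omega> * Z 0 \<omega>)"
    using gaussian_field_products(3)[OF field, of 0 0] by simp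
  also have "0 \<le> \<dots>" by (intro integral_nonneg_AE AE_I2) simp
  finally show ?thesis .
qed

text \<open>
  The distance is measured in the form in which the row sum bound for kernels of bounded range delivers
  it; it amounts to convergence in operator norm, uniformly in \<open>\<theta>\<close> and in the outcome.
\<close>

definition approximates :: "(nat \<Rightarrow> real ^ 'p \<Rightarrow> 'w \<Rightarrow> real mat) \<Rightarrow> bool" where
  "approximates R' \<longleftrightarrow> (\<forall>\<epsilon>>0. \<exists>N. \<forall>n\<ge>N. \<forall>\<theta>\<in>\<Theta>. \<forall>\<omega>\<in>space M.
     R' n \<theta> \<omega> \<in> carrier_mat n n \<and> (\<forall>i<n. \<forall>j<n. R' n \<theta> \<omega> $$ (i, j) = R' n \<theta> \<omega> $$ (j, i)) \<and>
     (\<forall>x y. \<bar>bilinear_form n (\<lambda>i j. R' n \<theta> \<omega> $$ (i, j) - R n \<theta> \<omega> $$ (i, j)) x y\<bar> \<le> \<epsilon> * (sq_norm n x + sq_norm n y) / 2))"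

lemma approximatesD:
  assumes R': "approximates R'" and \<epsilon>: "0 < \<epsilon>" "\<epsilon> \<le> \<mu> / 4"
  obtains N where "1 \<le> N"
    and "\<And>n \<theta> \<omega>. N \<le> n \<Longrightarrow> \<theta> \<in> \<Theta> \<Longrightarrow> \<omega> \<in> space M \<Longrightarrow> coercive n (\<mu> / 2) (R' n \<theta> \<omega>)"
    and "\<And>n \<theta> \<omega>. N \<le> n \<Longrightarrow> \<theta> \<in> \<Theta> \<Longrightarrow> \<omega> \<in> space M \<Longrightarrow>
      \<bar>divergence n \<theta> \<omega> - scaled_kl n (K n \<omega>) (R' n \<theta> \<omega>)\<bar> \<le> (4 / \<mu> + 4 * c0 0 / \<mu>\<^sup>2) * \<epsilon>"
    and "\<And>n \<theta> \<omega>. N \<le> n \<Longrightarrow> \<theta> \<in> \<Theta> \<Longrightarrow> \<omega> \<in> space M \<Longrightarrow>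
      \<bar>truncated_likelihood n (R' n \<theta> \<omega>) (Matrix.vec n (obs \<omega>)) - (divergence n \<theta> \<omega> + ln (det (K n \<omega>)) / real n + 1)\<bar>
      \<le> (4 / \<mu> + 4 / \<mu>\<^sup>2 * (sq_norm n (obs \<omega>) / real n)) * \<epsilon> + \<bar>fluctuation n \<theta> \<omega>\<bar>"
proof -
  obtain N where N: "\<And>n \<theta> \<omega>. N \<le> n \<Longrightarrow> \<theta> \<in> \<Theta> \<Longrightarrow> \<omega> \<in> space M \<Longrightarrow>
     R' n \<theta> \<omega> \<in> carrier_mat n n \<and> (\<forall>i<n. \<forall>j<n. R' n \<theta> \<omega> $$ (i, j) = R' n \<theta> \<omega> $$ (j, i)) \<and>
     (\<forall>x y. \<bar>bilinear_form n (\<lambda>i j. R' n \<theta> \<omega> $$ (i, j) - R n \<theta> \<omega> $$ (i, j)) x y\<bar> \<le> \<epsilon> * (sq_norm n x + sq_norm n y) / 2)"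
    using R' \<epsilon>(1) unfolding approximates_def by meson
  show thesis
  proof (rule that[of "max 1 N"])
    fix n \<theta> \<omega> assume a: "max 1 N \<le> n" "\<theta> \<in> \<Theta>" "\<omega> \<in> space M"
    have n: "1 \<le> n" "N \<le> n" using a(1) by auto
    have C: "R' n \<theta> \<omega> \<in> carrier_mat n n"
      and S: "\<And>i j. i < n \<Longrightarrow> j < n \<Longrightarrow> R' n \<theta> \<omega> $$ (i, j) = R' n \<theta> \<omega> $$ (j, i)"
      and D: "\<And>x y. \<bar>bilinear_form n (\<lambda>i j. R' n \<theta> \<omega> $$ (i, j) - R n \<theta> \<omega> $$ (i, j)) x y\<bar> \<le> \<epsilon> * (sq_norm n x + sq_norm n y) / 2"
      using N[OF n(2) a(2,3)] by blast+
    note A = likelihood_approximation[OF a(2) n(1) C _ D less_imp_le[OF \<epsilon>(1)] \<epsilon>(2)]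
    show "coercive n (\<mu> / 2) (R' n \<theta> \<omega>)" by (rule A(1)) (rule S)
    show "\<bar>divergence n \<theta> \<omega> - scaled_kl n (K n \<omega>) (R' n \<theta> \<omega>)\<bar> \<le> (4 / \<mu> + 4 * c0 0 / \<mu>\<^sup>2) * \<epsilon>"
      by (rule A(2)) (rule S)
    show "\<bar>truncated_likelihood n (R' n \<theta> \<omega>) (Matrix.vec n (obs \<omega>)) - (divergence n \<theta> \<omega> + ln (det (K n \<omega>)) / real n + 1)\<bar>
      \<le> (4 / \<mu> + 4 / \<mu>\<^sup>2 * (sq_norm n (obs \<omega>) / real n)) * \<epsilon> + \<bar>fluctuation n \<theta> \<omega>\<bar>"
      by (rule A(3)) (rule S)
  qed simp
qed

lemma approximating_positive_definite:
  assumes "approximates R'"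
  shows "\<exists>N\<ge>1. \<forall>n\<ge>N. \<forall>\<theta>\<in>\<Theta>. \<forall>\<omega>\<in>space M. positive_definite (R' n \<theta> \<omega>)"
proof -
  obtain N where N: "1 \<le> N" "\<And>n \<theta> \<omega>. N \<le> n \<Longrightarrow> \<theta> \<in> \<Theta> \<Longrightarrow> \<omega> \<in> space M \<Longrightarrow> coercive n (\<mu> / 2) (R' n \<theta> \<omega>)"
    using approximatesD[OF assms, of "\<mu> / 4"] pos by (metis divide_pos_pos order_refl zero_less_numeral)
  have "0 < \<mu> / 2" using pos by simp
  then show ?thesis using N coercive_positive_definite by blast
qed

lemma divergence_approximation:
  assumes R': "approximates R'" and \<omega>: "\<omega> \<in> space M"
  shows "(\<lambda>n. SUP \<theta>\<in>\<Theta>. ereal \<bar>divergence n \<theta> \<omega> - scaled_kl n (K n \<omega>) (R' n \<theta> \<omega>)\<bar>) \<longlonglongrightarrow> 0"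
proof (rule order_tendstoI)
  obtain \<theta>1 where \<theta>1: "\<theta>1 \<in> \<Theta>" using nonempty by blast
  fix a :: ereal assume a: "a < 0"
  have "a < (SUP \<theta>\<in>\<Theta>. ereal \<bar>divergence n \<theta> \<omega> - scaled_kl n (K n \<omega>) (R' n \<theta> \<omega>)\<bar>)" for n
    by (rule less_le_trans[OF a SUP_upper2[OF \<theta>1]]) simp
  then show "\<forall>\<^sub>F n in sequentially. a < (SUP \<theta>\<in>\<Theta>. ereal \<bar>divergence n \<theta> \<omega> - scaled_kl n (K n \<omega>) (R' n \<theta> \<omega>)\<bar>)"
    by simp
next
  fix a :: ereal assume "0 < a"
  then obtain e where e: "0 < e" "ereal e < a"
    using ereal_dense2[of 0 a] by (metis ereal_less(2))
  define C where "C = 4 / \<mu> + 4 * c0 0 / \<mu>\<^sup>2"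
  have C: "0 < C" using pos variance_nonneg by (simp add: C_def add_pos_nonneg)
  define \<epsilon> where "\<epsilon> = min (\<mu> / 4) (e / C)"
  have \<epsilon>: "0 < \<epsilon>" "\<epsilon> \<le> \<mu> / 4" "C * \<epsilon> \<le> e"
  proof -
    show "0 < \<epsilon>" using pos C e by (simp add: \<epsilon>_def)
    show "\<epsilon> \<le> \<mu> / 4" by (simp only: \<epsilon>_def min.cobounded1)
    have "\<epsilon> \<le> e / C" by (simp add: \<epsilon>_def)
    then show "C * \<epsilon> \<le> e" using C by (simp add: pos_le_divide_eq mult.commute)
  qed
  obtain N where N: "\<And>n \<theta> \<omega>. N \<le> n \<Longrightarrow> \<theta> \<in> \<Theta> \<Longrightarrow> \<omega> \<in> space M \<Longrightarrow>
      \<bar>divergence n \<theta> \<omega> - scaled_kl n (K n \<omega>) (R' n \<theta> \<omega>)\<bar> \<le> C * \<epsilon>"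
    using approximatesD[OF R' \<epsilon>(1,2)] unfolding C_def by metis
  have "(SUP \<theta>\<in>\<Theta>. ereal \<bar>divergence n \<theta> \<omega> - scaled_kl n (K n \<omega>) (R' n \<theta> \<omega>)\<bar>) < a" if "N \<le> n" for n
  proof (rule le_less_trans[OF SUP_least e(2)])
    fix \<theta> assume "\<theta> \<in> \<Theta>"
    then show "ereal \<bar>divergence n \<theta> \<omega> - scaled_kl n (K n \<omega>) (R' n \<theta> \<omega>)\<bar> \<le> ereal e"
      using N[OF that _ \<omega>, of \<theta>] \<epsilon>(3) by simp
  qed
  then show "\<forall>\<^sub>F n in sequentially. (SUP \<theta>\<in>\<Theta>. ereal \<bar>divergence n \<theta> \<omega> - scaled_kl n (K n \<omega>) (R' n \<theta> \<omega>)\<bar>) < a"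
    unfolding eventually_sequentially by blast
qed

text \<open>
  A minimizer of \<open>l\<close> loses at most the uniform distance twice; the additive constant \<open>a\<close> is common to
  all parameters and cancels.
\<close>

lemma near_minimizer_deterministic:
  assumes n: "1 \<le> n" and \<theta>1: "\<theta>1 \<in> \<Theta>"
    and min: "\<And>\<theta>. \<theta> \<in> \<Theta> \<Longrightarrow> l \<theta>1 \<le> l \<theta>"
    and close: "\<And>\<theta>. \<theta> \<in> \<Theta> \<Longrightarrow> \<bar>l \<theta> - (divergence n \<theta> \<omega> + a)\<bar> \<le> \<eta>"
  shows "\<bar>divergence n \<theta>1 \<omega> - (INF \<theta>\<in>\<Theta>. divergence n \<theta> \<omega>)\<bar> \<le> 2 * \<eta>"
proof -
  have "(INF \<theta>\<in>\<Theta>. divergence n \<theta> \<omega>) \<le> divergence n \<theta>1 \<omega>"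
    by (rule cINF_lower[OF divergence_bdd_below[OF n] \<theta>1])
  moreover have "divergence n \<theta>1 \<omega> - 2 * \<eta> \<le> (INF \<theta>\<in>\<Theta>. divergence n \<theta> \<omega>)"
  proof (rule cINF_greatest[OF nonempty])
    fix \<theta> assume "\<theta> \<in> \<Theta>"
    then show "divergence n \<theta>1 \<omega> - 2 * \<eta> \<le> divergence n \<theta> \<omega>"
      using min[of \<theta>] close[of \<theta>] close[OF \<theta>1] by linarith
  qed
  ultimately show ?thesis by linarith
qed

text \<open>
  Outside the event that the mean square of the observations exceeds a large level \<open>H\<close> and the events
  that the fluctuation is large at some point of a finite net of \<open>\<Theta>\<close>, the fluctuation is small on all
  of \<open>\<Theta>\<close> and the likelihood is uniformly close to the divergence up to a constant.
\<close>

lemma estimator_near_optimal: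
  assumes R': "approximates R'"
    and \<theta>m: "\<And>n. 1 \<le> n \<Longrightarrow> \<theta>hat n \<in> borel_measurable M"
    and arg: "\<And>n \<omega>. 1 \<le> n \<Longrightarrow> \<omega> \<in> space M \<Longrightarrow>
       is_arg_min (\<lambda>\<theta>. truncated_likelihood n (R' n \<theta> \<omega>) (Matrix.vec n (obs \<omega>))) (\<lambda>\<theta>. \<theta> \<in> \<Theta>) (\<theta>hat n \<omega>)"
  shows "tendsto_in_prob M (\<lambda>n \<omega>. if n = 0 then 0 else divergence n (\<theta>hat n \<omega>) \<omega> - (INF \<theta>\<in>\<Theta>. divergence n \<theta> \<omega>)) 0"
proof -
  define \<delta> where "\<delta> = (\<lambda>n \<omega>. if n = 0 then 0 else divergence n (\<theta>hat n \<omega>) \<omega> - (INF \<theta>\<in>\<Theta>. divergence n \<theta> \<omega>))"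
  have in\<Theta>: "\<theta>hat n \<omega> \<in> \<Theta>" and min: "\<theta> \<in> \<Theta> \<Longrightarrow> truncated_likelihood n (R' n (\<theta>hat n \<omega>) \<omega>) (Matrix.vec n (obs \<omega>))
      \<le> truncated_likelihood n (R' n \<theta> \<omega>) (Matrix.vec n (obs \<omega>))"
    if "1 \<le> n" "\<omega> \<in> space M" for n \<omega> \<theta>
    using arg[OF that] by (auto simp: is_arg_min_def not_less)
  have \<delta>m: "\<delta> n \<in> borel_measurable M" for n
  proof (cases "n = 0")
    case False
    then have n: "1 \<le> n" by simp
    show ?thesis
      using False borel_measurable_diff[OF divergence_measurable[OF \<theta>m[OF n] in\<Theta>[OF n]] divergence_INF_measurable[OF n]]
      by (simp add: \<delta>_def)
  qed (simp add: \<delta>_def)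
  have "(\<lambda>n. prob {\<omega> \<in> space M. \<epsilon> < \<bar>\<delta> n \<omega> - 0\<bar>}) \<longlonglongrightarrow> 0" if \<epsilon>: "0 < \<epsilon>" for \<epsilon>
  proof (rule LIMSEQ_I)
    fix \<zeta> :: real assume \<zeta>: "0 < \<zeta>"
    \<comment> \<open>by Markov's inequality the mean square exceeds this level with probability below \<open>\<zeta> / 2\<close>\<close>
    define H where "H = 2 * (c0 0 + 1) / \<zeta>"
    have H: "0 < H" using \<zeta> variance_nonneg by (simp add: H_def)
    have tail: "c0 0 / H < \<zeta> / 2"
    proof -
      have "\<zeta> / 2 * H = c0 0 + 1" using \<zeta> by (simp add: H_def)
      then show ?thesis unfolding pos_divide_less_eq[OF H] by linarith
    qed
    \<comment> \<open>mesh of the net: as long as the mean square is at most \<open>H\<close>, moving \<open>\<theta>\<close> by this much changes the fluctuation by at most \<open>\<epsilon> / 16\<close>\<close>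
    define h where "h = \<epsilon> / 16 * \<mu>\<^sup>2 / ((L + 1) * (H + c0 0))"
    have Hc: "0 < H + c0 0" using H variance_nonneg by simp
    have h: "0 < h" using \<epsilon> pos Hc by (simp add: h_def)
    have h': "L * h / \<mu>\<^sup>2 * (H + c0 0) \<le> \<epsilon> / 16"
    proof -
      have "L * h / \<mu>\<^sup>2 * (H + c0 0) \<le> (L + 1) * h / \<mu>\<^sup>2 * (H + c0 0)"
        using h Hc by (intro mult_right_mono divide_right_mono) auto
      also have "\<dots> = \<epsilon> / 16"
      proof -
        have "l * (e * m / (l * g)) / m * g = e" if "l \<noteq> 0" "m \<noteq> 0" "g \<noteq> 0" for l e m g :: real
          using that by simp
        from this[of "L + 1" "\<mu>\<^sup>2" "H + c0 0" "\<epsilon> / 16"] show ?thesis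
          using pos Hc unfolding h_def by auto
      qed
      finally show ?thesis .
    qed
    have "\<exists>k. finite k \<and> k \<subseteq> \<Theta> \<and> \<Theta> \<subseteq> (\<Union>x\<in>k. ball x h)"
      by (rule seq_compact_imp_totally_bounded[OF compact_imp_seq_compact[OF compact], rule_format, OF h])
    then obtain k where k: "finite k" "k \<subseteq> \<Theta>" "\<Theta> \<subseteq> (\<Union>x\<in>k. ball x h)" by blast
    define B where "B = 4 / \<mu> + 4 / \<mu>\<^sup>2 * H"
    have B: "0 < B" using pos H by (simp add: B_def add_pos_pos)
    \<comment> \<open>accuracy of the matrices that costs the likelihood at most \<open>\<epsilon> / 16\<close> while the mean square is at most \<open>H\<close>\<close>
    define \<eta> where "\<eta> = min (\<mu> / 4) (\<epsilon> / 16 / B)"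
    have \<eta>: "0 < \<eta>" "\<eta> \<le> \<mu> / 4" "B * \<eta> \<le> \<epsilon> / 16"
    proof -
      show "0 < \<eta>" using pos B \<epsilon> by (simp add: \<eta>_def)
      show "\<eta> \<le> \<mu> / 4" by (simp only: \<eta>_def min.cobounded1)
      have "\<eta> \<le> \<epsilon> / 16 / B" by (simp only: \<eta>_def min.cobounded2)
      then show "B * \<eta> \<le> \<epsilon> / 16" using B by (simp only: pos_le_divide_eq mult.commute)
    qed
    obtain N where N: "1 \<le> N" "\<And>n \<theta> \<omega>. N \<le> n \<Longrightarrow> \<theta> \<in> \<Theta> \<Longrightarrow> \<omega> \<in> space M \<Longrightarrow>
      \<bar>truncated_likelihood n (R' n \<theta> \<omega>) (Matrix.vec n (obs \<omega>)) - (divergence n \<theta> \<omega> + ln (det (K n \<omega>)) / real n + 1)\<bar>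
      \<le> (4 / \<mu> + 4 / \<mu>\<^sup>2 * (sq_norm n (obs \<omega>) / real n)) * \<eta> + \<bar>fluctuation n \<theta> \<omega>\<bar>"
      using approximatesD[OF R' \<eta>(1,2)] by metis
    have fm: "fluctuation n \<theta> \<in> borel_measurable M" if n: "n0 \<le> n" "1 \<le> n" and \<theta>: "\<theta> \<in> \<Theta>" and n0: "\<forall>n\<ge>n0. \<forall>s. near_sites \<tau> v s \<longrightarrow>
       (\<Sum>i<n. \<Sum>j<n. (c0 (s (Suc i) - s (Suc j)))\<^sup>2) \<le> 1 * (real n)\<^sup>2" for n n0 \<theta>
      using n n0 by (intro fluctuation_second_moment(1)[OF \<theta> n(2), of 1]) blast
    obtain n0 where n0: "\<forall>n\<ge>n0. \<forall>s. near_sites \<tau> v s \<longrightarrow>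
       (\<Sum>i<n. \<Sum>j<n. (c0 (s (Suc i) - s (Suc j)))\<^sup>2) \<le> 1 * (real n)\<^sup>2"
      using K_decay[of 1] by auto
    have "(\<lambda>n. \<Sum>\<theta>\<in>k. prob {\<omega> \<in> space M. \<epsilon> / 16 < \<bar>fluctuation n \<theta> \<omega>\<bar>}) \<longlonglongrightarrow> (\<Sum>\<theta>\<in>k. 0)"
      using k(2) \<epsilon> by (intro tendsto_sum fluctuation_tendsto_0) auto
    then have lim: "(\<lambda>n. \<Sum>\<theta>\<in>k. prob {\<omega> \<in> space M. \<epsilon> / 16 < \<bar>fluctuation n \<theta> \<omega>\<bar>}) \<longlonglongrightarrow> 0"
      by (simp only: sum.neutral_const)
    have "\<forall>\<^sub>F n in sequentially. (\<Sum>\<theta>\<in>k. prob {\<omega> \<in> space M. \<epsilon> / 16 < \<bar>fluctuation n \<theta> \<omega>\<bar>}) < \<zeta> / 2"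
      by (rule order_tendstoD(2)[OF lim]) (use \<zeta> in simp)
    then obtain N2 where N2: "\<And>n. N2 \<le> n \<Longrightarrow> (\<Sum>\<theta>\<in>k. prob {\<omega> \<in> space M. \<epsilon> / 16 < \<bar>fluctuation n \<theta> \<omega>\<bar>}) < \<zeta> / 2"
      unfolding eventually_sequentially by blast
    have "norm (prob {\<omega> \<in> space M. \<epsilon> < \<bar>\<delta> n \<omega> - 0\<bar>} - 0) < \<zeta>" if n: "max N (max n0 N2) \<le> n" for n
    proof -
      have n1: "1 \<le> n" "N \<le> n" "n0 \<le> n" "N2 \<le> n" using n N(1) by auto
      let ?E = "{\<omega> \<in> space M. H < sq_norm n (obs \<omega>) / real n}"
      let ?F = "\<lambda>\<theta>. {\<omega> \<in> space M. \<epsilon> / 16 < \<bar>fluctuation n \<theta> \<omega>\<bar>}"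
      note [measurable] = mean_square_bound(1)[OF n1(1)]
      have Fm: "?F \<theta> \<in> events" if "\<theta> \<in> k" for \<theta>
      proof -
        have [measurable]: "fluctuation n \<theta> \<in> borel_measurable M"
          using that k(2) by (intro fm[OF n1(3,1) _ n0]) auto
        show ?thesis by measurable
      qed
      have Em: "?E \<in> events" by measurable
      have sub: "{\<omega> \<in> space M. \<epsilon> < \<bar>\<delta> n \<omega> - 0\<bar>} \<subseteq> ?E \<union> (\<Union>\<theta>\<in>k. ?F \<theta>)"
      proof (rule subsetI, rule ccontr)
        fix \<omega> assume "\<omega> \<in> {\<omega> \<in> space M. \<epsilon> < \<bar>\<delta> n \<omega> - 0\<bar>}" and good: "\<omega> \<notin> ?E \<union> (\<Union>\<theta>\<in>k. ?F \<theta>)"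
        then have \<omega>: "\<omega> \<in> space M" and bad: "\<epsilon> < \<bar>\<delta> n \<omega>\<bar>" by auto
        have E: "sq_norm n (obs \<omega>) / real n \<le> H" and F: "\<And>\<theta>. \<theta> \<in> k \<Longrightarrow> \<bar>fluctuation n \<theta> \<omega>\<bar> \<le> \<epsilon> / 16"
          using good \<omega> by (auto simp: not_less)
        have fl: "\<bar>fluctuation n \<theta> \<omega>\<bar> \<le> \<epsilon> / 16 + \<epsilon> / 16" if \<theta>: "\<theta> \<in> \<Theta>" for \<theta>
        proof -
          obtain \<theta>' where \<theta>': "\<theta>' \<in> k" "dist \<theta>' \<theta> < h" using k(3) \<theta> by auto
          have "\<bar>fluctuation n \<theta> \<omega> - fluctuation n \<theta>' \<omega>\<bar> \<le> L * dist \<theta>' \<theta> / \<mu>\<^sup>2 * (sq_norm n (obs \<omega>) / real n + c0 0)"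
            using \<theta>' k(2) by (intro fluctuation_lipschitz[OF _ \<theta> n1(1)]) auto
          also have "\<dots> \<le> L * h / \<mu>\<^sup>2 * (H + c0 0)"
            using \<theta>'(2) pos E sq_norm_nonneg variance_nonneg h
            by (intro mult_mono divide_right_mono mult_left_mono add_mono add_nonneg_nonneg divide_nonneg_nonneg mult_nonneg_nonneg) auto
          finally show ?thesis using h' F[OF \<theta>'(1)] by linarith
        qed
        have close: "\<bar>truncated_likelihood n (R' n \<theta> \<omega>) (Matrix.vec n (obs \<omega>)) - (divergence n \<theta> \<omega> + (ln (det (K n \<omega>)) / real n + 1))\<bar> \<le> 3 * (\<epsilon> / 16)"
          if \<theta>: "\<theta> \<in> \<Theta>" for \<theta>
        proof -
          have "(4 / \<mu> + 4 / \<mu>\<^sup>2 * (sq_norm n (obs \<omega>) / real n)) * \<eta> \<le> B * \<eta>"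
            unfolding B_def using E \<eta>(1) by (intro mult_right_mono add_left_mono mult_left_mono) auto
          then show ?thesis using N(2)[OF n1(2) \<theta> \<omega>] fl[OF \<theta>] \<eta>(3) by (simp only: add.assoc)
        qed
        have "\<bar>divergence n (\<theta>hat n \<omega>) \<omega> - (INF \<theta>\<in>\<Theta>. divergence n \<theta> \<omega>)\<bar> \<le> 2 * (3 * (\<epsilon> / 16))"
          by (rule near_minimizer_deterministic[OF n1(1) in\<Theta>[OF n1(1) \<omega>] min[OF n1(1) \<omega>] close])
        then show False using bad n1(1) \<epsilon> by (simp add: \<delta>_def)
      qed
      have "prob {\<omega> \<in> space M. \<epsilon> < \<bar>\<delta> n \<omega> - 0\<bar>} \<le> prob (?E \<union> (\<Union>\<theta>\<in>k. ?F \<theta>))"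
        using Em Fm k(1) by (intro finite_measure_mono[OF sub] sets.Un sets.finite_UN) auto
      also have "\<dots> \<le> prob ?E + prob (\<Union>\<theta>\<in>k. ?F \<theta>)"
        using Em Fm k(1) by (intro measure_Un_le sets.finite_UN) auto
      also have "prob (\<Union>\<theta>\<in>k. ?F \<theta>) \<le> (\<Sum>\<theta>\<in>k. prob (?F \<theta>))"
        using Fm by (intro finite_measure_subadditive_finite k(1)) auto
      also have "prob ?E \<le> c0 0 / H"
        by (rule markov_bound[OF mean_square_bound[OF n1(1)] H variance_nonneg])
      finally have "prob {\<omega> \<in> space M. \<epsilon> < \<bar>\<delta> n \<omega> - 0\<bar>} < \<zeta>"
        using tail N2[OF n1(4)] by linarith
      then show ?thesis by (simp add: measure_nonneg)
    qed
    then show "\<exists>no. \<forall>n\<ge>no. norm (prob {\<omega> \<in> space M. \<epsilon> < \<bar>\<delta> n \<omega> - 0\<bar>} - 0) < \<zeta>" by blast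
  qed
  then show ?thesis using \<delta>m unfolding tendsto_in_prob_def \<delta>_def[symmetric] by blast
qed

end

lemma bounded_with_support_inD:
  assumes "bounded_with_support_in B C f"
  shows "\<bar>f s\<bar> \<le> B" "C < norm s \<Longrightarrow> f s = 0"
  using assms closure_subset[of "{s. f s \<noteq> 0}"] by (auto simp: bounded_with_support_in_def)

section \<open>The tapered divergence and its approximation\<close>

theorem theorem7p1:
  fixes M :: "'w measure"
    and \<Theta> :: "(real ^ 'p) set" and \<theta>0 :: "real ^ 'p"
    and k khat :: "real ^ 'p \<Rightarrow> real ^ 'd \<Rightarrow> real"
    and dk :: "'p \<Rightarrow> real ^ 'p \<Rightarrow> real ^ 'd \<Rightarrow> real"
    and Z :: "real ^ 'd \<Rightarrow> 'w \<Rightarrow> real" and X :: "nat \<Rightarrow> 'w \<Rightarrow> real ^ 'd"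
    and \<tau> :: real and v :: "nat \<Rightarrow> real ^ 'd"
    and \<Theta>' :: "(real ^ 'l) set" and \<theta>0' :: "real ^ 'l" and \<beta>0 :: real
    and t that :: "real ^ 'l \<Rightarrow> real ^ 'd \<Rightarrow> real"
    and Dt :: "'l list \<Rightarrow> real ^ 'l \<Rightarrow> real ^ 'd \<Rightarrow> real"
    and ta :: "nat \<Rightarrow> real ^ 'l \<Rightarrow> real ^ 'd \<Rightarrow> real"
    and Dta :: "nat \<Rightarrow> 'l list \<Rightarrow> real ^ 'l \<Rightarrow> real ^ 'd \<Rightarrow> real"
    and r :: "nat \<Rightarrow> nat"
    and \<theta>hat :: "nat \<Rightarrow> 'w \<Rightarrow> real ^ 'p"
  defines "S \<equiv> \<lambda>\<omega> i. v i + \<tau> *\<^sub>R X i \<omega>"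
  defines "K \<equiv> \<lambda>n \<theta> \<omega>. cov_mat n (k \<theta>) (S \<omega>)"
    and "R \<equiv> \<lambda>n \<theta> \<omega>. cov_mat n (\<lambda>s. k \<theta> s * t \<theta>0' s) (S \<omega>)"
    and "R' \<equiv> \<lambda>n \<theta> \<omega>. cov_mat n (\<lambda>s. k \<theta> s * ta (r n) \<theta>0' s) (S \<omega>)"
    and "z \<equiv> \<lambda>n \<omega>. Matrix.vec n (\<lambda>i. Z (S \<omega> (Suc i)) \<omega>)"
  defines "d \<equiv> \<lambda>n \<theta> \<omega>. scaled_kl n (K n \<theta>0 \<omega>) (R n \<theta> \<omega>)"
    and "d' \<equiv> \<lambda>n \<theta> \<omega>. scaled_kl n (K n \<theta>0 \<omega>) (R' n \<theta> \<omega>)"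
  assumes "prob_space M"
    and "compact \<Theta>" "convex \<Theta>" "\<theta>0 \<in> \<Theta>"
    and "covariance_model \<Theta> k dk khat"
    and "centred_gaussian_field M Z (k \<theta>0)"
    and "iid_in_unit_cube M X"
    and "jointly_measurable_indep_field M Z X"
    and "0 \<le> \<tau>" "\<tau> < 1 / 2"
    and "enumerates_grid v"
    and "compact \<Theta>'" "convex \<Theta>'" "\<theta>0' \<in> \<Theta>'"
    and "taper_family \<Theta>' t Dt that"
    and "\<forall>s. \<beta>0 \<le> norm s \<longrightarrow> t \<theta>0' s = 0"
    and "taper_approximation \<Theta>' t Dt ta Dta"
    and "\<forall>n\<ge>1. 1 \<le> r n" "filterlim r at_top sequentially"
    and "\<forall>n\<ge>1. \<theta>hat n \<in> borel_measurable M"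
    and "\<forall>n\<ge>1. \<forall>\<omega>\<in>space M.
           is_arg_min (\<lambda>\<theta>. truncated_likelihood n (R' n \<theta> \<omega>) (z n \<omega>)) (\<lambda>\<theta>. \<theta> \<in> \<Theta>) (\<theta>hat n \<omega>)"
  shows "(\<exists>N\<ge>1. AE \<omega> in M. \<forall>n\<ge>N. \<forall>\<theta>\<in>\<Theta>. positive_definite (R' n \<theta> \<omega>)) \<and>
    (AE \<omega> in M. (\<lambda>n. SUP \<theta>\<in>\<Theta>. ereal \<bar>d n \<theta> \<omega> - d' n \<theta> \<omega>\<bar>) \<longlonglongrightarrow> 0) \<and>
    (\<exists>\<delta>. (\<forall>n\<ge>1. \<forall>\<omega>\<in>space M. d n (\<theta>hat n \<omega>) \<omega> = (INF \<theta>\<in>\<Theta>. d n \<theta> \<omega>) + \<delta> n \<omega>) \<and>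
         tendsto_in_prob M \<delta> 0)"
proof -
  interpret prob_space M by fact
  have conv: "convex \<Theta>" and comp: "compact \<Theta>" and \<theta>0: "\<theta>0 \<in> \<Theta>" and model: "covariance_model \<Theta> k dk khat"
    and field: "centred_gaussian_field M Z (k \<theta>0)" and iid: "iid_in_unit_cube M X"
    and indep: "jointly_measurable_indep_field M Z X"
    and \<tau>: "0 \<le> \<tau>" "\<tau> < 1 / 2" and grid: "enumerates_grid v" and \<theta>0': "\<theta>0' \<in> \<Theta>'"
    and taper: "taper_family \<Theta>' t Dt that"
    and approx: "taper_approximation \<Theta>' t Dt ta Dta"
    and r: "\<forall>n\<ge>1. 1 \<le> r n" "filterlim r at_top sequentially"
    and \<theta>m: "\<forall>n\<ge>1. \<theta>hat n \<in> borel_measurable M"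
    and argmin: "\<forall>n\<ge>1. \<forall>\<omega>\<in>space M.
           is_arg_min (\<lambda>\<theta>. truncated_likelihood n (R' n \<theta> \<omega>) (z n \<omega>)) (\<lambda>\<theta>. \<theta> \<in> \<Theta>) (\<theta>hat n \<omega>)"
    by fact+
  have v: "integer_sites v" by (rule enumerates_grid_integer_sites[OF grid])

  obtain A where A: "0 \<le> A" "\<And>\<theta> s. \<theta> \<in> \<Theta> \<Longrightarrow> \<bar>k \<theta> s\<bar> \<le> A"
    and A_decay: "\<And>\<theta> s. \<theta> \<in> \<Theta> \<Longrightarrow> 1 \<le> norm s \<Longrightarrow> \<bar>k \<theta> s\<bar> \<le> A / norm s"
    using covariance_model_bounded[OF model] by metis
  obtain Lk where Lk: "0 \<le> Lk" "\<And>\<theta> \<theta>' s. \<theta> \<in> \<Theta> \<Longrightarrow> \<theta>' \<in> \<Theta> \<Longrightarrow> \<bar>k \<theta> s - k \<theta>' s\<bar> \<le> Lk * dist \<theta> \<theta>'"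
    using covariance_model_lipschitz[OF model conv] by metis
  have k_even: "k \<theta> (- x) = k \<theta> x" if "\<theta> \<in> \<Theta>" for \<theta> x
    using model that by (simp add: covariance_model_def covariance_function_def)
  have psf_k: "positive_spectral_family \<Theta> k khat"
    using model by (simp add: covariance_model_def)
  note k0 = positive_spectral_familyD[OF psf_k \<theta>0]

  have psf_t: "positive_spectral_family \<Theta>' t that" and t_even: "t \<theta>0' (- x) = t \<theta>0' x" for x
    using taper \<theta>0' by (simp_all add: taper_family_def covariance_function_def)
  note t = positive_spectral_familyD[OF psf_t \<theta>0']
  have "\<exists>B C. \<forall>\<eta>\<in>\<Theta>'. bounded_with_support_in B C (t \<eta>)"
    using taper by (simp add: taper_family_def)
  then obtain Bt Ct where t_supp: "bounded_with_support_in Bt Ct (t \<theta>0')" using \<theta>0' by blast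
  have Bt: "0 \<le> Bt" using bounded_with_support_inD(1)[OF t_supp, of 0] by linarith
  have "\<exists>B C. \<forall>m\<ge>1. \<forall>\<eta>\<in>\<Theta>'. bounded_with_support_in B C (ta m \<eta>)"
    using approx unfolding taper_approximation_def by (elim conjE)
  then obtain Ba Ca where ta_supp: "\<And>m. 1 \<le> m \<Longrightarrow> bounded_with_support_in Ba Ca (ta m \<theta>0')" using \<theta>0' by blast
  have ta_even: "ta m \<theta>0' (- x) = ta m \<theta>0' x" if "1 \<le> m" for m x
  proof -
    have "\<forall>m\<ge>1. \<forall>\<eta>\<in>\<Theta>'. ta m \<eta> \<in> borel_measurable borel \<and> (\<forall>s. ta m \<eta> s = ta m \<eta> (- s))"
      using approx unfolding taper_approximation_def by (elim conjE)
    then show ?thesis using that \<theta>0' by metis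
  qed
  define C where "C = max Ct Ca"
  have t_zero: "t \<theta>0' x = 0" if "C < norm x" for x
    using bounded_with_support_inD(2)[OF t_supp, of x] that by (simp add: C_def)
  have ta_zero: "ta m \<theta>0' x = 0" if "C < norm x" "1 \<le> m" for m x
    using bounded_with_support_inD(2)[OF ta_supp[OF that(2)], of x] that by (simp add: C_def)
  obtain W where W: "\<And>s n i. near_sites \<tau> v s \<Longrightarrow> card {j. j < n \<and> norm (s (Suc i) - s (Suc j)) \<le> C} \<le> W"
    using neighbour_count[OF v \<tau>(2), of C] by blast
  have ta_close: "\<exists>N. \<forall>n\<ge>N. \<forall>x. \<bar>ta (r n) \<theta>0' x - t \<theta>0' x\<bar> \<le> e" if e: "0 < e" for e
  proof -
    have "(\<lambda>m. SUP \<eta>\<in>\<Theta>'. sup_norm (\<lambda>s. ta m \<eta> s - t \<eta> s)) \<longlonglongrightarrow> 0"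
      using approx unfolding taper_approximation_def by (elim conjE)
    then have "\<forall>\<^sub>F m in sequentially. (SUP \<eta>\<in>\<Theta>'. sup_norm (\<lambda>s. ta m \<eta> s - t \<eta> s)) < ereal e"
      by (rule order_tendstoD(2)) (use e in simp)
    then have "\<forall>\<^sub>F m in sequentially. \<forall>x. \<bar>ta m \<theta>0' x - t \<theta>0' x\<bar> \<le> e"
    proof eventually_elim
      case (elim m)
      show ?case
      proof
        fix x
        have "ereal \<bar>ta m \<theta>0' x - t \<theta>0' x\<bar> \<le> sup_norm (\<lambda>s. ta m \<theta>0' s - t \<theta>0' s)"
          unfolding sup_norm_def by (rule SUP_upper) simp
        also have "\<dots> \<le> (SUP \<eta>\<in>\<Theta>'. sup_norm (\<lambda>s. ta m \<eta> s - t \<eta> s))"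
          by (rule SUP_upper[OF \<theta>0'])
        finally have "ereal \<bar>ta m \<theta>0' x - t \<theta>0' x\<bar> < ereal e" using elim by (rule le_less_trans)
        then show "\<bar>ta m \<theta>0' x - t \<theta>0' x\<bar> \<le> e" by simp
      qed
    qed
    from eventually_compose_filterlim[OF this r(2)] show ?thesis
      unfolding eventually_sequentially .
  qed

  define c where "c = (\<lambda>\<theta> x. k \<theta> x * t \<theta>0' x)"
  obtain \<mu> where \<mu>: "0 < \<mu>" "\<And>n \<theta> s. \<theta> \<in> \<Theta> \<Longrightarrow> near_sites \<tau> v s \<Longrightarrow> coercive n \<mu> (cov_mat n (c \<theta>) s)"
    unfolding c_def using tapered_coercive[OF model conv comp \<theta>0 v \<tau> t t_even] by metis
  obtain \<nu> where \<nu>: "0 < \<nu>" "\<And>n s y. near_sites \<tau> v s \<Longrightarrow>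
     \<nu> * sq_norm n y \<le> quadratic_form n (\<lambda>i j. k \<theta>0 (s (Suc i) - s (Suc j))) y"
    using spectral_lower_bound[OF v \<tau> k0] by auto
  obtain G where G: "subalgebra M G" "(\<lambda>(s, \<omega>). Z s \<omega>) \<in> borel_measurable (borel \<Otimes>\<^sub>M G)"
     "indep_set (sets G) (sets (vimage_algebra (space M) (\<lambda>\<omega>. \<lambda>i\<in>{1..}. X i \<omega>) (\<Pi>\<^sub>M i\<in>{1..}. borel)))"
    using indep unfolding jointly_measurable_indep_field_def by blast

  interpret T: tapered_sampling M c "k \<theta>0" \<Theta> \<mu> \<nu> "real W * (Lk * Bt)" \<tau> v Z X G
  proof
    show "compact \<Theta>" "\<Theta> \<noteq> {}" using comp \<theta>0 by auto
    show "0 < \<mu>" "0 < \<nu>" "0 \<le> real W * (Lk * Bt)" "0 \<le> \<tau>" using \<mu> \<nu> Lk Bt \<tau> by auto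
    have "continuous_on (\<Theta> \<times> UNIV) (\<lambda>p. (\<lambda>(\<theta>, s). k \<theta> s) p * t \<theta>0' (snd p))"
      by (intro continuous_on_mult covariance_model_continuous[OF model conv]
          continuous_on_compose2[OF cosine_transform_continuous[OF t(1)]] continuous_intros) auto
    then show "continuous_on (\<Theta> \<times> UNIV) (\<lambda>(\<theta>, s). c \<theta> s)"
      by (simp add: c_def case_prod_beta)
    show "continuous_on UNIV (k \<theta>0)" by (rule cosine_transform_continuous[OF k0(1)])
    show "k \<theta>0 (- x) = k \<theta>0 x" for x by (rule k_even[OF \<theta>0])
    show "coercive n \<mu> (cov_mat n (c \<theta>) s)" if "\<theta> \<in> \<Theta>" "near_sites \<tau> v s" for n \<theta> s
      by (rule \<mu>(2)[OF that])
    show "coercive n \<nu> (cov_mat n (k \<theta>0) s)" if "near_sites \<tau> v s" for n s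
      by (rule coercive_cov_mat[OF k_even[OF \<theta>0] \<nu>(2)[OF that]])
    show "\<bar>bilinear_form n (\<lambda>i j. cov_mat n (c \<theta>') s $$ (i, j) - cov_mat n (c \<theta>) s $$ (i, j)) x y\<bar>
         \<le> real W * (Lk * Bt) * dist \<theta> \<theta>' * (sq_norm n x + sq_norm n y) / 2"
      if \<theta>: "\<theta> \<in> \<Theta>" "\<theta>' \<in> \<Theta>" and s: "near_sites \<tau> v s" for n \<theta> \<theta>' s x y
    proof -
      let ?g = "\<lambda>u. c \<theta>' u - c \<theta> u"
      have "\<bar>bilinear_form n (\<lambda>i j. ?g (s (Suc i) - s (Suc j))) x y\<bar> \<le> real W * (Lk * dist \<theta> \<theta>' * Bt) * (sq_norm n x + sq_norm n y) / 2"
      proof (rule local_kernel_bilinear_bound[OF W[OF s]])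
        fix u
        have "?g u = (k \<theta>' u - k \<theta> u) * t \<theta>0' u" by (simp add: c_def left_diff_distrib)
        then show "\<bar>?g u\<bar> \<le> Lk * dist \<theta> \<theta>' * Bt"
          using Lk(2)[OF \<theta>(2,1), of u] Lk(1) Bt bounded_with_support_inD(1)[OF t_supp, of u]
          by (simp add: abs_mult dist_commute mult_mono)
        show "?g u = 0" if "C < norm u" using t_zero[OF that] by (simp add: c_def)
        show "?g (- u) = ?g u" using k_even[OF \<theta>(1)] k_even[OF \<theta>(2)] t_even by (simp add: c_def)
      qed
      moreover have "bilinear_form n (\<lambda>i j. cov_mat n (c \<theta>') s $$ (i, j) - cov_mat n (c \<theta>) s $$ (i, j)) x y
          = bilinear_form n (\<lambda>i j. ?g (s (Suc i) - s (Suc j))) x y"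
        by (rule bilinear_form_cong) (simp add: cov_mat_entry)
      ultimately show ?thesis by (simp add: mult_ac)
    qed
    show "\<bar>\<Sum>i<n. \<Sum>j<n. E i j * cov_mat n (k \<theta>0) s $$ (i, j)\<bar> \<le> e * k \<theta>0 0 * real n"
      if "\<And>x. \<bar>quadratic_form n E x\<bar> \<le> e * sq_norm n x" for n s E e
      using trace_bound[OF k0(1) less_imp_le[OF k0(3)] that, where s = "\<lambda>i. s (Suc i)"] by (simp add: cov_mat_entry)
    show "\<exists>n0. \<forall>n\<ge>n0. \<forall>s. near_sites \<tau> v s \<longrightarrow>
       (\<Sum>i<n. \<Sum>j<n. (k \<theta>0 (s (Suc i) - s (Suc j)))\<^sup>2) \<le> \<epsilon> * (real n)\<^sup>2" if "0 < \<epsilon>" for \<epsilon>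
      using sum_squares_decay[OF v \<tau>(2) A(2)[OF \<theta>0] A_decay[OF \<theta>0] that] by metis
    show "centred_gaussian_field M Z (k \<theta>0)" by (rule field)
    show "X i \<in> borel_measurable M" if "1 \<le> i" for i
      using iid that by (simp add: iid_in_unit_cube_def indep_vars_def)
    show "X i \<omega> \<in> unit_cube" if "1 \<le> i" "\<omega> \<in> space M" for i \<omega>
      using iid that by (simp add: iid_in_unit_cube_def)
  qed (rule G)+

  have S_eq: "cov_mat n f (S \<omega>) = cov_mat n f (T.S \<omega>)" if "\<omega> \<in> space M" for n f \<omega>
    using T.X_cube[OF _ that] by (intro cov_mat_cong) (simp add: S_def sites_def clip_in_unit_cube)
  have z_eq: "z n \<omega> = Matrix.vec n (T.obs \<omega>)" if "\<omega> \<in> space M" for n \<omega>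
    using T.X_cube[OF _ that] by (simp add: z_def S_def sites_def clip_in_unit_cube)
  have d_eq: "d n \<theta> \<omega> = T.divergence n \<theta> \<omega>" and d'_eq: "d' n \<theta> \<omega> = scaled_kl n (T.K n \<omega>) (R' n \<theta> \<omega>)"
    if "\<omega> \<in> space M" for n \<theta> \<omega>
    using S_eq[OF that] by (simp_all add: d_def d'_def K_def R_def c_def)

  have R': "T.approximates R'"
    unfolding T.approximates_def
  proof (intro allI impI)
    fix \<epsilon> :: real assume \<epsilon>: "0 < \<epsilon>"
    \<comment> \<open>the denominator is increased by \<open>1\<close> so that it is positive\<close>
    define e where "e = \<epsilon> / (real W * A + 1)"
    have WA: "0 \<le> real W * A" using A(1) by simp
    have e: "0 < e" "real W * (A * e) \<le> \<epsilon>"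
      using \<epsilon> WA mult_right_mono[of "real W * A" "real W * A + 1" e] by (auto simp: e_def mult.assoc[symmetric])
    obtain N where N: "\<And>n x. N \<le> n \<Longrightarrow> \<bar>ta (r n) \<theta>0' x - t \<theta>0' x\<bar> \<le> e" using ta_close[OF e(1)] by blast
    show "\<exists>N. \<forall>n\<ge>N. \<forall>\<theta>\<in>\<Theta>. \<forall>\<omega>\<in>space M.
     R' n \<theta> \<omega> \<in> carrier_mat n n \<and> (\<forall>i<n. \<forall>j<n. R' n \<theta> \<omega> $$ (i, j) = R' n \<theta> \<omega> $$ (j, i)) \<and>
     (\<forall>x y. \<bar>bilinear_form n (\<lambda>i j. R' n \<theta> \<omega> $$ (i, j) - T.R n \<theta> \<omega> $$ (i, j)) x y\<bar> \<le> \<epsilon> * (sq_norm n x + sq_norm n y) / 2)"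
    proof (intro exI[of _ "max 1 N"] allI impI ballI conjI)
      fix n \<theta> \<omega> assume n: "max 1 N \<le> n" and \<theta>: "\<theta> \<in> \<Theta>" and \<omega>: "\<omega> \<in> space M"
      have rn: "1 \<le> r n" using r(1) n by auto
      let ?f = "\<lambda>x. k \<theta> x * ta (r n) \<theta>0' x"
      have R'_eq: "R' n \<theta> \<omega> = cov_mat n ?f (T.S \<omega>)" using S_eq[OF \<omega>] by (simp add: R'_def)
      have f_even: "?f (- x) = ?f x" for x using k_even[OF \<theta>] ta_even[OF rn] by simp
      show "R' n \<theta> \<omega> \<in> carrier_mat n n" unfolding R'_eq by (rule cov_mat_carrier)
      show "R' n \<theta> \<omega> $$ (i, j) = R' n \<theta> \<omega> $$ (j, i)" if "i < n" "j < n" for i j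
        unfolding R'_eq using that f_even[of "T.S \<omega> (Suc i) - T.S \<omega> (Suc j)"] by (simp add: cov_mat_entry)
      fix x y
      let ?g = "\<lambda>u. ?f u - c \<theta> u"
      have "\<bar>bilinear_form n (\<lambda>i j. ?g (T.S \<omega> (Suc i) - T.S \<omega> (Suc j))) x y\<bar> \<le> real W * (A * e) * (sq_norm n x + sq_norm n y) / 2"
      proof (rule local_kernel_bilinear_bound[OF W[OF T.near]])
        fix u
        have "?g u = k \<theta> u * (ta (r n) \<theta>0' u - t \<theta>0' u)" by (simp add: c_def right_diff_distrib)
        then show "\<bar>?g u\<bar> \<le> A * e"
          using A(2)[OF \<theta>, of u] A(1) N[of n u] n by (simp add: abs_mult mult_mono)
        show "?g u = 0" if "C < norm u" using t_zero[OF that] ta_zero[OF that rn] by (simp add: c_def)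
        show "?g (- u) = ?g u" using f_even[of u] k_even[OF \<theta>] t_even by (simp add: c_def)
      qed
      also have "\<dots> \<le> \<epsilon> * (sq_norm n x + sq_norm n y) / 2"
        using e(2) sq_norm_nonneg[of n x] sq_norm_nonneg[of n y] by (intro divide_right_mono mult_right_mono) auto
      finally have "\<bar>bilinear_form n (\<lambda>i j. ?g (T.S \<omega> (Suc i) - T.S \<omega> (Suc j))) x y\<bar> \<le> \<epsilon> * (sq_norm n x + sq_norm n y) / 2" .
      moreover have "bilinear_form n (\<lambda>i j. R' n \<theta> \<omega> $$ (i, j) - T.R n \<theta> \<omega> $$ (i, j)) x y
          = bilinear_form n (\<lambda>i j. ?g (T.S \<omega> (Suc i) - T.S \<omega> (Suc j))) x y"
        unfolding R'_eq by (rule bilinear_form_cong) (simp add: cov_mat_entry)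
      ultimately show "\<bar>bilinear_form n (\<lambda>i j. R' n \<theta> \<omega> $$ (i, j) - T.R n \<theta> \<omega> $$ (i, j)) x y\<bar> \<le> \<epsilon> * (sq_norm n x + sq_norm n y) / 2"
        by (simp only:)
    qed
  qed

  have 1: "\<exists>N\<ge>1. AE \<omega> in M. \<forall>n\<ge>N. \<forall>\<theta>\<in>\<Theta>. positive_definite (R' n \<theta> \<omega>)"
  proof -
    obtain N where N: "1 \<le> N" "\<forall>n\<ge>N. \<forall>\<theta>\<in>\<Theta>. \<forall>\<omega>\<in>space M. positive_definite (R' n \<theta> \<omega>)"
      using T.approximating_positive_definite[OF R'] by blast
    have "AE \<omega> in M. \<forall>n\<ge>N. \<forall>\<theta>\<in>\<Theta>. positive_definite (R' n \<theta> \<omega>)"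
      by (rule AE_I2) (use N(2) in blast)
    then show ?thesis using N(1) by blast
  qed
  have 2: "AE \<omega> in M. (\<lambda>n. SUP \<theta>\<in>\<Theta>. ereal \<bar>d n \<theta> \<omega> - d' n \<theta> \<omega>\<bar>) \<longlonglongrightarrow> 0"
  proof (rule AE_I2)
    fix \<omega> assume \<omega>: "\<omega> \<in> space M"
    show "(\<lambda>n. SUP \<theta>\<in>\<Theta>. ereal \<bar>d n \<theta> \<omega> - d' n \<theta> \<omega>\<bar>) \<longlonglongrightarrow> 0"
      unfolding d_eq[OF \<omega>] d'_eq[OF \<omega>] by (rule T.divergence_approximation[OF R' \<omega>])
  qed
  define \<delta> where "\<delta> = (\<lambda>n \<omega>. if n = 0 then 0 else T.divergence n (\<theta>hat n \<omega>) \<omega> - (INF \<theta>\<in>\<Theta>. T.divergence n \<theta> \<omega>))"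
  have "tendsto_in_prob M \<delta> 0"
    unfolding \<delta>_def
  proof (rule T.estimator_near_optimal[OF R'])
    show "\<theta>hat n \<in> borel_measurable M" if "1 \<le> n" for n using \<theta>m that by blast
    show "is_arg_min (\<lambda>\<theta>. truncated_likelihood n (R' n \<theta> \<omega>) (Matrix.vec n (T.obs \<omega>))) (\<lambda>\<theta>. \<theta> \<in> \<Theta>) (\<theta>hat n \<omega>)"
      if "1 \<le> n" "\<omega> \<in> space M" for n \<omega>
      unfolding z_eq[OF that(2), symmetric] using argmin that by blast
  qed
  moreover have "d n (\<theta>hat n \<omega>) \<omega> = (INF \<theta>\<in>\<Theta>. d n \<theta> \<omega>) + \<delta> n \<omega>" if "1 \<le> n" "\<omega> \<in> space M" for n \<omega>
    unfolding d_eq[OF that(2)] using that(1) by (simp add: \<delta>_def)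
  ultimately have 3: "\<exists>\<delta>. (\<forall>n\<ge>1. \<forall>\<omega>\<in>space M. d n (\<theta>hat n \<omega>) \<omega> = (INF \<theta>\<in>\<Theta>. d n \<theta> \<omega>) + \<delta> n \<omega>) \<and>
         tendsto_in_prob M \<delta> 0"
    by blast
  show ?thesis using 1 2 3 by blast
qed

end
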